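(* Let $k$ be a field of characteristic different from $2$, let $G$ be a group with an involution $\ast$, and let $N$ be a $\ast$-invariant normal subgroup of $G$ such that $G/N$ is a nonabelian torsion-free nilpotent group. Let $D$ be a division ring and $k[G]\hookrightarrow D$ an embedding which is a good embedding for $k[N]$, and suppose that the $k$-involution on $k[G]$ induced by $\ast$ extends to a $k$-involution of $D$. Then $D_G$ contains a free symmetric pair with respect to this $k$-involution.
   Context: An involution on a group is an anti-automorphism of order $2$; a $k$-involution on a $k$-algebra is a $k$-linear map $\ast$ with $(xy)^\ast=y^\ast x^\ast$, $(x^\ast)^\ast=x$; the $k$-linear extension of a group involution to $k[G]$ is a $k$-involution. A free symmetric pair is a pair $u,v$ with $u^\ast=u$, $v^\ast=v$ generating a free subgroup of rank $2$ of the multiplicative group. If $k[G]$ embeds in a division ring $D$ and $H\le G$, $D_H$ denotes the division subring of $D$ generated by $k[H]$. For a normal subgroup $N$ of $G$, the embedding $k[G]\hookrightarrow D$ is a good embedding for $k[N]$ if: (i) $G/N$ is orderable (admits a total order invariant under left and right multiplication); (ii) for every division ring $F$, every crossed product $F[\overline{G/N};\sigma,\tau]$ (free left $F$-module on a copy $\overline{G/N}$ of $G/N$ with $\overline{\alpha}r=r^{\sigma(\alpha)}\overline{\alpha}$, $\overline{\alpha}\,\overline{\beta}=\tau(\alpha,\beta)\overline{\alpha\beta}$ for maps $\sigma\colon G/N\to\operatorname{Aut}(F)$, $\tau\colon G/N\times G/N\to F^\bullet$, associative) is an Ore domain; (iii) there is a left transversal $\{x_\alpha\}_{\alpha\in G/N}$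 of $N$ in $G$ which is left linearly independent over $D_N$. *)

theory Defs
  imports "HOL-Algebra.Ring" "HOL-Algebra.Coset" "HOL-Algebra.Generated_Groups" "HOL-Algebra.RingHom"
begin

definition division_ring :: "('a, 'b) ring_scheme \<Rightarrow> bool" where
  "division_ring R \<longleftrightarrow> ring R \<and> \<one>\<^bsub>R\<^esub> \<noteq> \<zero>\<^bsub>R\<^esub> \<and>
     (\<forall>x \<in> carrier R - {\<zero>\<^bsub>R\<^esub>}. x \<in> Units R)"

definition ore_domain :: "('a, 'b) ring_scheme \<Rightarrow> bool" where
  "ore_domain R \<longleftrightarrow> ring R \<and> \<one>\<^bsub>R\<^esub> \<noteq> \<zero>\<^bsub>R\<^esub> \<and>
     (\<forall>a \<in> carrier R. \<forall>b \<in> carrier R. a \<otimes>\<^bsub>R\<^esub> b = \<zero>\<^bsub>R\<^esub> \<longrightarrow> a = \<zero>\<^bsub>R\<^esub> \<or> b = \<zero>\<^bsub>R\<^esub>) \<and>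
     (\<forall>a \<in> carrier R - {\<zero>\<^bsub>R\<^esub>}. \<forall>b \<in> carrier R - {\<zero>\<^bsub>R\<^esub>}.
        \<exists>r \<in> carrier R. \<exists>s \<in> carrier R. r \<otimes>\<^bsub>R\<^esub> a = s \<otimes>\<^bsub>R\<^esub> b \<and> r \<otimes>\<^bsub>R\<^esub> a \<noteq> \<zero>\<^bsub>R\<^esub>) \<and>
     (\<forall>a \<in> carrier R - {\<zero>\<^bsub>R\<^esub>}. \<forall>b \<in> carrier R - {\<zero>\<^bsub>R\<^esub>}.
        \<exists>r \<in> carrier R. \<exists>s \<in> carrier R. a \<otimes>\<^bsub>R\<^esub> r = b \<otimes>\<^bsub>R\<^esub> s \<and> a \<otimes>\<^bsub>R\<^esub> r \<noteq> \<zero>\<^bsub>R\<^esub>)"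

definition div_closed :: "('a, 'b) ring_scheme \<Rightarrow> 'a set \<Rightarrow> bool" where
  "div_closed D T \<longleftrightarrow> T \<subseteq> carrier D \<and> \<zero>\<^bsub>D\<^esub> \<in> T \<and> \<one>\<^bsub>D\<^esub> \<in> T \<and>
     (\<forall>x \<in> T. \<forall>y \<in> T. x \<oplus>\<^bsub>D\<^esub> y \<in> T \<and> x \<otimes>\<^bsub>D\<^esub> y \<in> T) \<and>
     (\<forall>x \<in> T. \<ominus>\<^bsub>D\<^esub> x \<in> T) \<and>
     (\<forall>x \<in> T - {\<zero>\<^bsub>D\<^esub>}. inv\<^bsub>D\<^esub> x \<in> T)"

definition div_generated :: "('a, 'b) ring_scheme \<Rightarrow> 'a set \<Rightarrow> 'a set" where
  "div_generated D S = \<Inter> {T. div_closed D T \<and> S \<subseteq> T}"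

text \<open>D_H: the division subring of D generated by the image of k[H]
  under the embedding given by psi (on k) and phi (on G).\<close>
definition D_sub :: "('a, 'b) ring_scheme \<Rightarrow> ('k \<Rightarrow> 'a) \<Rightarrow> 'k set \<Rightarrow> ('g \<Rightarrow> 'a) \<Rightarrow> 'g set \<Rightarrow> 'a set" where
  "D_sub D \<psi> K \<phi> H = div_generated D (\<psi> ` K \<union> \<phi> ` H)"

definition group_involution :: "('g, 'c) monoid_scheme \<Rightarrow> ('g \<Rightarrow> 'g) \<Rightarrow> bool" where
  "group_involution G s \<longleftrightarrow> (\<forall>x \<in> carrier G. s x \<in> carrier G) \<and>
     (\<forall>x \<in> carrier G. \<forall>y \<in> carrier G. s (x \<otimes>\<^bsub>G\<^esub> y) = s y \<otimes>\<^bsub>G\<^esub> s x) \<and>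
     (\<forall>x \<in> carrier G. s (s x) = x)"

definition comm_set :: "('g, 'c) monoid_scheme \<Rightarrow> 'g set \<Rightarrow> 'g set \<Rightarrow> 'g set" where
  "comm_set G A B = {a \<otimes>\<^bsub>G\<^esub> b \<otimes>\<^bsub>G\<^esub> inv\<^bsub>G\<^esub> a \<otimes>\<^bsub>G\<^esub> inv\<^bsub>G\<^esub> b | a b. a \<in> A \<and> b \<in> B}"

fun lower_central :: "('g, 'c) monoid_scheme \<Rightarrow> nat \<Rightarrow> 'g set" where
  "lower_central G 0 = carrier G"
| "lower_central G (Suc n) = generate G (comm_set G (lower_central G n) (carrier G))"

definition nilpotent_group :: "('g, 'c) monoid_scheme \<Rightarrow> bool" where
  "nilpotent_group G \<longleftrightarrow> group G \<and> (\<exists>n. lower_central G n = {\<one>\<^bsub>G\<^esub>})"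

definition torsion_free :: "('g, 'c) monoid_scheme \<Rightarrow> bool" where
  "torsion_free G \<longleftrightarrow> (\<forall>x \<in> carrier G. x \<noteq> \<one>\<^bsub>G\<^esub> \<longrightarrow> (\<forall>n::nat. n > 0 \<longrightarrow> x [^]\<^bsub>G\<^esub> n \<noteq> \<one>\<^bsub>G\<^esub>))"

definition nonabelian :: "('g, 'c) monoid_scheme \<Rightarrow> bool" where
  "nonabelian G \<longleftrightarrow> (\<exists>x \<in> carrier G. \<exists>y \<in> carrier G. x \<otimes>\<^bsub>G\<^esub> y \<noteq> y \<otimes>\<^bsub>G\<^esub> x)"

definition orderable :: "('g, 'c) monoid_scheme \<Rightarrow> bool" where
  "orderable G \<longleftrightarrow> (\<exists>lt :: 'g \<Rightarrow> 'g \<Rightarrow> bool.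
     (\<forall>a \<in> carrier G. \<not> lt a a) \<and>
     (\<forall>a \<in> carrier G. \<forall>b \<in> carrier G. \<forall>c \<in> carrier G. lt a b \<longrightarrow> lt b c \<longrightarrow> lt a c) \<and>
     (\<forall>a \<in> carrier G. \<forall>b \<in> carrier G. a = b \<or> lt a b \<or> lt b a) \<and>
     (\<forall>a \<in> carrier G. \<forall>b \<in> carrier G. \<forall>c \<in> carrier G. lt a b \<longrightarrow>
         lt (c \<otimes>\<^bsub>G\<^esub> a) (c \<otimes>\<^bsub>G\<^esub> b) \<and> lt (a \<otimes>\<^bsub>G\<^esub> c) (b \<otimes>\<^bsub>G\<^esub> c)))"

text \<open>The crossed product F[Q; sigma, tau]: finitely supported functions from
  carrier Q to carrier F (zero outside carrier Q), i.e. the free left F-module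
  on a copy of Q, with multiplication determined by
  (r a)(r' b) = r sigma(a)(r') tau(a,b) (ab). The unit is the (unique, if any)
  two-sided identity of the multiplication.\<close>
definition cp_supp :: "('f, 'e) ring_scheme \<Rightarrow> 'q set \<Rightarrow> ('q \<Rightarrow> 'f) \<Rightarrow> 'q set" where
  "cp_supp F A f = {a \<in> A. f a \<noteq> \<zero>\<^bsub>F\<^esub>}"

definition cp_carrier :: "('f, 'e) ring_scheme \<Rightarrow> ('q, 'c) monoid_scheme \<Rightarrow> ('q \<Rightarrow> 'f) set" where
  "cp_carrier F Q = {f. (\<forall>a \<in> carrier Q. f a \<in> carrier F) \<and> (\<forall>a. a \<notin> carrier Q \<longrightarrow> f a = \<zero>\<^bsub>F\<^esub>)
                        \<and> finite (cp_supp F (carrier Q) f)}"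

definition cp_mult :: "('f, 'e) ring_scheme \<Rightarrow> ('q, 'c) monoid_scheme \<Rightarrow> ('q \<Rightarrow> 'f \<Rightarrow> 'f)
    \<Rightarrow> ('q \<Rightarrow> 'q \<Rightarrow> 'f) \<Rightarrow> ('q \<Rightarrow> 'f) \<Rightarrow> ('q \<Rightarrow> 'f) \<Rightarrow> ('q \<Rightarrow> 'f)" where
  "cp_mult F Q \<sigma> \<tau> f g = (\<lambda>c. if c \<in> carrier Q then
      (\<Oplus>\<^bsub>F\<^esub> p \<in> {(a, b). a \<in> cp_supp F (carrier Q) f \<and> b \<in> cp_supp F (carrier Q) g \<and> a \<otimes>\<^bsub>Q\<^esub> b = c}.
          f (fst p) \<otimes>\<^bsub>F\<^esub> \<sigma> (fst p) (g (snd p)) \<otimes>\<^bsub>F\<^esub> \<tau> (fst p) (snd p))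
    else \<zero>\<^bsub>F\<^esub>)"

definition crossed_product :: "('f, 'e) ring_scheme \<Rightarrow> ('q, 'c) monoid_scheme \<Rightarrow> ('q \<Rightarrow> 'f \<Rightarrow> 'f)
    \<Rightarrow> ('q \<Rightarrow> 'q \<Rightarrow> 'f) \<Rightarrow> ('q \<Rightarrow> 'f) ring" where
  "crossed_product F Q \<sigma> \<tau> =
     \<lparr> carrier = cp_carrier F Q,
       mult = cp_mult F Q \<sigma> \<tau>,
       one = (SOME e. e \<in> cp_carrier F Q \<and>
                (\<forall>x \<in> cp_carrier F Q. cp_mult F Q \<sigma> \<tau> e x = x \<and> cp_mult F Q \<sigma> \<tau> x e = x)),
       zero = (\<lambda>_. \<zero>\<^bsub>F\<^esub>),
       add = (\<lambda>f g a. f a \<oplus>\<^bsub>F\<^esub> g a) \<rparr>"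

definition crossed_product_data :: "('f, 'e) ring_scheme \<Rightarrow> ('q, 'c) monoid_scheme \<Rightarrow> ('q \<Rightarrow> 'f \<Rightarrow> 'f)
    \<Rightarrow> ('q \<Rightarrow> 'q \<Rightarrow> 'f) \<Rightarrow> bool" where
  "crossed_product_data F Q \<sigma> \<tau> \<longleftrightarrow>
     (\<forall>a \<in> carrier Q. \<sigma> a \<in> ring_hom F F \<and> bij_betw (\<sigma> a) (carrier F) (carrier F)) \<and>
     (\<forall>a \<in> carrier Q. \<forall>b \<in> carrier Q. \<tau> a b \<in> carrier F - {\<zero>\<^bsub>F\<^esub>}) \<and>
     (\<forall>x \<in> cp_carrier F Q. \<forall>y \<in> cp_carrier F Q. \<forall>z \<in> cp_carrier F Q.
        cp_mult F Q \<sigma> \<tau> (cp_mult F Q \<sigma> \<tau> x y) z = cp_mult F Q \<sigma> \<tau> x (cp_mult F Q \<sigma> \<tau> y z))"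

text \<open>A k-algebra embedding of k[G] into D, given by its restrictions psi to k
  and phi to G: psi is a ring homomorphism into the centre of D, phi is a
  multiplicative homomorphism, and the induced k-linear map k[G] -> D is injective.\<close>
definition group_algebra_embedding ::
  "('k, 'm) ring_scheme \<Rightarrow> ('g, 'c) monoid_scheme \<Rightarrow> ('a, 'b) ring_scheme \<Rightarrow> ('k \<Rightarrow> 'a) \<Rightarrow> ('g \<Rightarrow> 'a) \<Rightarrow> bool" where
  "group_algebra_embedding K G D \<psi> \<phi> \<longleftrightarrow>
     \<psi> \<in> ring_hom K D \<and>
     (\<forall>a \<in> carrier K. \<forall>x \<in> carrier D. \<psi> a \<otimes>\<^bsub>D\<^esub> x = x \<otimes>\<^bsub>D\<^esub> \<psi> a) \<and>
     (\<forall>g \<in> carrier G. \<phi> g \<in> carrier D) \<and>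
     \<phi> \<one>\<^bsub>G\<^esub> = \<one>\<^bsub>D\<^esub> \<and>
     (\<forall>g \<in> carrier G. \<forall>h \<in> carrier G. \<phi> (g \<otimes>\<^bsub>G\<^esub> h) = \<phi> g \<otimes>\<^bsub>D\<^esub> \<phi> h) \<and>
     (\<forall>A c. finite A \<longrightarrow> A \<subseteq> carrier G \<longrightarrow> c ` A \<subseteq> carrier K \<longrightarrow>
        (\<Oplus>\<^bsub>D\<^esub> g \<in> A. \<psi> (c g) \<otimes>\<^bsub>D\<^esub> \<phi> g) = \<zero>\<^bsub>D\<^esub> \<longrightarrow> (\<forall>g \<in> A. c g = \<zero>\<^bsub>K\<^esub>))"

definition good_embedding ::
  "('k, 'm) ring_scheme \<Rightarrow> ('g, 'c) monoid_scheme \<Rightarrow> 'g set \<Rightarrow> ('a, 'b) ring_scheme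
     \<Rightarrow> ('k \<Rightarrow> 'a) \<Rightarrow> ('g \<Rightarrow> 'a) \<Rightarrow> bool" where
  "good_embedding K G N D \<psi> \<phi> \<longleftrightarrow>
     orderable (G Mod N) \<and>
     (\<forall>(F :: 'a ring) \<sigma> \<tau>. division_ring F \<longrightarrow> crossed_product_data F (G Mod N) \<sigma> \<tau> \<longrightarrow>
        ore_domain (crossed_product F (G Mod N) \<sigma> \<tau>)) \<and>
     (\<exists>x. (\<forall>\<alpha> \<in> carrier (G Mod N). x \<alpha> \<in> \<alpha>) \<and>
        (\<forall>A c. finite A \<longrightarrow> A \<subseteq> carrier (G Mod N) \<longrightarrow> c ` A \<subseteq> D_sub D \<psi> (carrier K) \<phi> N \<longrightarrow>
           (\<Oplus>\<^bsub>D\<^esub> \<alpha> \<in> A. c \<alpha> \<otimes>\<^bsub>D\<^esub> \<phi> (x \<alpha>)) = \<zero>\<^bsub>D\<^esub> \<longrightarrow> (\<forall>\<alpha> \<in> A. c \<alpha> = \<zero>\<^bsub>D\<^esub>)))"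

definition k_involution_extending ::
  "('k, 'm) ring_scheme \<Rightarrow> ('g, 'c) monoid_scheme \<Rightarrow> ('a, 'b) ring_scheme \<Rightarrow> ('k \<Rightarrow> 'a) \<Rightarrow> ('g \<Rightarrow> 'a)
     \<Rightarrow> ('g \<Rightarrow> 'g) \<Rightarrow> ('a \<Rightarrow> 'a) \<Rightarrow> bool" where
  "k_involution_extending K G D \<psi> \<phi> s J \<longleftrightarrow>
     (\<forall>x \<in> carrier D. J x \<in> carrier D) \<and>
     (\<forall>x \<in> carrier D. \<forall>y \<in> carrier D. J (x \<oplus>\<^bsub>D\<^esub> y) = J x \<oplus>\<^bsub>D\<^esub> J y) \<and>
     (\<forall>a \<in> carrier K. \<forall>x \<in> carrier D. J (\<psi> a \<otimes>\<^bsub>D\<^esub> x) = \<psi> a \<otimes>\<^bsub>D\<^esub> J x) \<and>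
     (\<forall>x \<in> carrier D. \<forall>y \<in> carrier D. J (x \<otimes>\<^bsub>D\<^esub> y) = J y \<otimes>\<^bsub>D\<^esub> J x) \<and>
     (\<forall>x \<in> carrier D. J (J x) = x) \<and>
     (\<forall>g \<in> carrier G. J (\<phi> g) = \<phi> (s g))"

text \<open>Words in u, v and their inverses: a letter is (generator, exponent sign),
  False = u, True = v; sign True = +1, False = -1. A word is reduced if no letter
  is followed by its inverse.\<close>
fun reduced_word :: "(bool \<times> bool) list \<Rightarrow> bool" where
  "reduced_word (x # y # ws) \<longleftrightarrow> \<not> (fst x = fst y \<and> snd x \<noteq> snd y) \<and> reduced_word (y # ws)"
| "reduced_word _ \<longleftrightarrow> True"

fun eval_word :: "('a, 'b) ring_scheme \<Rightarrow> 'a \<Rightarrow> 'a \<Rightarrow> (bool \<times> bool) list \<Rightarrow> 'a" where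
  "eval_word D u v [] = \<one>\<^bsub>D\<^esub>"
| "eval_word D u v (x # ws) =
     (let g = (if fst x then v else u) in (if snd x then g else inv\<^bsub>D\<^esub> g)) \<otimes>\<^bsub>D\<^esub> eval_word D u v ws"

definition free_pair :: "('a, 'b) ring_scheme \<Rightarrow> 'a \<Rightarrow> 'a \<Rightarrow> bool" where
  "free_pair D u v \<longleftrightarrow> u \<in> Units D \<and> v \<in> Units D \<and>
     (\<forall>w. w \<noteq> [] \<longrightarrow> reduced_word w \<longrightarrow> eval_word D u v w \<noteq> \<one>\<^bsub>D\<^esub>)"

definition free_symmetric_pair :: "('a, 'b) ring_scheme \<Rightarrow> ('a \<Rightarrow> 'a) \<Rightarrow> 'a \<Rightarrow> 'a \<Rightarrow> bool" where
  "free_symmetric_pair D J u v \<longleftrightarrow> J u = u \<and> J v = v \<and> free_pair D u v"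

end

theory Submission
  imports Defs "HOL-Computational_Algebra.Formal_Laurent_Series"
begin

text \<open>
  Write \<open>Q = G/N\<close> and \<open>F = D\<^sub>N\<close>. Pushing elements along the lower central series yields
  \<open>x, y \<in> Q\<close>, each of which the involution fixes or inverts, such that \<open>z = [x, y] \<noteq> 1\<close> is central;
  they generate a Heisenberg group \<open>H\<close>. For lifts \<open>g, h\<close> of \<open>x, y\<close> to \<open>G\<close> the elements
  \<open>u = (1 + g)(1 + g\<^sup>*)\<close> and \<open>v = (1 + h)(1 + h\<^sup>*)\<close> are symmetric.

  Since \<open>F[Q]\<close> is Ore, so is \<open>F[H]\<close>, and the grading of \<open>F[H]\<close> by \<open>deg x = deg y = 1\<close> induces a
  filtration on its fractions in \<open>D\<close>. The inverses of \<open>1 + g\<close> and \<open>1 + h\<close> are geometric series, so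
  every word in \<open>u, v\<close> is approximated to any order by elements of the integral group ring of the
  preimage of \<open>H\<close>. As \<open>k[G]\<close> embeds in \<open>D\<close>, a relation \<open>w(u, v) = 1\<close> survives, modulo the
  characteristic, under \<open>x \<mapsto> t diag(1, -1)\<close>, \<open>y \<mapsto> t antidiag(1, 1)\<close>, \<open>z \<mapsto> -1\<close>. After clearing
  denominators and putting \<open>t = -1\<close>, the letters \<open>u, u\<^sup>-\<^sup>1, v, v\<^sup>-\<^sup>1\<close> become, up to sign and powers
  of 2, the matrices \<open>c c\<^sup>T\<close> with \<open>c =\<close> \<open>(0, 1), (1, 0), (1, -1), (1, 1)\<close>. The product of these over a reduced
  word is a nonzero matrix of rank one, because the characteristic is not 2, hence not scalar.
\<close>

section \<open>Symmetric and unitary elements of nilpotent groups with involution\<close>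

text \<open>No homomorphism from \<open>D\<close> to matrices is available: its coefficients include
  a division ring \<open>F\<close>, and words contain inverses. Only the integral group ring of the
  preimage of \<open>H\<close> is mapped, a group element going to the matrix of its coset. Integers
  are visible in \<open>D\<close> only modulo the characteristic, so every conclusion on the matrix
  side is a congruence. The filtration of \<open>D\<close> is matched with the powers of
  \<open>t\<close>, so that high order in \<open>D\<close> forces high \<open>t\<close>-adic order
  of the matrix; this is what transfers a relation.

  The value -1 for \<open>z\<close> is forced once \<open>x\<close> and \<open>y\<close> act, up to
  \<open>t\<close>, by noncommuting matrices of square 1. For such a matrix \<open>\<sigma>\<close>
  the determinant of \<open>1 + t \<sigma>\<close> is \<open>1 - t^2\<close>, and
  \<open>t = -1\<close> is chosen because it makes the binomials singular: products of rank one
  matrices are governed by scalar products of vectors, and two of the four vectors are orthogonal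
  exactly when the letters cancel. The price is that a denominator may vanish at
  \<open>t = -1\<close>. A relation then says only that some matrix is scalar, possibly
  zero.\<close>

definition commutator :: "('g, 'c) monoid_scheme \<Rightarrow> 'g \<Rightarrow> 'g \<Rightarrow> 'g" where
  "commutator G a b = a \<otimes>\<^bsub>G\<^esub> b \<otimes>\<^bsub>G\<^esub> inv\<^bsub>G\<^esub> a \<otimes>\<^bsub>G\<^esub> inv\<^bsub>G\<^esub> b"

context group
begin

lemma inv_cancel_left:
  assumes "x \<in> carrier G" "y \<in> carrier G"
  shows "x \<otimes> (inv x \<otimes> y) = y" "inv x \<otimes> (x \<otimes> y) = y"
  using assms by (simp_all flip: m_assoc)

lemma commutator_closed [simp]:
  "\<lbrakk>a \<in> carrier G; b \<in> carrier G\<rbrakk> \<Longrightarrow> commutator G a b \<in> carrier G"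
  by (simp add: commutator_def)

lemma commutator_eq_one_iff:
  assumes "a \<in> carrier G" "b \<in> carrier G"
  shows "commutator G a b = \<one> \<longleftrightarrow> a \<otimes> b = b \<otimes> a"
proof -
  have "commutator G a b = (a \<otimes> b) \<otimes> inv (b \<otimes> a)"
    using assms by (simp add: commutator_def m_assoc inv_mult_group)
  then show ?thesis
    using assms by (metis inv_closed inv_equality inv_inv m_closed r_inv)
qed

lemma lower_central_subgroup: "subgroup (lower_central G n) G"
proof (induction n)
  case 0
  then show ?case by (simp add: subgroup_self)
next
  case (Suc n)
  have "comm_set G (lower_central G n) (carrier G) \<subseteq> carrier G"
    using subgroup.subset[OF Suc] by (auto simp: comm_set_def)
  then show ?case by (simp add: generate_is_subgroup)
qed

lemma commutator_in_lower_central: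
  assumes "a \<in> lower_central G n" "b \<in> carrier G"
  shows "commutator G a b \<in> lower_central G (Suc n)"
  using assms by (auto simp: commutator_def comm_set_def intro!: generate.incl)

lemma involution_one_inv:
  assumes "group_involution G t"
  shows "t \<one> = \<one>" and "x \<in> carrier G \<Longrightarrow> t (inv x) = inv (t x)"
proof -
  have t: "\<And>x. x \<in> carrier G \<Longrightarrow> t x \<in> carrier G"
    "\<And>x y. \<lbrakk>x \<in> carrier G; y \<in> carrier G\<rbrakk> \<Longrightarrow> t (x \<otimes> y) = t y \<otimes> t x"
    using assms by (auto simp: group_involution_def)
  have "t \<one> \<otimes> t \<one> = t \<one>"
    using t(2)[of \<one> \<one>] by simp
  then show one: "t \<one> = \<one>"
    using t(1) by (metis l_cancel_one one_closed)
  show "t (inv x) = inv (t x)" if "x \<in> carrier G"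
  proof -
    have "t (inv x) \<otimes> t x = \<one>"
      using t(2)[of x "inv x"] that one by simp
    then show ?thesis
      using t(1) that by (metis inv_closed inv_equality)
  qed
qed

text \<open>Since \<open>t\<close> reverses products, \<open>a \<mapsto> inv (t a)\<close> is an
  automorphism and respects commutators; one more inversion brings \<open>t\<close> back.\<close>

lemma involution_commutator:
  assumes "group_involution G t" "a \<in> carrier G" "b \<in> carrier G"
  shows "t (commutator G a b) = inv (commutator G (inv (t a)) (inv (t b)))"
proof -
  have t: "\<And>x. x \<in> carrier G \<Longrightarrow> t x \<in> carrier G"
    "\<And>x y. \<lbrakk>x \<in> carrier G; y \<in> carrier G\<rbrakk> \<Longrightarrow> t (x \<otimes> y) = t y \<otimes> t x"
    using assms by (auto simp: group_involution_def)
  show ?thesis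
    using assms(2,3) t involution_one_inv(2)[OF assms(1)]
    by (simp add: commutator_def inv_mult_group m_assoc)
qed

lemma involution_lower_central:
  assumes "group_involution G t" "x \<in> lower_central G n"
  shows "t x \<in> lower_central G n"
  using assms(2)
proof (induction n arbitrary: x)
  case 0
  then show ?case using assms(1) by (simp add: group_involution_def)
next
  case (Suc n)
  have t: "\<And>x. x \<in> carrier G \<Longrightarrow> t x \<in> carrier G"
    "\<And>x y. \<lbrakk>x \<in> carrier G; y \<in> carrier G\<rbrakk> \<Longrightarrow> t (x \<otimes> y) = t y \<otimes> t x"
    using assms(1) by (auto simp: group_involution_def)
  have sub: "lower_central G n \<subseteq> carrier G" "subgroup (lower_central G n) G"
    "subgroup (lower_central G (Suc n)) G"
    using lower_central_subgroup subgroup.subset by blast+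
  have sub1: "lower_central G (Suc n) \<subseteq> carrier G"
    using sub(3) subgroup.subset by blast
  have base: "t y \<in> lower_central G (Suc n)"
    if "y \<in> comm_set G (lower_central G n) (carrier G)" for y
  proof -
    obtain a b where ab: "a \<in> lower_central G n" "b \<in> carrier G" "y = commutator G a b"
      using \<open>y \<in> _\<close> by (auto simp: comm_set_def commutator_def)
    have "inv (t a) \<in> lower_central G n"
      using Suc.IH[OF ab(1)] sub(2) by (simp add: subgroup.m_inv_closed)
    then have "commutator G (inv (t a)) (inv (t b)) \<in> lower_central G (Suc n)"
      using ab(2) t(1) by (intro commutator_in_lower_central) auto
    then show ?thesis
      using involution_commutator[OF assms(1)] ab sub(1) subgroup.m_inv_closed[OF sub(3)]
      by (metis subsetD)
  qed
  have "x \<in> generate G (comm_set G (lower_central G n) (carrier G))"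
    using Suc.prems by simp
  then show ?case
  proof (induction rule: generate.induct)
    case one
    then show ?case using involution_one_inv[OF assms(1)] sub(3) subgroup.one_closed by fastforce
  next
    case (incl h)
    then show ?case by (rule base)
  next
    case (inv h)
    then have "h \<in> carrier G"
      using sub(1) by (auto simp: comm_set_def)
    then show ?case
      using base[OF inv] involution_one_inv(2)[OF assms(1)] sub(3) by (simp add: subgroup.m_inv_closed)
  next
    case (eng h1 h2)
    then have "h1 \<in> carrier G" "h2 \<in> carrier G"
      using sub1 by auto
    then show ?case
      using eng t(2) sub(3) by (metis subgroup.m_closed)
  qed
qed

text \<open>Replacing \<open>b\<close> by \<open>b \<otimes> inv (t b)\<close> moves \<open>b\<close> closer, along the lower central series, to the
  fixed points of the automorphism \<open>b \<mapsto> inv (t b)\<close>.\<close>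

lemma symmetric_or_unitary_outside_kernel:
  assumes t: "group_involution G t" and nil: "lower_central G n = {\<one>}"
    and B: "subgroup B G" "t ` B \<subseteq> B"
    and f: "group H" "f \<in> hom (G\<lparr>carrier := B\<rparr>) H"
    and square: "\<And>b. \<lbrakk>b \<in> B; f b \<otimes>\<^bsub>H\<^esub> f b = \<one>\<^bsub>H\<^esub>\<rbrakk> \<Longrightarrow> f b = \<one>\<^bsub>H\<^esub>"
    and b: "b \<in> B" "f b \<noteq> \<one>\<^bsub>H\<^esub>"
  shows "\<exists>b' \<in> B. (t b' = b' \<or> t b' = inv b') \<and> f b' \<noteq> \<one>\<^bsub>H\<^esub>"
proof -
  have tc: "\<And>x. x \<in> carrier G \<Longrightarrow> t x \<in> carrier G"
    "\<And>x y. \<lbrakk>x \<in> carrier G; y \<in> carrier G\<rbrakk> \<Longrightarrow> t (x \<otimes> y) = t y \<otimes> t x"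
    "\<And>x. x \<in> carrier G \<Longrightarrow> t (t x) = x"
    using t by (auto simp: group_involution_def)
  interpret H: group H by (rule f(1))
  have Bc: "B \<subseteq> carrier G" using B(1) subgroup.subset by blast
  have fc: "\<And>x. x \<in> B \<Longrightarrow> f x \<in> carrier H"
    and fm: "\<And>x y. \<lbrakk>x \<in> B; y \<in> B\<rbrakk> \<Longrightarrow> f (x \<otimes> y) = f x \<otimes>\<^bsub>H\<^esub> f y"
    using f(2) by (auto simp: hom_def)
  have Bm: "\<And>x y. \<lbrakk>x \<in> B; y \<in> B\<rbrakk> \<Longrightarrow> x \<otimes> y \<in> B" and Bi: "\<And>x. x \<in> B \<Longrightarrow> inv x \<in> B"
    and Bt: "\<And>x. x \<in> B \<Longrightarrow> t x \<in> B" and B1: "\<one> \<in> B"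
    using B by (auto simp: subgroup.m_closed subgroup.m_inv_closed subgroup.one_closed)
  have f1: "f \<one> = \<one>\<^bsub>H\<^esub>"
    using fm[OF B1 B1] fc[OF B1] by simp
  \<comment> \<open>\<open>k\<close> is the remaining distance: the defect
    \<open>inv x \<otimes> inv (t x)\<close> lies in term \<open>n - k\<close> of the series, so for
    \<open>k = 0\<close> it is trivial and \<open>t x = inv x\<close>.\<close>
  have step: "\<exists>b' \<in> B. (t b' = b' \<or> t b' = inv b') \<and> f b' \<noteq> \<one>\<^bsub>H\<^esub>"
    if "k \<le> n" "x \<in> B" "f x \<noteq> \<one>\<^bsub>H\<^esub>" "inv x \<otimes> inv (t x) \<in> lower_central G (n - k)" for k x
    using that
  proof (induction k arbitrary: x)
    case 0
    then have x: "x \<in> carrier G" "t x \<in> carrier G" using Bc tc(1) by auto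
    have "inv x \<otimes> inv (t x) = \<one>" using 0 nil by simp
    then have "t x = inv x"
      using x by (metis inv_closed inv_equality inv_inv)
    then show ?case using 0 by blast
  next
    case (Suc k)
    have x: "x \<in> carrier G" "t x \<in> carrier G" "t (t x) = x" using Bc tc Suc.prems by auto
    \<comment> \<open>\<open>x \<otimes> t x\<close> is symmetric, so it is the answer unless
      \<open>f\<close> kills it. If \<open>f\<close> does kill it, then \<open>f\<close> sends
      \<open>x \<otimes> inv (t x)\<close> to the square of \<open>f x\<close>, which is nontrivial
      by \<open>square\<close>, and the induction continues with this element.\<close>
    show ?case
    proof (cases "f (x \<otimes> t x) = \<one>\<^bsub>H\<^esub>")
      case False
      moreover have "t (x \<otimes> t x) = x \<otimes> t x" using tc x by simp
      moreover have "x \<otimes> t x \<in> B" using Bm Bt Suc.prems by blast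
      ultimately show ?thesis by blast
    next
      case True
      define y where "y = x \<otimes> inv (t x)"
      define c where "c = inv x \<otimes> inv (t x)"
      have yB: "y \<in> B" using Bm Bt Bi Suc.prems by (simp add: y_def)
      have ftx: "f (t x) \<otimes>\<^bsub>H\<^esub> f (inv (t x)) = \<one>\<^bsub>H\<^esub>"
        using fm[OF Bt Bi[OF Bt], OF Suc.prems(2) Suc.prems(2)] f1 x by simp
      have "f x \<otimes>\<^bsub>H\<^esub> f (t x) = \<one>\<^bsub>H\<^esub>"
        using True fm Bt Suc.prems(2) by simp
      then have "f (inv (t x)) = f x"
        using ftx fc Bt Bi Suc.prems(2) by (metis H.inv_equality H.inv_inv H.inv_comm)
      then have "f y = f x \<otimes>\<^bsub>H\<^esub> f x"
        using fm[OF Suc.prems(2) Bi[OF Bt]] Suc.prems(2) by (simp add: y_def)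
      then have fy: "f y \<noteq> \<one>\<^bsub>H\<^esub>"
        using square Suc.prems(2,3) by auto
      have nk: "n - k = Suc (n - Suc k)" using Suc.prems(1) by simp
      have cc: "c \<in> lower_central G (n - Suc k)" using Suc.prems(4) by (simp add: c_def)
      have ccarr: "c \<in> carrier G" using x by (simp add: c_def)
      \<comment> \<open>The new defect is a commutator formed with the inverse of the old one, so it
        lies one term further down.\<close>
      have "inv y \<otimes> inv (t y) = commutator G (inv c) (inv x)"
      proof -
        have "t y = inv x \<otimes> t x"
          using x tc(2) involution_one_inv(2)[OF t] by (simp add: y_def)
        then show ?thesis
          using x by (simp add: y_def c_def commutator_def inv_mult_group m_assoc inv_cancel_left)
      qed
      moreover have "inv c \<in> lower_central G (n - Suc k)"
        using cc lower_central_subgroup by (simp add: subgroup.m_inv_closed)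
      ultimately have "inv y \<otimes> inv (t y) \<in> lower_central G (n - k)"
        using nk commutator_in_lower_central x by simp
      then show ?thesis
        using Suc.IH[of y] yB fy Suc.prems(1) by simp
    qed
  qed
  show ?thesis
    using step[of n b] b Bc tc(1) by auto
qed

lemma commutator_mult_left:
  assumes "a \<in> carrier G" "b \<in> carrier G" "y \<in> carrier G"
    and central: "\<And>q. q \<in> carrier G \<Longrightarrow> commutator G b y \<otimes> q = q \<otimes> commutator G b y"
  shows "commutator G (a \<otimes> b) y = commutator G a y \<otimes> commutator G b y"
proof -
  have "commutator G (a \<otimes> b) y = (a \<otimes> commutator G b y) \<otimes> (y \<otimes> inv a \<otimes> inv y)"
    using assms(1-3) by (simp add: commutator_def inv_mult_group m_assoc inv_cancel_left)
  also have "\<dots> = commutator G b y \<otimes> commutator G a y"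
  proof -
    have "a \<otimes> commutator G b y = commutator G b y \<otimes> a"
      using central[OF assms(1)] by simp
    then show ?thesis
      using assms(1-3) commutator_closed[of b y] by (simp add: commutator_def[of _ a] m_assoc)
  qed
  finally show ?thesis using central[of "commutator G a y"] assms(1-3) by simp
qed

lemma commutator_mult_right:
  assumes "a \<in> carrier G" "b \<in> carrier G" "x \<in> carrier G"
    and central: "\<And>q. q \<in> carrier G \<Longrightarrow> commutator G x b \<otimes> q = q \<otimes> commutator G x b"
  shows "commutator G x (a \<otimes> b) = commutator G x a \<otimes> commutator G x b"
proof -
  have "commutator G x (a \<otimes> b) = (x \<otimes> a \<otimes> inv x) \<otimes> (commutator G x b \<otimes> inv a)"
    using assms(1-3) by (simp add: commutator_def inv_mult_group m_assoc inv_cancel_left)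
  also have "\<dots> = commutator G x a \<otimes> commutator G x b"
  proof -
    have "commutator G x b \<otimes> inv a = inv a \<otimes> commutator G x b"
      using central[of "inv a"] assms by simp
    then show ?thesis
      using assms(1-3) commutator_closed[of x b] by (simp add: commutator_def[of _ _ a] m_assoc)
  qed
  finally show ?thesis .
qed

text \<open>With one argument fixed, the commutator becomes a homomorphism to which
  \<open>symmetric_or_unitary_outside_kernel\<close> applies; absence of torsion supplies the
  condition on squares. The argument in \<open>A\<close> is adjusted first. It then stays fixed, so
  that the other one may vary over the whole group.\<close>

lemma heisenberg_pair_exists:
  assumes nil: "nilpotent_group G" and nonab: "nonabelian G" and tf: "torsion_free G"
    and t: "group_involution G t"
  obtains x y where "x \<in> carrier G" "y \<in> carrier G"
    "t x = x \<or> t x = inv x" "t y = y \<or> t y = inv y" "commutator G x y \<noteq> \<one>"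
    "\<And>q. q \<in> carrier G \<Longrightarrow> commutator G x y \<otimes> q = q \<otimes> commutator G x y"
proof -
  define n where "n = (LEAST n. lower_central G n = {\<one>})"
  have ex: "\<exists>n. lower_central G n = {\<one>}" using nil by (simp add: nilpotent_group_def)
  have ln: "lower_central G n = {\<one>}" unfolding n_def by (rule LeastI_ex[OF ex])
  have less: "lower_central G m \<noteq> {\<one>}" if "m < n" for m
    using not_less_Least[of m] that unfolding n_def by blast
  obtain a b where ab: "a \<in> carrier G" "b \<in> carrier G" "a \<otimes> b \<noteq> b \<otimes> a"
    using nonab by (auto simp: nonabelian_def)
  have "n \<noteq> 0"
  proof
    assume "n = 0"
    then have "carrier G = {\<one>}" using ln by simp
    then show False using ab by auto
  qed
  moreover have "n \<noteq> Suc 0"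
  proof
    assume "n = Suc 0"
    then have "commutator G a b \<in> {\<one>}"
      using commutator_in_lower_central[of a 0 b] ab ln by (metis lower_central.simps(1))
    then show False using commutator_eq_one_iff[of a b] ab by simp
  qed
  ultimately obtain m where m: "n = Suc (Suc m)"
    by (metis old.nat.exhaust)
  \<comment> \<open>Commutators of \<open>A\<close> with the group lie in the last nontrivial term
    of the series, which is central. This makes the commutator multiplicative in each argument as
    long as the first one stays in \<open>A\<close>.\<close>
  define A where "A = lower_central G m"
  have Asub: "subgroup A G" unfolding A_def by (rule lower_central_subgroup)
  then have Ac: "A \<subseteq> carrier G" by (rule subgroup.subset)
  have central: "commutator G w y \<otimes> q = q \<otimes> commutator G w y"
    if "w \<in> A" "y \<in> carrier G" "q \<in> carrier G" for w y q
  proof -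
    have "commutator G w y \<in> lower_central G (Suc m)"
      using that commutator_in_lower_central by (simp add: A_def)
    then have "commutator G (commutator G w y) q \<in> lower_central G n"
      using m that commutator_in_lower_central by blast
    then show ?thesis
      using ln commutator_eq_one_iff[of "commutator G w y" q] that Ac by auto
  qed
  have "\<exists>w \<in> A. \<exists>y \<in> carrier G. commutator G w y \<noteq> \<one>"
  proof (rule ccontr)
    assume "\<not> ?thesis"
    then have "comm_set G A (carrier G) \<subseteq> {\<one>}"
      by (auto simp: comm_set_def commutator_def)
    then have "lower_central G (Suc m) \<subseteq> {\<one>}"
      using generate_subgroup_incl[OF _ triv_subgroup] by (simp add: A_def)
    then have "lower_central G (Suc m) = {\<one>}"
      using lower_central_subgroup[of "Suc m"] subgroup.one_closed by blast
    then show False using less[of "Suc m"] m by simp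
  qed
  then obtain w y where wy: "w \<in> A" "y \<in> carrier G" "commutator G w y \<noteq> \<one>"
    by blast
  have square: "z = \<one>" if "z \<in> carrier G" "z \<otimes> z = \<one>" for z
  proof (rule ccontr)
    assume "z \<noteq> \<one>"
    moreover have "z [^] (2::nat) = \<one>" using that by (simp add: numeral_2_eq_2)
    ultimately show False using tf that(1) unfolding torsion_free_def by (metis zero_less_numeral)
  qed
  have tA: "t ` A \<subseteq> A" using involution_lower_central[OF t] by (auto simp: A_def)
  have "(\<lambda>a. commutator G a y) \<in> hom (G\<lparr>carrier := A\<rparr>) G"
  proof (rule homI)
    fix a b assume ab: "a \<in> carrier (G\<lparr>carrier := A\<rparr>)" "b \<in> carrier (G\<lparr>carrier := A\<rparr>)"
    then show "commutator G (a \<otimes>\<^bsub>G\<lparr>carrier := A\<rparr>\<^esub> b) y = commutator G a y \<otimes> commutator G b y"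
      using commutator_mult_left[of a b y] central[OF _ wy(2), of b] wy(2) Ac by (simp add: subset_iff)
  qed (use Ac wy(2) in auto)
  from symmetric_or_unitary_outside_kernel[OF t ln Asub tA is_group this _ wy(1) wy(3)]
  obtain x where x: "x \<in> A" "t x = x \<or> t x = inv x" "commutator G x y \<noteq> \<one>"
    using square wy(2) Ac by (metis commutator_closed subsetD)
  have tG: "t ` carrier G \<subseteq> carrier G" using t by (auto simp: group_involution_def)
  have "(\<lambda>a. commutator G x a) \<in> hom (G\<lparr>carrier := carrier G\<rparr>) G"
  proof (rule homI)
    fix a b assume ab: "a \<in> carrier (G\<lparr>carrier := carrier G\<rparr>)" "b \<in> carrier (G\<lparr>carrier := carrier G\<rparr>)"
    then show "commutator G x (a \<otimes>\<^bsub>G\<lparr>carrier := carrier G\<rparr>\<^esub> b) = commutator G x a \<otimes> commutator G x b"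
      using commutator_mult_right[of a b x] central[OF x(1), of b] Ac x(1) by (simp add: subset_iff)
  qed (use Ac x(1) in auto)
  from symmetric_or_unitary_outside_kernel[OF t ln subgroup_self tG is_group this _ wy(2) x(3)]
  obtain y' where y': "y' \<in> carrier G" "t y' = y' \<or> t y' = inv y'" "commutator G x y' \<noteq> \<one>"
    using square x(1) Ac by (metis commutator_closed subsetD)
  show thesis
    using that[of x y'] x y' Ac central by blast
qed

end

section \<open>The Heisenberg group\<close>

text \<open>\<open>(i, j, k)\<close> stands for \<open>x^i y^j z^k\<close>. The term
  \<open>- j * i'\<close> is the cost of moving \<open>y^j\<close> to the right past
  \<open>x^i'\<close> when \<open>[x, y] = z\<close> is central.\<close>

fun hmult :: "int \<times> int \<times> int \<Rightarrow> int \<times> int \<times> int \<Rightarrow> int \<times> int \<times> int" where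
  "hmult (i, j, k) (i', j', k') = (i + i', j + j', k + k' - j * i')"

fun hdeg :: "int \<times> int \<times> int \<Rightarrow> int" where
  "hdeg (i, j, k) = i + j"

lemma hdeg_hmult [simp]: "hdeg (hmult S T) = hdeg S + hdeg T"
  by (cases S; cases T) simp

definition hinv :: "int \<times> int \<times> int \<Rightarrow> int \<times> int \<times> int" where
  "hinv = (\<lambda>(i, j, k). (- i, - j, - k - j * i))"

lemma hmult_assoc: "hmult (hmult R S) T = hmult R (hmult S T)"
  by (cases R; cases S; cases T) (simp add: algebra_simps)

lemma hmult_simps [simp]:
  "hmult (0, 0, 0) T = T" "hmult T (0, 0, 0) = T"
  "hmult (hinv T) T = (0, 0, 0)" "hmult T (hinv T) = (0, 0, 0)"
  by (cases T; simp add: hinv_def algebra_simps)+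

context group
begin

text \<open>Conjugation by \<open>w\<close> is an endomorphism sending \<open>a\<close> to
  \<open>a \<otimes> c\<close>, and powers of \<open>a \<otimes> c\<close> split because the factors
  commute.\<close>

lemma int_pow_past:
  assumes "w \<in> carrier G" "a \<in> carrier G" "c \<in> carrier G"
    and "w \<otimes> a = a \<otimes> c \<otimes> w" "a \<otimes> c = c \<otimes> a"
  shows "w \<otimes> a [^] (i::int) = a [^] i \<otimes> c [^] i \<otimes> w"
proof -
  have "(\<lambda>g. w \<otimes> g \<otimes> inv w) \<in> hom G G"
    using assms(1) by (auto simp: hom_def m_assoc inv_cancel_left)
  then have "w \<otimes> a [^] i \<otimes> inv w = (w \<otimes> a \<otimes> inv w) [^] i"
    using Group.hom_int_pow[of "\<lambda>g. w \<otimes> g \<otimes> inv w" G G a i] assms is_group by simp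
  also have "w \<otimes> a \<otimes> inv w = a \<otimes> c"
    using assms by (simp add: m_assoc)
  also have "(a \<otimes> c) [^] i = a [^] i \<otimes> c [^] i"
    by (rule int_pow_mult_distrib) (use assms in auto)
  finally have "w \<otimes> a [^] i \<otimes> inv w \<otimes> w = a [^] i \<otimes> c [^] i \<otimes> w" by simp
  then show ?thesis using assms by (simp add: m_assoc)
qed

end

locale heisenberg_pair = group Q for Q (structure) +
  fixes x y
  assumes x [simp]: "x \<in> carrier Q" and y [simp]: "y \<in> carrier Q"
    and tf: "torsion_free Q"
    and z_ne: "commutator Q x y \<noteq> \<one>"
    and z_central: "\<And>q. q \<in> carrier Q \<Longrightarrow> commutator Q x y \<otimes> q = q \<otimes> commutator Q x y"
begin

definition "z = commutator Q x y"

lemma z [simp]: "z \<in> carrier Q"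
  by (simp add: z_def)

fun lam where
  "lam (i, j, k) = x [^] (i::int) \<otimes> y [^] (j::int) \<otimes> z [^] (k::int)"

lemma lam_closed [simp]: "lam T \<in> carrier Q"
  by (cases T) simp

lemma z_pow_central:
  assumes "q \<in> carrier Q"
  shows "z [^] (k::int) \<otimes> q = q \<otimes> z [^] k"
proof -
  have "q \<otimes> z [^] k = z [^] k \<otimes> \<one> [^] k \<otimes> q"
    by (rule int_pow_past) (use assms z_central in \<open>simp_all add: z_def\<close>)
  then show ?thesis using assms by simp
qed

text \<open>\<open>int_pow_past\<close> is used twice: conjugation by \<open>inv x\<close> treats
  the power of \<open>y\<close> against a single \<open>x\<close>, then conjugation by
  \<open>y [^] j\<close> treats the power of \<open>x\<close>.\<close>

lemma y_pow_x_pow: "y [^] (j::int) \<otimes> x [^] (i::int) = x [^] i \<otimes> z [^] (- (j * i)) \<otimes> y [^] j"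
proof -
  have zx: "z \<otimes> y \<otimes> x = x \<otimes> y"
    by (simp add: z_def commutator_def m_assoc inv_cancel_left)
  have "y \<otimes> x = inv z \<otimes> (x \<otimes> y)"
    by (simp add: zx[symmetric] m_assoc inv_cancel_left)
  also have "\<dots> = x \<otimes> (inv z \<otimes> y)"
    using z_pow_central[of x "-1"] by (simp add: int_pow_neg flip: m_assoc)
  finally have "inv x \<otimes> y \<otimes> x = inv z \<otimes> y"
    by (simp add: m_assoc inv_cancel_left)
  then have "inv x \<otimes> y = inv z \<otimes> y \<otimes> inv x"
    by (metis inv_closed inv_solve_right m_closed x y z)
  also have "\<dots> = y \<otimes> inv z \<otimes> inv x"
    using z_pow_central[of y "-1"] by (simp add: int_pow_neg)
  finally have "inv x \<otimes> y [^] j = y [^] j \<otimes> inv z [^] j \<otimes> inv x"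
    using z_pow_central[of y "-1"] by (intro int_pow_past) (simp_all add: int_pow_neg)
  then have "x \<otimes> (inv x \<otimes> y [^] j) \<otimes> x = x \<otimes> (y [^] j \<otimes> inv z [^] j \<otimes> inv x) \<otimes> x" by simp
  then have "y [^] j \<otimes> x = x \<otimes> (y [^] j \<otimes> z [^] (- j))"
    by (simp add: m_assoc inv_cancel_left int_pow_neg int_pow_inv)
  also have "\<dots> = x \<otimes> z [^] (- j) \<otimes> y [^] j"
    using z_pow_central[of "y [^] j" "-j"] by (simp add: m_assoc)
  finally have "y [^] j \<otimes> x [^] i = x [^] i \<otimes> (z [^] (- j)) [^] i \<otimes> y [^] j"
    using z_pow_central[of x "-j"] by (intro int_pow_past) simp_all
  then show ?thesis by (simp add: int_pow_pow)
qed

lemma lam_hmult: "lam (hmult S T) = lam S \<otimes> lam T"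
proof -
  obtain i j k i' j' k' where [simp]: "S = (i, j, k)" "T = (i', j', k')"
    by (cases S; cases T) auto
  have "lam S \<otimes> lam T = x [^] i \<otimes> (y [^] j \<otimes> (z [^] k \<otimes> x [^] i') \<otimes> y [^] j' \<otimes> z [^] k')"
    by (simp add: m_assoc)
  also have "\<dots> = x [^] i \<otimes> ((y [^] j \<otimes> x [^] i') \<otimes> (z [^] k \<otimes> y [^] j') \<otimes> z [^] k')"
    using z_pow_central[of "x [^] i'" k] by (simp add: m_assoc)
  also have "\<dots> = x [^] i \<otimes> (x [^] i' \<otimes> (z [^] (- (j * i')) \<otimes> (y [^] j \<otimes> y [^] j')) \<otimes> z [^] k \<otimes> z [^] k')"
    using z_pow_central[of "y [^] j'" k] y_pow_x_pow[of j i'] by (simp add: m_assoc)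
  also have "\<dots> = (x [^] i \<otimes> x [^] i') \<otimes> (y [^] j \<otimes> y [^] j') \<otimes> (z [^] (- (j * i')) \<otimes> z [^] k \<otimes> z [^] k')"
    using z_pow_central[of "y [^] j \<otimes> y [^] j'" "- (j * i')"] by (simp add: m_assoc)
  also have "\<dots> = lam (hmult S T)"
    by (simp add: int_pow_mult[symmetric] algebra_simps)
  finally show ?thesis ..
qed

lemma lam_one [simp]: "lam (0, 0, 0) = \<one>"
  by simp

lemma z_pow_eq_one:
  assumes "z [^] (k::int) = \<one>"
  shows "k = 0"
proof (rule ccontr)
  assume "k \<noteq> 0"
  then obtain n :: nat where n: "n > 0" "k = int n \<or> k = - int n"
    by (metis int_cases2 not_gr_zero of_nat_0 minus_zero)
  then have "z [^] n = \<one>"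
    using assms by (auto simp: int_pow_neg int_pow_int inv_eq_1_iff)
  then show False
    using tf z_ne n(1) unfolding torsion_free_def z_def[symmetric] by auto
qed

text \<open>A word equal to \<open>\<one>\<close> commutes with \<open>x\<close> and with
  \<open>y\<close>. Comparing the two products leaves a power of \<open>z\<close> with exponent
  \<open>- j\<close>, respectively \<open>- i\<close>, and \<open>z\<close> has infinite
  order.\<close>

lemma lam_eq_one:
  assumes "lam T = \<one>"
  shows "T = (0, 0, 0)"
proof -
  obtain i j k where T: "T = (i, j, k)" by (cases T)
  have c: "lam (hmult S T) = lam (hmult T S)" for S
    by (simp add: lam_hmult assms)
  have "y [^] j \<otimes> z [^] (k - j) = y [^] j \<otimes> z [^] k"
  proof -
    have "x [^] (i + 1) \<otimes> (y [^] j \<otimes> z [^] (k - j)) = x [^] (i + 1) \<otimes> (y [^] j \<otimes> z [^] k)"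
      using c[of "(1, 0, 0)"] by (simp add: T m_assoc add.commute)
    then show ?thesis by simp
  qed
  then have "z [^] (k - j) = z [^] k" by simp
  then have "z [^] (- j) = \<one>"
    by (metis (no_types, lifting) add_diff_cancel_left' diff_conv_add_uminus int_pow_closed int_pow_mult r_cancel_one z)
  then have j: "j = 0" using z_pow_eq_one by fastforce
  have "x [^] i \<otimes> y \<otimes> z [^] (k - i) = x [^] i \<otimes> y \<otimes> z [^] k"
    using c[of "(0, 1, 0)"] by (simp add: T j)
  then have "z [^] (k - i) = z [^] k" by (simp add: m_assoc)
  then have "z [^] (- i) = \<one>"
    by (metis (no_types, lifting) add_diff_cancel_left' diff_conv_add_uminus int_pow_closed int_pow_mult r_cancel_one z)
  then have i: "i = 0" using z_pow_eq_one by fastforce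
  have "z [^] k = \<one>" using assms by (simp add: T i j)
  then show ?thesis using z_pow_eq_one T i j by simp
qed

lemma inj_lam: "inj lam"
proof (rule injI)
  fix S T assume "lam S = lam T"
  then have "lam (hmult (hinv S) T) = lam (hmult (hinv S) S)"
    by (simp only: lam_hmult)
  then have "hmult (hinv S) T = (0, 0, 0)"
    by (intro lam_eq_one) simp
  then have "hmult S (hmult (hinv S) T) = S" by simp
  then show "S = T" by (simp flip: hmult_assoc)
qed

lemma lam_hinv: "lam (hinv T) = inv (lam T)"
proof -
  have "lam (hinv T) \<otimes> lam T = \<one>" by (simp flip: lam_hmult)
  then show ?thesis by (simp add: inv_equality)
qed

end

section \<open>The involution induced on the quotient group\<close>

lemma (in normal) image_coset_involution:
  assumes s: "group_involution G s" "s ` H \<subseteq> H" and a: "a \<in> carrier G"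
  shows "s ` (H #> a) = H #> s a"
proof -
  have sc: "\<And>x. x \<in> carrier G \<Longrightarrow> s x \<in> carrier G"
    "\<And>x y. \<lbrakk>x \<in> carrier G; y \<in> carrier G\<rbrakk> \<Longrightarrow> s (x \<otimes> y) = s y \<otimes> s x"
    "\<And>x. x \<in> carrier G \<Longrightarrow> s (s x) = x"
    using s(1) by (auto simp: group_involution_def)
  have "s ` H = H"
  proof
    show "H \<subseteq> s ` H"
    proof
      fix h assume "h \<in> H"
      then have "s (s h) = h" "s h \<in> H" using sc(3) subset s(2) by auto
      then show "h \<in> s ` H" by force
    qed
  qed (rule s(2))
  \<comment> \<open>An anti-automorphism turns a right coset into a left one; normality of
    \<open>H\<close> turns it back.\<close>
  moreover have "s ` (H #> a) = s a <# (s ` H)"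
    using a sc(2) subset by (force simp: r_coset_def l_coset_def)
  ultimately show ?thesis using coset_eq sc(1) a by auto
qed

lemma (in normal) involution_FactGroup:
  assumes "group_involution G s" "s ` H \<subseteq> H"
  shows "group_involution (G Mod H) (\<lambda>C. s ` C)"
proof -
  have sc: "\<And>x. x \<in> carrier G \<Longrightarrow> s x \<in> carrier G"
    "\<And>x y. \<lbrakk>x \<in> carrier G; y \<in> carrier G\<rbrakk> \<Longrightarrow> s (x \<otimes> y) = s y \<otimes> s x"
    "\<And>x. x \<in> carrier G \<Longrightarrow> s (s x) = x"
    using assms(1) by (auto simp: group_involution_def)
  show ?thesis
    unfolding group_involution_def
    using sc by (auto simp: FactGroup_def RCOSETS_def rcos_sum image_coset_involution[OF assms])
qed

section \<open>Spans of cosets over a division subring\<close>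

lemma (in ring) division_ring_inv:
  assumes "division_ring R" "x \<in> carrier R" "x \<noteq> \<zero>"
  shows "x \<in> Units R" "inv x \<in> carrier R" "x \<otimes> inv x = \<one>" "inv x \<otimes> x = \<one>"
  using assms by (auto simp: division_ring_def)

lemma (in ring) minus_eq_zeroD:
  assumes "a \<in> carrier R" "b \<in> carrier R" "a \<ominus> b = \<zero>"
  shows "a = b"
  using assms minus_equality[of a "\<ominus> b"] by (simp add: a_minus_def)

text \<open>\<open>F\<close> stands for \<open>D_N\<close> and \<open>\<xi>\<close> for the
  transversal of a good embedding; the ground field is present only inside \<open>F\<close>. The
  assumptions say that the \<open>F\<close>-span of the image of \<open>\<phi>\<close> is a crossed
  product of \<open>F\<close> with the quotient.\<close>

locale graded_division = ring D + G: normal N G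
  for D :: "'a ring" (structure) and G :: "'g monoid" and N +
  fixes F :: "'a set" and \<phi> :: "'g \<Rightarrow> 'a" and \<xi> :: "'g set \<Rightarrow> 'g"
  assumes division: "division_ring D"
    and F: "div_closed D F"
    and phi_closed [simp]: "g \<in> carrier G \<Longrightarrow> \<phi> g \<in> carrier D"
    and phi_one [simp]: "\<phi> \<one>\<^bsub>G\<^esub> = \<one>"
    and phi_mult: "\<lbrakk>g \<in> carrier G; h \<in> carrier G\<rbrakk> \<Longrightarrow> \<phi> (g \<otimes>\<^bsub>G\<^esub> h) = \<phi> g \<otimes> \<phi> h"
    and phi_N: "g \<in> N \<Longrightarrow> \<phi> g \<in> F"
    and phi_conj: "\<lbrakk>g \<in> carrier G; f \<in> F\<rbrakk> \<Longrightarrow> \<phi> g \<otimes> f \<otimes> \<phi> (inv\<^bsub>G\<^esub> g) \<in> F"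
    and transversal: "\<alpha> \<in> carrier (G Mod N) \<Longrightarrow> \<xi> \<alpha> \<in> \<alpha>"
    and independent: "\<lbrakk>finite A; A \<subseteq> carrier (G Mod N); c ` A \<subseteq> F;
      (\<Oplus>\<alpha>\<in>A. c \<alpha> \<otimes> \<phi> (\<xi> \<alpha>)) = \<zero>\<rbrakk> \<Longrightarrow> \<forall>\<alpha>\<in>A. c \<alpha> = \<zero>"
begin

abbreviation "Q \<equiv> G Mod N"

lemma F_simps [simp]:
  "\<zero> \<in> F" "\<one> \<in> F" "\<lbrakk>a \<in> F; b \<in> F\<rbrakk> \<Longrightarrow> a \<oplus> b \<in> F" "\<lbrakk>a \<in> F; b \<in> F\<rbrakk> \<Longrightarrow> a \<otimes> b \<in> F"
  "a \<in> F \<Longrightarrow> \<ominus> a \<in> F"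
  using F by (auto simp: div_closed_def)

lemma F_carrier [simp]: "a \<in> F \<Longrightarrow> a \<in> carrier D"
  using F by (auto simp: div_closed_def)

lemmas division_inv = division_ring_inv[OF division]

lemma no_zero_divisors:
  assumes "a \<in> carrier D" "b \<in> carrier D" "a \<otimes> b = \<zero>"
  shows "a = \<zero> \<or> b = \<zero>"
proof (rule disjCI)
  assume "b \<noteq> \<zero>"
  then have "a = a \<otimes> b \<otimes> inv b"
    using division_inv[of b] assms(1,2) by (simp add: m_assoc)
  also have "\<dots> = \<zero>" using division_inv[of b] \<open>b \<noteq> \<zero>\<close> assms by simp
  finally show "a = \<zero>" .
qed

lemma F_inv: "\<lbrakk>a \<in> F; a \<noteq> \<zero>\<rbrakk> \<Longrightarrow> inv a \<in> F"
  using F by (auto simp: div_closed_def)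

lemma phi_inv:
  assumes "g \<in> carrier G"
  shows "\<phi> g \<otimes> \<phi> (inv\<^bsub>G\<^esub> g) = \<one>" "\<phi> (inv\<^bsub>G\<^esub> g) \<otimes> \<phi> g = \<one>"
  using assms by (simp_all flip: phi_mult)

lemma phi_inv_cancel:
  assumes "g \<in> carrier G" "a \<in> carrier D"
  shows "\<phi> g \<otimes> (\<phi> (inv\<^bsub>G\<^esub> g) \<otimes> a) = a" "\<phi> (inv\<^bsub>G\<^esub> g) \<otimes> (\<phi> g \<otimes> a) = a"
  using assms phi_inv by (simp_all flip: m_assoc)

lemma phi_nonzero: "g \<in> carrier G \<Longrightarrow> \<phi> g \<noteq> \<zero>"
  using phi_inv[of g] division by (auto simp: division_ring_def)

lemma coset_carrier [simp]: "g \<in> carrier G \<Longrightarrow> N #>\<^bsub>G\<^esub> g \<in> carrier Q"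
  by (simp add: carrier_FactGroup)

lemma coset_mult: "\<lbrakk>g \<in> carrier G; h \<in> carrier G\<rbrakk> \<Longrightarrow>
    (N #>\<^bsub>G\<^esub> g) \<otimes>\<^bsub>Q\<^esub> (N #>\<^bsub>G\<^esub> h) = N #>\<^bsub>G\<^esub> (g \<otimes>\<^bsub>G\<^esub> h)"
  by (simp add: G.rcos_sum)

lemma mem_coset:
  assumes "\<alpha> \<in> carrier Q" "g \<in> \<alpha>"
  shows "g \<in> carrier G" "N #>\<^bsub>G\<^esub> g = \<alpha>"
proof -
  obtain a where a: "a \<in> carrier G" "\<alpha> = N #>\<^bsub>G\<^esub> a"
    using assms(1) by (auto simp: carrier_FactGroup)
  then show "g \<in> carrier G" using assms(2) G.r_coset_subset_G G.subset by blast
  show "N #>\<^bsub>G\<^esub> g = \<alpha>"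
    using a assms(2) G.repr_independence G.is_subgroup by metis
qed

lemma transversal_closed [simp]: "\<alpha> \<in> carrier Q \<Longrightarrow> \<xi> \<alpha> \<in> carrier G"
  and transversal_coset [simp]: "\<alpha> \<in> carrier Q \<Longrightarrow> N #>\<^bsub>G\<^esub> \<xi> \<alpha> = \<alpha>"
  using mem_coset transversal by blast+

lemma same_coset:
  assumes "g \<in> carrier G" "h \<in> carrier G" "N #>\<^bsub>G\<^esub> g = N #>\<^bsub>G\<^esub> h"
  shows "g \<otimes>\<^bsub>G\<^esub> inv\<^bsub>G\<^esub> h \<in> N"
proof -
  have "g \<in> N #>\<^bsub>G\<^esub> h"
    using G.rcos_self[OF assms(1) G.is_subgroup] assms(3) by simp
  then show ?thesis
    using G.rcos_module_imp[OF G.is_group assms(2)] by simp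
qed

inductive_set Span :: "'g set set \<Rightarrow> 'a set" for S where
  Span_zero [simp]: "\<zero> \<in> Span S"
| Span_add_term: "\<lbrakk>f \<in> F; g \<in> carrier G; N #>\<^bsub>G\<^esub> g \<in> S; r \<in> Span S\<rbrakk> \<Longrightarrow> f \<otimes> \<phi> g \<oplus> r \<in> Span S"

lemma Span_carrier [simp]: "r \<in> Span S \<Longrightarrow> r \<in> carrier D"
  by (induction rule: Span.induct) auto

lemma Span_mono: "\<lbrakk>r \<in> Span S; S \<subseteq> T\<rbrakk> \<Longrightarrow> r \<in> Span T"
  by (induction rule: Span.induct) (auto intro: Span.intros)

lemma Span_term: "\<lbrakk>f \<in> F; g \<in> carrier G; N #>\<^bsub>G\<^esub> g \<in> S\<rbrakk> \<Longrightarrow> f \<otimes> \<phi> g \<in> Span S"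
  using Span_add_term[of f g S \<zero>] by simp

lemma Span_phi: "\<lbrakk>g \<in> carrier G; N #>\<^bsub>G\<^esub> g \<in> S\<rbrakk> \<Longrightarrow> \<phi> g \<in> Span S"
  using Span_term[of \<one> g S] by simp

lemma Span_add:
  assumes "a \<in> Span S" "b \<in> Span S"
  shows "a \<oplus> b \<in> Span S"
  using assms by (induction rule: Span.induct) (auto simp: a_assoc intro: Span_add_term)

lemma Span_uminus: "a \<in> Span S \<Longrightarrow> \<ominus> a \<in> Span S"
proof (induction rule: Span.induct)
  case (Span_add_term f g r)
  then have "\<ominus> (f \<otimes> \<phi> g \<oplus> r) = (\<ominus> f) \<otimes> \<phi> g \<oplus> \<ominus> r"
    by (simp add: minus_add l_minus)
  then show ?case using Span_add_term Span.Span_add_term by simp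
qed simp

lemma Span_minus: "\<lbrakk>a \<in> Span S; b \<in> Span S\<rbrakk> \<Longrightarrow> a \<ominus> b \<in> Span S"
  by (simp add: a_minus_def Span_add Span_uminus)

lemma Span_mult:
  assumes "a \<in> Span S" "b \<in> Span T"
    and "\<And>\<alpha> \<beta>. \<lbrakk>\<alpha> \<in> S; \<beta> \<in> T; \<alpha> \<in> carrier Q; \<beta> \<in> carrier Q\<rbrakk> \<Longrightarrow> \<alpha> \<otimes>\<^bsub>Q\<^esub> \<beta> \<in> U"
  shows "a \<otimes> b \<in> Span U"
  using assms(1)
proof (induction rule: Span.induct)
  case Span_zero
  then show ?case using Span_carrier[OF assms(2)] by simp
next
  case (Span_add_term f g r)
  have "f \<otimes> \<phi> g \<otimes> b \<in> Span U"
    using assms(2)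
  proof (induction rule: Span.induct)
    case Span_zero
    then show ?case using Span_add_term by simp
  next
    case (Span_add_term f' g' r')
    note gr = \<open>f \<in> F\<close> \<open>g \<in> carrier G\<close> Span_add_term(1,2)
    \<comment> \<open>Moving \<open>f'\<close> to the left of \<open>\<phi> g\<close> conjugates it,
      and \<open>F\<close> is stable under conjugation by group elements.\<close>
    have "f \<otimes> \<phi> g \<otimes> (f' \<otimes> \<phi> g') = f \<otimes> (\<phi> g \<otimes> f' \<otimes> \<phi> (inv\<^bsub>G\<^esub> g)) \<otimes> \<phi> (g \<otimes>\<^bsub>G\<^esub> g')"
      using gr by (simp add: phi_mult m_assoc phi_inv_cancel)
    moreover have "N #>\<^bsub>G\<^esub> (g \<otimes>\<^bsub>G\<^esub> g') \<in> U"
      using assms(3)[OF \<open>N #>\<^bsub>G\<^esub> g \<in> S\<close> \<open>N #>\<^bsub>G\<^esub> g' \<in> T\<close>] gr by (simp add: coset_mult del: mult_FactGroup)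
    ultimately have "f \<otimes> \<phi> g \<otimes> (f' \<otimes> \<phi> g') \<in> Span U"
      using gr phi_conj by (simp add: Span_term)
    then show ?case
      using Span_add_term gr by (simp add: r_distr Span_add)
  qed
  then show ?case
    using Span_add_term Span_carrier[OF assms(2)] by (simp add: l_distr Span_add)
qed

lemma Span_UnE:
  assumes "r \<in> Span (S \<union> T)"
  obtains a b where "a \<in> Span S" "b \<in> Span T" "r = a \<oplus> b"
proof -
  from assms have "\<exists>a\<in>Span S. \<exists>b\<in>Span T. r = a \<oplus> b"
  proof (induction rule: Span.induct)
    case Span_zero
    have "\<zero> = \<zero> \<oplus> \<zero>" by simp
    then show ?case using Span.Span_zero by blast
  next
    case (Span_add_term f g r)
    then obtain a b where ab: "a \<in> Span S" "b \<in> Span T" "r = a \<oplus> b" by blast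
    have c: "f \<in> carrier D" "\<phi> g \<in> carrier D" "a \<in> carrier D" "b \<in> carrier D"
      using Span_add_term ab by auto
    show ?case
    proof (cases "N #>\<^bsub>G\<^esub> g \<in> S")
      case True
      then have "f \<otimes> \<phi> g \<oplus> a \<in> Span S" using Span_add_term ab by (simp add: Span.Span_add_term)
      moreover have "f \<otimes> \<phi> g \<oplus> r = (f \<otimes> \<phi> g \<oplus> a) \<oplus> b" using ab c by (simp add: a_assoc)
      ultimately show ?thesis using ab by blast
    next
      case False
      then have "f \<otimes> \<phi> g \<oplus> b \<in> Span T" using Span_add_term ab by (simp add: Span.Span_add_term)
      moreover have "f \<otimes> \<phi> g \<oplus> r = a \<oplus> (f \<otimes> \<phi> g \<oplus> b)" using ab c by (simp add: a_lcomm)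
      ultimately show ?thesis using ab by blast
    qed
  qed
  then show ?thesis using that by blast
qed

text \<open>Evaluation of an element of the crossed product in \<open>D\<close>. It will turn out
  injective and multiplicative, so that the Ore condition passes to
  \<open>Span (carrier Q)\<close>.\<close>

definition Psi :: "('g set \<Rightarrow> 'a) \<Rightarrow> 'a" where
  "Psi c = (\<Oplus>\<alpha>\<in>cp_supp D (carrier Q) c. c \<alpha> \<otimes> \<phi> (\<xi> \<alpha>))"

abbreviation FQ :: "('g set \<Rightarrow> 'a) set" where
  "FQ \<equiv> cp_carrier (D\<lparr>carrier := F\<rparr>) Q"

lemma FQ_D:
  assumes "c \<in> FQ"
  shows "c \<alpha> \<in> F" "c \<alpha> \<in> carrier D" "finite (cp_supp D (carrier Q) c)" "cp_supp D (carrier Q) c \<subseteq> carrier Q"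
    "\<alpha> \<notin> cp_supp D (carrier Q) c \<Longrightarrow> c \<alpha> = \<zero>"
proof -
  show "c \<alpha> \<in> F" using assms by (cases "\<alpha> \<in> carrier Q") (auto simp: cp_carrier_def)
  then show "c \<alpha> \<in> carrier D" by simp
qed (use assms in \<open>auto simp: cp_carrier_def cp_supp_def\<close>)

lemma FQ_I:
  assumes "\<And>\<alpha>. c \<alpha> \<in> F" "finite A" "A \<subseteq> carrier Q" "\<And>\<alpha>. \<alpha> \<notin> A \<Longrightarrow> c \<alpha> = \<zero>"
  shows "c \<in> FQ"
proof -
  have "cp_supp D (carrier Q) c \<subseteq> A" using assms(4) by (auto simp: cp_supp_def)
  then show ?thesis
    using assms finite_subset by (auto simp: cp_carrier_def cp_supp_def)
qed

lemma Psi_superset: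
  assumes "c \<in> FQ" "finite A" "A \<subseteq> carrier Q" "cp_supp D (carrier Q) c \<subseteq> A"
  shows "Psi c = (\<Oplus>\<alpha>\<in>A. c \<alpha> \<otimes> \<phi> (\<xi> \<alpha>))"
  unfolding Psi_def using assms FQ_D[OF assms(1)]
  by (intro add.finprod_mono_neutral_cong_left) auto

lemma Psi_closed: "c \<in> FQ \<Longrightarrow> Psi c \<in> carrier D"
  using FQ_D[of c] by (auto simp: Psi_def intro!: finsum_closed)

lemma Psi_in_Span:
  assumes "c \<in> FQ" "cp_supp D (carrier Q) c \<subseteq> S"
  shows "Psi c \<in> Span S"
proof -
  have "(\<Oplus>\<alpha>\<in>A. c \<alpha> \<otimes> \<phi> (\<xi> \<alpha>)) \<in> Span S" if "finite A" "A \<subseteq> S" "A \<subseteq> carrier Q" for A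
    using that
  proof (induction rule: finite_induct)
    case (insert a A)
    then have a: "a \<in> S" "a \<in> carrier Q" by auto
    have "(\<Oplus>\<alpha>\<in>insert a A. c \<alpha> \<otimes> \<phi> (\<xi> \<alpha>)) = c a \<otimes> \<phi> (\<xi> a) \<oplus> (\<Oplus>\<alpha>\<in>A. c \<alpha> \<otimes> \<phi> (\<xi> \<alpha>))"
      using insert a FQ_D[OF assms(1)] by (intro finsum_insert) (auto simp: subset_iff)
    then show ?case using insert a FQ_D[OF assms(1)] by (auto intro: Span_add_term)
  qed simp
  then show ?thesis using assms FQ_D[OF assms(1)] by (simp add: Psi_def)
qed

text \<open>A representative \<open>g\<close> of the coset \<open>\<beta>\<close> differs from
  \<open>\<xi> \<beta>\<close> by a left factor in \<open>N\<close>, whose image lies in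
  \<open>F\<close> and is absorbed into the coefficient.\<close>

lemma Span_eq_Psi:
  assumes "r \<in> Span S"
  shows "\<exists>c \<in> FQ. cp_supp D (carrier Q) c \<subseteq> S \<and> Psi c = r"
  using assms
proof (induction rule: Span.induct)
  case Span_zero
  have "cp_supp D (carrier Q) (\<lambda>_. \<zero>) = {}" by (auto simp: cp_supp_def)
  moreover have "(\<lambda>_. \<zero>) \<in> FQ" by (rule FQ_I[of _ "{}"]) auto
  ultimately show ?case by (intro bexI[of _ "\<lambda>_. \<zero>"]) (auto simp: Psi_def)
next
  case (Span_add_term f g r)
  then obtain c where c: "c \<in> FQ" "cp_supp D (carrier Q) c \<subseteq> S" "Psi c = r" by blast
  define \<beta> where "\<beta> = N #>\<^bsub>G\<^esub> g"
  \<comment> \<open>With \<open>\<beta>\<close> removed, \<open>finsum_insert\<close> covers both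
    cases, whether or not \<open>\<beta>\<close> already occurs in \<open>c\<close>.\<close>
  define B where "B = cp_supp D (carrier Q) c - {\<beta>}"
  define h where "h = g \<otimes>\<^bsub>G\<^esub> inv\<^bsub>G\<^esub> (\<xi> \<beta>)"
  have \<beta>: "\<beta> \<in> carrier Q" "\<beta> \<in> S" using Span_add_term by (auto simp: \<beta>_def)
  have h: "h \<in> N" unfolding h_def
    using \<beta> Span_add_term by (intro same_coset) (auto simp: \<beta>_def simp del: carrier_FactGroup)
  then have hc: "h \<in> carrier G" using G.subset by blast
  have "g = h \<otimes>\<^bsub>G\<^esub> \<xi> \<beta>" using \<beta> Span_add_term by (simp add: h_def G.m_assoc)
  then have g: "\<phi> g = \<phi> h \<otimes> \<phi> (\<xi> \<beta>)" using \<beta> hc phi_mult by simp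
  define c' where "c' = c(\<beta> := c \<beta> \<oplus> f \<otimes> \<phi> h)"
  have B: "finite B" "B \<subseteq> carrier Q" "\<beta> \<notin> B" "B \<subseteq> S"
    using FQ_D[OF c(1)] c(2) by (auto simp: B_def)
  have c'F: "c' \<alpha> \<in> F" for \<alpha> using FQ_D[OF c(1)] Span_add_term phi_N[OF h] by (simp add: c'_def)
  have c'0: "c' \<alpha> = \<zero>" if "\<alpha> \<notin> insert \<beta> B" for \<alpha>
    using that FQ_D(5)[OF c(1)] by (auto simp: c'_def B_def)
  have c'FQ: "c' \<in> FQ"
    by (rule FQ_I[of _ "insert \<beta> B"]) (use B \<beta> c'F c'0 in auto)
  have sup: "cp_supp D (carrier Q) c' \<subseteq> insert \<beta> B"
    using c'0 by (auto simp: cp_supp_def)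
  have "Psi c' = (\<Oplus>\<alpha>\<in>insert \<beta> B. c' \<alpha> \<otimes> \<phi> (\<xi> \<alpha>))"
    using B \<beta> c'FQ sup by (intro Psi_superset) auto
  also have "\<dots> = c' \<beta> \<otimes> \<phi> (\<xi> \<beta>) \<oplus> (\<Oplus>\<alpha>\<in>B. c' \<alpha> \<otimes> \<phi> (\<xi> \<alpha>))"
    using B \<beta> c'F by (intro finsum_insert) (auto simp: subset_iff)
  also have "(\<Oplus>\<alpha>\<in>B. c' \<alpha> \<otimes> \<phi> (\<xi> \<alpha>)) = (\<Oplus>\<alpha>\<in>B. c \<alpha> \<otimes> \<phi> (\<xi> \<alpha>))"
    using B FQ_D[OF c(1)] by (intro finsum_cong') (auto simp: c'_def subset_iff)
  also have "c' \<beta> \<otimes> \<phi> (\<xi> \<beta>) = f \<otimes> \<phi> g \<oplus> c \<beta> \<otimes> \<phi> (\<xi> \<beta>)"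
    using FQ_D[OF c(1)] Span_add_term \<beta> g hc by (simp add: c'_def l_distr m_assoc a_comm)
  also have "f \<otimes> \<phi> g \<oplus> c \<beta> \<otimes> \<phi> (\<xi> \<beta>) \<oplus> (\<Oplus>\<alpha>\<in>B. c \<alpha> \<otimes> \<phi> (\<xi> \<alpha>))
      = f \<otimes> \<phi> g \<oplus> (c \<beta> \<otimes> \<phi> (\<xi> \<beta>) \<oplus> (\<Oplus>\<alpha>\<in>B. c \<alpha> \<otimes> \<phi> (\<xi> \<alpha>)))"
    using FQ_D[OF c(1)] Span_add_term \<beta> B by (intro a_assoc finsum_closed) (auto simp: subset_iff)
  also have "c \<beta> \<otimes> \<phi> (\<xi> \<beta>) \<oplus> (\<Oplus>\<alpha>\<in>B. c \<alpha> \<otimes> \<phi> (\<xi> \<alpha>)) = (\<Oplus>\<alpha>\<in>insert \<beta> B. c \<alpha> \<otimes> \<phi> (\<xi> \<alpha>))"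
    using B \<beta> FQ_D[OF c(1)] by (intro finsum_insert[symmetric]) (auto simp: subset_iff)
  also have "\<dots> = r"
    using B \<beta> c Psi_superset[OF c(1), of "insert \<beta> B"] by (metis B_def Diff_subset_conv \<open>Psi c = r\<close> finite.insertI insert_is_Un insert_subset order_refl)
  finally show ?case using c'FQ sup B \<beta> by blast
qed

lemma FQ_minus: "\<lbrakk>c \<in> FQ; d \<in> FQ\<rbrakk> \<Longrightarrow> (\<lambda>\<alpha>. c \<alpha> \<ominus> d \<alpha>) \<in> FQ"
  using FQ_D[of c] FQ_D[of d]
  by (intro FQ_I[of _ "cp_supp D (carrier Q) c \<union> cp_supp D (carrier Q) d"]) (auto simp: a_minus_def)

lemma Psi_minus:
  assumes "c \<in> FQ" "d \<in> FQ"
  shows "Psi (\<lambda>\<alpha>. c \<alpha> \<ominus> d \<alpha>) = Psi c \<ominus> Psi d"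
proof -
  define A where "A = cp_supp D (carrier Q) c \<union> cp_supp D (carrier Q) d"
  have A: "finite A" "A \<subseteq> carrier Q" using FQ_D[OF assms(1)] FQ_D[OF assms(2)] by (auto simp: A_def)
  define p where "p \<alpha> = c \<alpha> \<otimes> \<phi> (\<xi> \<alpha>)" for \<alpha>
  define q where "q \<alpha> = d \<alpha> \<otimes> \<phi> (\<xi> \<alpha>)" for \<alpha>
  have pq: "p \<in> A \<rightarrow> carrier D" "q \<in> A \<rightarrow> carrier D" "(\<lambda>\<alpha>. p \<alpha> \<ominus> q \<alpha>) \<in> A \<rightarrow> carrier D"
    using A FQ_D[OF assms(1)] FQ_D[OF assms(2)] by (auto simp: p_def q_def subset_iff)
  have "Psi (\<lambda>\<alpha>. c \<alpha> \<ominus> d \<alpha>) = (\<Oplus>\<alpha>\<in>A. (c \<alpha> \<ominus> d \<alpha>) \<otimes> \<phi> (\<xi> \<alpha>))"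
  proof (rule Psi_superset[OF FQ_minus[OF assms] A])
    show "cp_supp D (carrier Q) (\<lambda>\<alpha>. c \<alpha> \<ominus> d \<alpha>) \<subseteq> A"
      using FQ_D(5)[OF assms(1)] FQ_D(5)[OF assms(2)]
      by (auto simp: A_def cp_supp_def a_minus_def)
  qed
  also have "\<dots> = (\<Oplus>\<alpha>\<in>A. p \<alpha> \<ominus> q \<alpha>)"
    using A FQ_D[OF assms(1)] FQ_D[OF assms(2)] pq
    by (intro finsum_cong') (auto simp: p_def q_def subset_iff a_minus_def l_distr l_minus)
  finally have 1: "Psi (\<lambda>\<alpha>. c \<alpha> \<ominus> d \<alpha>) = (\<Oplus>\<alpha>\<in>A. p \<alpha> \<ominus> q \<alpha>)" .
  have "(\<Oplus>\<alpha>\<in>A. p \<alpha> \<ominus> q \<alpha>) \<oplus> (\<Oplus>\<alpha>\<in>A. q \<alpha>) = (\<Oplus>\<alpha>\<in>A. (p \<alpha> \<ominus> q \<alpha>) \<oplus> q \<alpha>)"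
    using pq by (intro finsum_addf[symmetric]) auto
  also have "\<dots> = (\<Oplus>\<alpha>\<in>A. p \<alpha>)"
    using pq by (intro finsum_cong') (auto simp: a_minus_def a_assoc l_neg dest!: funcset_mem)
  finally have "(\<Oplus>\<alpha>\<in>A. p \<alpha> \<ominus> q \<alpha>) \<oplus> (\<Oplus>\<alpha>\<in>A. q \<alpha>) = (\<Oplus>\<alpha>\<in>A. p \<alpha>)" .
  moreover have "(\<Oplus>\<alpha>\<in>A. p \<alpha>) = Psi c" "(\<Oplus>\<alpha>\<in>A. q \<alpha>) = Psi d"
    using Psi_superset[OF assms(1) A] Psi_superset[OF assms(2) A] by (auto simp: A_def p_def q_def)
  ultimately show ?thesis
    using 1 pq by (metis Psi_closed a_minus_def add.inv_solve_right' add.finprod_closed assms)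
qed

lemma Psi_eq_zero:
  assumes "c \<in> FQ" "Psi c = \<zero>"
  shows "c = (\<lambda>_. \<zero>)"
proof
  fix \<alpha>
  show "c \<alpha> = \<zero>"
    using independent[of "cp_supp D (carrier Q) c" c] FQ_D[OF assms(1)] assms(2)
    by (cases "\<alpha> \<in> cp_supp D (carrier Q) c") (auto simp: Psi_def)
qed

lemma Psi_inj:
  assumes "c \<in> FQ" "d \<in> FQ" "Psi c = Psi d"
  shows "c = d"
proof
  fix \<alpha>
  have "Psi (\<lambda>\<alpha>. c \<alpha> \<ominus> d \<alpha>) = \<zero>"
    unfolding Psi_minus[OF assms(1,2)] assms(3)
    using Psi_closed[OF assms(2)] by (simp add: a_minus_def r_neg)
  then have "c \<alpha> \<ominus> d \<alpha> = \<zero>"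
    using Psi_eq_zero[OF FQ_minus[OF assms(1,2)]] by metis
  then show "c \<alpha> = d \<alpha>"
    by (rule minus_eq_zeroD[OF FQ_D(2)[OF assms(1)] FQ_D(2)[OF assms(2)]])
qed

text \<open>Coordinates with respect to the transversal are unique, so the support of
  \<open>r\<close> would lie in both sets.\<close>

lemma Span_disjoint:
  assumes "r \<in> Span S" "r \<in> Span T" "S \<inter> T = {}"
  shows "r = \<zero>"
proof -
  obtain c where c: "c \<in> FQ" "cp_supp D (carrier Q) c \<subseteq> S" "Psi c = r"
    using Span_eq_Psi[OF assms(1)] by blast
  obtain d where d: "d \<in> FQ" "cp_supp D (carrier Q) d \<subseteq> T" "Psi d = r"
    using Span_eq_Psi[OF assms(2)] by blast
  have "c = d" using Psi_inj c d by simp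
  then have "cp_supp D (carrier Q) c = {}" using c d assms(3) by auto
  then show ?thesis using c by (simp add: Psi_def)
qed

lemma Span_finite_support:
  assumes "r \<in> Span S"
  obtains A where "finite A" "A \<subseteq> S" "r \<in> Span A"
proof -
  obtain c where c: "c \<in> FQ" "cp_supp D (carrier Q) c \<subseteq> S" "Psi c = r"
    using Span_eq_Psi[OF assms] by blast
  then show ?thesis
    using that[of "cp_supp D (carrier Q) c"] FQ_D[OF c(1)] Psi_in_Span[OF c(1)] by auto
qed

text \<open>This singles out a coset of the support without naming coordinates.
  \<open>RH_left_Ore\<close> uses it to find a part of an Ore multiplier that is nonzero.\<close>

lemma Span_nonzeroE:
  assumes "r \<in> Span (carrier Q)" "r \<noteq> \<zero>"
  obtains \<alpha> where "\<alpha> \<in> carrier Q" "r \<notin> Span (carrier Q - {\<alpha>})"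
proof -
  obtain c where c: "c \<in> FQ" "Psi c = r"
    using Span_eq_Psi[OF assms(1)] by blast
  then have "cp_supp D (carrier Q) c \<noteq> {}" using assms(2) by (auto simp: Psi_def)
  then obtain \<alpha> where a: "\<alpha> \<in> cp_supp D (carrier Q) c" by blast
  have "r \<notin> Span (carrier Q - {\<alpha>})"
  proof
    assume "r \<in> Span (carrier Q - {\<alpha>})"
    then obtain d where d: "d \<in> FQ" "cp_supp D (carrier Q) d \<subseteq> carrier Q - {\<alpha>}" "Psi d = r"
      using Span_eq_Psi by blast
    then show False using Psi_inj[OF c(1) d(1)] c a by auto
  qed
  then show thesis using that a FQ_D(4)[OF c(1)] by blast
qed

end

section \<open>The crossed product\<close>

lemma (in abelian_monoid) finsum_fibres:
  assumes "finite A" "finite B" "finite C" "\<And>a b. \<lbrakk>a \<in> A; b \<in> B\<rbrakk> \<Longrightarrow> m a b \<in> C"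
    and t: "\<And>a b. \<lbrakk>a \<in> A; b \<in> B\<rbrakk> \<Longrightarrow> t (a, b) \<in> carrier G"
  shows "(\<Oplus>c\<in>C. \<Oplus>p\<in>{(a, b). a \<in> A \<and> b \<in> B \<and> m a b = c}. t p) = (\<Oplus>a\<in>A. \<Oplus>b\<in>B. t (a, b))"
proof -
  let ?P = "\<lambda>c. {(a, b). a \<in> A \<and> b \<in> B \<and> m a b = c}"
  have "finite (?P c)" for c
    by (rule finite_subset[of _ "A \<times> B"]) (use assms in auto)
  then have "finsum G t (\<Union>(?P ` C)) = (\<Oplus>c\<in>C. finsum G t (?P c))"
    using assms by (intro add.finprod_UN_disjoint) (auto simp: pairwise_def disjnt_def)
  moreover have "\<Union>(?P ` C) = (\<Union>a\<in>A. Pair a ` B)"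
    using assms(4) by auto
  moreover have "finsum G t (\<Union>a\<in>A. Pair a ` B) = (\<Oplus>a\<in>A. finsum G t (Pair a ` B))"
    using assms by (intro add.finprod_UN_disjoint) (auto simp: pairwise_def disjnt_def)
  moreover have "(\<Oplus>a\<in>A. finsum G t (Pair a ` B)) = (\<Oplus>a\<in>A. \<Oplus>b\<in>B. t (a, b))"
    using t by (intro finsum_cong' finsum_reindex) (auto intro!: finsum_closed inj_onI simp: finsum_reindex)
  ultimately show ?thesis by simp
qed

context graded_division
begin

text \<open>Keeping the element type of \<open>D\<close> makes this ring an instance of the
  quantifier over division rings in \<open>good_embedding\<close>.\<close>

abbreviation "F_ring \<equiv> D\<lparr>carrier := F\<rparr>"

lemma cp_supp_F_ring [simp]: "cp_supp F_ring = cp_supp D"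
  by (intro ext) (simp add: cp_supp_def)

lemma F_ring_ring: "ring F_ring"
proof (rule ringI)
  show "abelian_group F_ring"
  proof (rule abelian_groupI)
    fix x assume "x \<in> carrier F_ring"
    then show "\<exists>y\<in>carrier F_ring. y \<oplus>\<^bsub>F_ring\<^esub> x = \<zero>\<^bsub>F_ring\<^esub>"
      by (auto intro!: bexI[of _ "\<ominus> x"] simp: l_neg)
  qed (auto simp: a_ac)
  show "monoid F_ring"
    by (rule monoidI) (auto simp: m_assoc)
qed (auto simp: l_distr r_distr)

lemma F_ring_Units: "x \<in> F \<Longrightarrow> x \<noteq> \<zero> \<Longrightarrow> x \<in> Units F_ring"
  using F_inv[of x] division_inv(3,4)[of x] unfolding Units_def by (auto intro!: bexI[of _ "inv x"] simp del: Units_l_inv_ex Units_r_inv_ex)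

lemma F_ring_division: "division_ring F_ring"
  using F_ring_ring F_ring_Units division by (auto simp: division_ring_def)

lemma finsum_F_ring:
  assumes "h \<in> A \<rightarrow> F"
  shows "finsum F_ring h A = finsum D h A"
proof -
  interpret FR: ring F_ring by (rule F_ring_ring)
  show ?thesis
    using assms
  proof (induction A rule: infinite_finite_induct)
    case (infinite A)
    then show ?case by (simp add: finsum_infinite FR.finsum_infinite)
  next
    case empty
    then show ?case by simp
  next
    case (insert a A)
    have "finsum F_ring h (insert a A) = h a \<oplus> finsum F_ring h A"
      using insert FR.finsum_insert[of A a h] by simp
    also have "\<dots> = finsum D h (insert a A)"
      using insert by (subst finsum_insert) (auto simp: Pi_iff)
    finally show ?case .
  qed
qed

definition sig :: "'g set \<Rightarrow> 'a \<Rightarrow> 'a" where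
  "sig \<alpha> r = \<phi> (\<xi> \<alpha>) \<otimes> r \<otimes> \<phi> (inv\<^bsub>G\<^esub> \<xi> \<alpha>)"

definition tau :: "'g set \<Rightarrow> 'g set \<Rightarrow> 'a" where
  "tau \<alpha> \<beta> = \<phi> (\<xi> \<alpha> \<otimes>\<^bsub>G\<^esub> \<xi> \<beta> \<otimes>\<^bsub>G\<^esub> inv\<^bsub>G\<^esub> \<xi> (\<alpha> \<otimes>\<^bsub>Q\<^esub> \<beta>))"

lemma Q_mult_closed [simp]: "\<lbrakk>\<alpha> \<in> carrier Q; \<beta> \<in> carrier Q\<rbrakk> \<Longrightarrow> \<alpha> \<otimes>\<^bsub>Q\<^esub> \<beta> \<in> carrier Q"
  using G.factorgroup_is_group by (simp add: group.is_monoid monoid.m_closed del: mult_FactGroup carrier_FactGroup)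

lemma sig_closed: "\<lbrakk>\<alpha> \<in> carrier Q; r \<in> F\<rbrakk> \<Longrightarrow> sig \<alpha> r \<in> F"
  by (simp add: sig_def phi_conj)

lemma tau_closed:
  assumes "\<alpha> \<in> carrier Q" "\<beta> \<in> carrier Q"
  shows "tau \<alpha> \<beta> \<in> F" "tau \<alpha> \<beta> \<noteq> \<zero>"
proof -
  have "N #>\<^bsub>G\<^esub> (\<xi> \<alpha> \<otimes>\<^bsub>G\<^esub> \<xi> \<beta>) = \<alpha> \<otimes>\<^bsub>Q\<^esub> \<beta>"
    using coset_mult[of "\<xi> \<alpha>" "\<xi> \<beta>"] assms by (simp del: mult_FactGroup carrier_FactGroup)
  then show "tau \<alpha> \<beta> \<in> F"
    unfolding tau_def using assms
    by (intro phi_N same_coset) (simp_all del: mult_FactGroup carrier_FactGroup)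
  show "tau \<alpha> \<beta> \<noteq> \<zero>"
    unfolding tau_def using assms by (intro phi_nonzero) (simp del: mult_FactGroup carrier_FactGroup)
qed

lemma sig_hom:
  assumes "\<alpha> \<in> carrier Q"
  shows "sig \<alpha> \<in> ring_hom F_ring F_ring" "bij_betw (sig \<alpha>) F F"
proof -
  have g: "\<xi> \<alpha> \<in> carrier G" using assms by simp
  show "sig \<alpha> \<in> ring_hom F_ring F_ring"
  proof (rule ring_hom_memI)
    fix x y assume "x \<in> carrier F_ring" "y \<in> carrier F_ring"
    then show "sig \<alpha> (x \<otimes>\<^bsub>F_ring\<^esub> y) = sig \<alpha> x \<otimes>\<^bsub>F_ring\<^esub> sig \<alpha> y"
      "sig \<alpha> (x \<oplus>\<^bsub>F_ring\<^esub> y) = sig \<alpha> x \<oplus>\<^bsub>F_ring\<^esub> sig \<alpha> y"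
      using g by (simp_all add: sig_def m_assoc phi_inv_cancel l_distr r_distr)
  qed (use assms g sig_closed phi_inv in \<open>auto simp: sig_def\<close>)
  show "bij_betw (sig \<alpha>) F F"
  proof (rule bij_betw_byWitness[where f' = "\<lambda>r. \<phi> (inv\<^bsub>G\<^esub> \<xi> \<alpha>) \<otimes> r \<otimes> \<phi> (\<xi> \<alpha>)"])
    show "(\<lambda>r. \<phi> (inv\<^bsub>G\<^esub> \<xi> \<alpha>) \<otimes> r \<otimes> \<phi> (\<xi> \<alpha>)) ` F \<subseteq> F"
      using phi_conj[of "inv\<^bsub>G\<^esub> \<xi> \<alpha>"] g by auto
  qed (use g assms sig_closed phi_inv in \<open>auto simp: sig_def m_assoc phi_inv_cancel\<close>)
qed

lemma term_mult:
  assumes "\<alpha> \<in> carrier Q" "\<beta> \<in> carrier Q" "a \<in> F" "b \<in> F"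
  shows "a \<otimes> sig \<alpha> b \<otimes> tau \<alpha> \<beta> \<otimes> \<phi> (\<xi> (\<alpha> \<otimes>\<^bsub>Q\<^esub> \<beta>)) = (a \<otimes> \<phi> (\<xi> \<alpha>)) \<otimes> (b \<otimes> \<phi> (\<xi> \<beta>))"
proof -
  have c: "\<xi> (\<alpha> \<otimes>\<^bsub>Q\<^esub> \<beta>) \<in> carrier G" "\<xi> \<alpha> \<in> carrier G" "\<xi> \<beta> \<in> carrier G"
    using assms by (auto simp del: mult_FactGroup carrier_FactGroup)
  have "tau \<alpha> \<beta> \<otimes> \<phi> (\<xi> (\<alpha> \<otimes>\<^bsub>Q\<^esub> \<beta>)) = \<phi> (\<xi> \<alpha>) \<otimes> \<phi> (\<xi> \<beta>)"
    unfolding tau_def using c by (simp add: phi_mult m_assoc phi_inv del: mult_FactGroup)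
  moreover have "tau \<alpha> \<beta> \<in> carrier D" "sig \<alpha> b \<in> carrier D"
    using tau_closed sig_closed assms by auto
  ultimately show ?thesis
    using assms c by (simp add: m_assoc sig_def phi_inv_cancel del: mult_FactGroup)
qed

abbreviation "cpm \<equiv> cp_mult F_ring Q sig tau"

text \<open>\<open>term_mult\<close> compares single terms; \<open>finsum_fibres\<close> then
  regroups the double sum along the fibres of multiplication in the quotient.\<close>

lemma cp_mult_FQ:
  assumes c: "c \<in> FQ" and d: "d \<in> FQ"
  shows "cpm c d \<in> FQ" "Psi (cpm c d) = Psi c \<otimes> Psi d"
proof -
  define A where "A = cp_supp D (carrier Q) c"
  define B where "B = cp_supp D (carrier Q) d"
  define C where "C = (\<lambda>(a, b). a \<otimes>\<^bsub>Q\<^esub> b) ` (A \<times> B)"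
  define P where "P \<gamma> = {(a, b). a \<in> A \<and> b \<in> B \<and> a \<otimes>\<^bsub>Q\<^esub> b = \<gamma>}" for \<gamma>
  define e where "e p = c (fst p) \<otimes> sig (fst p) (d (snd p)) \<otimes> tau (fst p) (snd p)" for p
  note cD = FQ_D[OF c] and dD = FQ_D[OF d]
  have A: "finite A" "A \<subseteq> carrier Q" and B: "finite B" "B \<subseteq> carrier Q"
    using cD dD by (auto simp: A_def B_def)
  have C: "finite C" "C \<subseteq> carrier Q"
    using A B by (auto simp: C_def subset_iff simp del: mult_FactGroup carrier_FactGroup)
  have fP: "finite (P \<gamma>)" for \<gamma>
    by (rule finite_subset[of _ "A \<times> B"]) (use A B in \<open>auto simp: P_def\<close>)
  have eF: "e p \<in> F" if "p \<in> P \<gamma>" for p \<gamma>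
    using that A B cD dD by (auto simp: P_def e_def intro!: F_simps sig_closed tau_closed)
  have e_eq: "(\<lambda>p. c (fst p) \<otimes> sig (fst p) (d (snd p)) \<otimes> tau (fst p) (snd p)) = e"
    by (auto simp: e_def)
  have m: "cpm c d \<gamma> = (if \<gamma> \<in> carrier Q then \<Oplus>p\<in>P \<gamma>. e p else \<zero>)" for \<gamma>
    using finsum_F_ring[of e "P \<gamma>"] eF by (auto simp: cp_mult_def e_eq A_def B_def P_def)
  have mF: "cpm c d \<gamma> \<in> F" for \<gamma>
  proof (cases "\<gamma> \<in> carrier Q")
    case True
    interpret FR: ring F_ring by (rule F_ring_ring)
    have "finsum F_ring e (P \<gamma>) \<in> F" using FR.finsum_closed[of e "P \<gamma>"] eF by auto
    then show ?thesis using m True finsum_F_ring[of e "P \<gamma>"] eF by auto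
  qed (use m in simp)
  have m0: "cpm c d \<gamma> = \<zero>" if "\<gamma> \<notin> C" for \<gamma>
  proof -
    have "P \<gamma> = {}" using that by (auto simp: P_def C_def)
    then show ?thesis using m by simp
  qed
  show FQ: "cpm c d \<in> FQ"
    using mF C m0 by (rule FQ_I)
  have sup: "cp_supp D (carrier Q) (cpm c d) \<subseteq> C"
    using m0 by (auto simp: cp_supp_def)
  define t where "t p = (c (fst p) \<otimes> \<phi> (\<xi> (fst p))) \<otimes> (d (snd p) \<otimes> \<phi> (\<xi> (snd p)))" for p
  have tc: "t (a, b) \<in> carrier D" if "a \<in> A" "b \<in> B" for a b
    using that A B cD dD by (auto simp: t_def subset_iff)
  have "Psi (cpm c d) = (\<Oplus>\<gamma>\<in>C. cpm c d \<gamma> \<otimes> \<phi> (\<xi> \<gamma>))"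
    by (rule Psi_superset[OF FQ C sup])
  also have "\<dots> = (\<Oplus>\<gamma>\<in>C. \<Oplus>p\<in>P \<gamma>. t p)"
  proof (rule finsum_cong'[OF refl])
    show "(\<lambda>\<gamma>. \<Oplus>p\<in>P \<gamma>. t p) \<in> C \<rightarrow> carrier D"
      using tc by (auto simp: P_def intro!: finsum_closed)
    fix \<gamma> assume "\<gamma> \<in> C"
    then have g: "\<gamma> \<in> carrier Q" using C by blast
    have "cpm c d \<gamma> \<otimes> \<phi> (\<xi> \<gamma>) = (\<Oplus>p\<in>P \<gamma>. e p) \<otimes> \<phi> (\<xi> \<gamma>)"
      using m g by simp
    also have "\<dots> = (\<Oplus>p\<in>P \<gamma>. e p \<otimes> \<phi> (\<xi> \<gamma>))"
      using fP g eF by (intro finsum_ldistr) auto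
    also have "\<dots> = (\<Oplus>p\<in>P \<gamma>. t p)"
    proof (rule finsum_cong'[OF refl])
      show "t \<in> P \<gamma> \<rightarrow> carrier D" using tc by (auto simp: P_def)
      fix p assume "p \<in> P \<gamma>"
      then obtain a b where "p = (a, b)" "a \<in> A" "b \<in> B" "a \<otimes>\<^bsub>Q\<^esub> b = \<gamma>" by (auto simp: P_def)
      then show "e p \<otimes> \<phi> (\<xi> \<gamma>) = t p"
        using term_mult[of a b "c a" "d b"] A B cD dD by (auto simp: e_def t_def subset_iff simp del: mult_FactGroup carrier_FactGroup)
    qed
    finally show "cpm c d \<gamma> \<otimes> \<phi> (\<xi> \<gamma>) = (\<Oplus>p\<in>P \<gamma>. t p)" .
  qed
  also have "\<dots> = (\<Oplus>a\<in>A. \<Oplus>b\<in>B. t (a, b))"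
    unfolding P_def using A B C tc by (intro finsum_fibres) (auto simp: C_def simp del: mult_FactGroup)
  also have "\<dots> = (\<Oplus>a\<in>A. (c a \<otimes> \<phi> (\<xi> a)) \<otimes> Psi d)"
  proof (rule finsum_cong'[OF refl])
    show "(\<lambda>a. (c a \<otimes> \<phi> (\<xi> a)) \<otimes> Psi d) \<in> A \<rightarrow> carrier D"
      using A cD Psi_closed[OF d] by (auto simp: subset_iff)
    fix a assume "a \<in> A"
    then show "(\<Oplus>b\<in>B. t (a, b)) = (c a \<otimes> \<phi> (\<xi> a)) \<otimes> Psi d"
      unfolding Psi_def t_def B_def[symmetric] fst_conv snd_conv
      using A B cD dD by (intro finsum_rdistr[symmetric]) (auto simp: subset_iff)
  qed
  also have "\<dots> = Psi c \<otimes> Psi d"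
    unfolding Psi_def[of c] A_def[symmetric]
    using A cD Psi_closed[OF d] by (intro finsum_ldistr[symmetric]) (auto simp: subset_iff)
  finally show "Psi (cpm c d) = Psi c \<otimes> Psi d" .
qed

text \<open>Associativity is pulled back from \<open>D\<close> along the injective multiplicative
  map \<open>Psi\<close>, so no cocycle identity has to be verified.\<close>

lemma crossed_product_data: "crossed_product_data F_ring Q sig tau"
  unfolding crossed_product_data_def
proof (intro conjI ballI)
  fix c d e assume "c \<in> FQ" "d \<in> FQ" "e \<in> FQ"
  then show "cpm (cpm c d) e = cpm c (cpm d e)"
    by (intro Psi_inj) (auto simp: cp_mult_FQ Psi_closed m_assoc)
qed (use sig_hom tau_closed in auto)

lemma Span_left_Ore:
  assumes "ore_domain (crossed_product F_ring Q sig tau)"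
    and "a \<in> Span (carrier Q)" "a \<noteq> \<zero>" "b \<in> Span (carrier Q)" "b \<noteq> \<zero>"
  obtains r s where "r \<in> Span (carrier Q)" "s \<in> Span (carrier Q)" "r \<otimes> a = s \<otimes> b" "r \<otimes> a \<noteq> \<zero>"
proof -
  let ?C = "crossed_product F_ring Q sig tau"
  obtain c where c: "c \<in> FQ" "Psi c = a" using Span_eq_Psi[OF assms(2)] by blast
  obtain d where d: "d \<in> FQ" "Psi d = b" using Span_eq_Psi[OF assms(4)] by blast
  have z: "Psi (\<lambda>_. \<zero>) = \<zero>" by (auto simp: Psi_def cp_supp_def)
  have "c \<noteq> (\<lambda>_. \<zero>)" "d \<noteq> (\<lambda>_. \<zero>)" using c d assms z by auto
  then have "c \<in> carrier ?C - {\<zero>\<^bsub>?C\<^esub>}" "d \<in> carrier ?C - {\<zero>\<^bsub>?C\<^esub>}"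
    using c d by (auto simp: crossed_product_def)
  then obtain r s where rs: "r \<in> carrier ?C" "s \<in> carrier ?C"
    "r \<otimes>\<^bsub>?C\<^esub> c = s \<otimes>\<^bsub>?C\<^esub> d" "r \<otimes>\<^bsub>?C\<^esub> c \<noteq> \<zero>\<^bsub>?C\<^esub>"
    using assms(1) unfolding ore_domain_def by metis
  then have rs': "r \<in> FQ" "s \<in> FQ" "cpm r c = cpm s d" "cpm r c \<noteq> (\<lambda>_. \<zero>)"
    by (auto simp: crossed_product_def)
  have "Psi r \<otimes> a = Psi s \<otimes> b" using rs' c d cp_mult_FQ by metis
  moreover have "Psi r \<otimes> a \<noteq> \<zero>" using rs' c cp_mult_FQ Psi_eq_zero by metis
  moreover have "Psi r \<in> Span (carrier Q)" "Psi s \<in> Span (carrier Q)"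
    using Psi_in_Span rs' FQ_D(4) by blast+
  ultimately show thesis using that by blast
qed

end

section \<open>The order filtration\<close>

locale heisenberg_division = graded_division D G N F \<phi> \<xi> + HQ: heisenberg_pair "G Mod N" x y
  for D :: "'a ring" (structure) and G :: "'g monoid" and N F \<phi> \<xi> x y +
  assumes Ore: "ore_domain (crossed_product F_ring Q sig tau)"
begin

abbreviation lam where "lam \<equiv> HQ.lam"

declare HQ.lam.simps [simp del] mult_FactGroup [simp del] carrier_FactGroup [simp del] one_FactGroup [simp del]

text \<open>A decreasing filtration of \<open>RH\<close>, the subring \<open>F[H]\<close> of
  \<open>D\<close>.\<close>

definition RG :: "int \<Rightarrow> 'a set" where
  "RG e = Span (lam ` {T. hdeg T \<ge> e})"

definition RH :: "'a set" where
  "RH = Span (range lam)"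

lemma RG_RH: "a \<in> RG e \<Longrightarrow> a \<in> RH"
  by (auto simp: RG_def RH_def intro: Span_mono)

lemma RH_carrier [simp]: "a \<in> RH \<Longrightarrow> a \<in> carrier D"
  by (simp add: RH_def)

lemma RG_carrier [simp]: "a \<in> RG e \<Longrightarrow> a \<in> carrier D"
  by (simp add: RG_def)

lemma RG_antimono: "\<lbrakk>a \<in> RG e; f \<le> e\<rbrakk> \<Longrightarrow> a \<in> RG f"
  unfolding RG_def by (rule Span_mono) auto

lemma Span_mult_lam:
  assumes "a \<in> Span (lam ` A)" "b \<in> Span (lam ` B)" "\<And>S T. \<lbrakk>S \<in> A; T \<in> B\<rbrakk> \<Longrightarrow> hmult S T \<in> C"
  shows "a \<otimes> b \<in> Span (lam ` C)"
  by (rule Span_mult[OF assms(1,2)]) (use assms(3) in \<open>auto simp flip: HQ.lam_hmult\<close>)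

lemma RG_mult: "\<lbrakk>a \<in> RG e; b \<in> RG f\<rbrakk> \<Longrightarrow> a \<otimes> b \<in> RG (e + f)"
  unfolding RG_def by (rule Span_mult_lam) auto

lemma RG_add: "\<lbrakk>a \<in> RG e; b \<in> RG e\<rbrakk> \<Longrightarrow> a \<oplus> b \<in> RG e"
  by (simp add: RG_def Span_add)

lemma RG_uminus: "a \<in> RG e \<Longrightarrow> \<ominus> a \<in> RG e"
  by (simp add: RG_def Span_uminus)

lemma phi_RG:
  assumes "g \<in> lam T" "e \<le> hdeg T"
  shows "\<phi> g \<in> RG e"
  using mem_coset[OF HQ.lam_closed assms(1)] assms(2) unfolding RG_def by (intro Span_phi) auto

lemma zero_RG [simp]: "\<zero> \<in> RG e"
  by (simp add: RG_def)

lemma lam_disjoint: "A \<inter> B = {} \<Longrightarrow> lam ` A \<inter> lam ` B = {}"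
  using HQ.inj_lam by (metis image_Int image_empty)

text \<open>A finite support bounds the degrees on both sides. Hence \<open>p\<close> lies in some
  \<open>RG l\<close> but not in \<open>RG u\<close>, and it must drop out of the filtration at some
  step between.\<close>

lemma RH_order:
  assumes "p \<in> RH" "p \<noteq> \<zero>"
  obtains e where "p \<in> RG e" "p \<notin> RG (e + 1)"
proof -
  obtain A where A: "finite A" "A \<subseteq> range lam" "p \<in> Span A"
    using assms(1) Span_finite_support unfolding RH_def by blast
  then obtain B where B: "finite B" "A = lam ` B"
    by (metis finite_subset_image)
  obtain l where l: "\<And>T. T \<in> B \<Longrightarrow> l \<le> hdeg T"
    using B(1) by (metis finite_imageI Min_le imageI)
  obtain u where u: "\<And>T. T \<in> B \<Longrightarrow> hdeg T < u"
  proof -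
    assume *: "\<And>u. (\<And>T. T \<in> B \<Longrightarrow> hdeg T < u) \<Longrightarrow> thesis"
    have "hdeg T < Max (hdeg ` B) + 1" if "T \<in> B" for T
      using B(1) that Max_ge[of "hdeg ` B" "hdeg T"] by simp
    then show thesis using * by blast
  qed
  have l': "p \<in> RG l" unfolding RG_def
    by (rule Span_mono[OF A(3)]) (use B l in auto)
  have u': "p \<notin> RG u"
  proof
    assume "p \<in> RG u"
    moreover have "lam ` {T. hdeg T \<ge> u} \<inter> lam ` B = {}"
      using u by (intro lam_disjoint) fastforce
    ultimately show False using Span_disjoint A(3) B assms(2) unfolding RG_def by blast
  qed
  note result = that
  show thesis
  proof (rule ccontr)
    assume "\<not> thesis"
    then have step: "p \<in> RG (e + 1)" if "p \<in> RG e" for e using that result by blast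
    have "p \<in> RG (l + int n)" for n
    proof (induction n)
      case (Suc n)
      then show ?case using step[of "l + int n"] by (simp add: add.assoc add.commute[of 1])
    qed (use l' in simp)
    moreover have "u \<le> l + int (nat (u - l))" by simp
    ultimately show False using u' RG_antimono by blast
  qed
qed

lemma RG_split:
  assumes "p \<in> RG e"
  obtains p0 p1 where "p0 \<in> Span (lam ` {T. hdeg T = e})" "p1 \<in> RG (e + 1)" "p = p0 \<oplus> p1"
proof -
  have "lam ` {T. hdeg T \<ge> e} = lam ` {T. hdeg T = e} \<union> lam ` {T. hdeg T \<ge> e + 1}"
    by (auto simp flip: image_Un intro!: imageI)
  then have "p \<in> Span (lam ` {T. hdeg T = e} \<union> lam ` {T. hdeg T \<ge> e + 1})"
    using assms by (simp add: RG_def)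
  then show thesis using that unfolding RG_def by (rule Span_UnE)
qed

text \<open>The lowest homogeneous parts are nonzero and \<open>D\<close> has no zero divisors, so
  their product is nonzero and sits exactly in degree \<open>e + f\<close>. Together with
  \<open>RG_mult\<close> this says that orders add.\<close>

lemma order_mult:
  assumes "p \<in> RG e" "p \<notin> RG (e + 1)" "q \<in> RG f" "q \<notin> RG (f + 1)"
  shows "p \<otimes> q \<notin> RG (e + f + 1)"
proof
  assume pq: "p \<otimes> q \<in> RG (e + f + 1)"
  obtain p0 p1 where p: "p0 \<in> Span (lam ` {T. hdeg T = e})" "p1 \<in> RG (e + 1)" "p = p0 \<oplus> p1"
    using RG_split[OF assms(1)] .
  obtain q0 q1 where q: "q0 \<in> Span (lam ` {T. hdeg T = f})" "q1 \<in> RG (f + 1)" "q = q0 \<oplus> q1"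
    using RG_split[OF assms(3)] .
  have c: "p0 \<in> carrier D" "p1 \<in> carrier D" "q0 \<in> carrier D" "q1 \<in> carrier D"
    using p q by auto
  have p0: "p0 \<noteq> \<zero>" and q0: "q0 \<noteq> \<zero>" using p q c assms by auto
  have p0R: "p0 \<in> RG e" unfolding RG_def by (rule Span_mono[OF p(1)]) auto
  have "p0 \<otimes> q1 \<oplus> p1 \<otimes> q \<in> RG (e + f + 1)"
    using RG_mult[OF p0R q(2)] RG_mult[OF p(2) assms(3)] RG_add by (simp add: algebra_simps)
  then have "p \<otimes> q \<oplus> \<ominus> (p0 \<otimes> q1 \<oplus> p1 \<otimes> q) \<in> RG (e + f + 1)"
    using pq RG_add RG_uminus by blast
  also have "p \<otimes> q \<oplus> \<ominus> (p0 \<otimes> q1 \<oplus> p1 \<otimes> q) = p0 \<otimes> q0"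
  proof -
    have "p \<otimes> q = p0 \<otimes> q0 \<oplus> (p0 \<otimes> q1 \<oplus> p1 \<otimes> q)"
      using c by (simp add: p(3) q(3) l_distr r_distr a_ac)
    then show ?thesis using c q by (simp add: a_assoc r_neg)
  qed
  finally have "p0 \<otimes> q0 \<in> RG (e + f + 1)" .
  moreover have "p0 \<otimes> q0 \<in> Span (lam ` {T. hdeg T = e + f})"
    by (rule Span_mult_lam[OF p(1) q(1)]) simp
  moreover have "lam ` {T. hdeg T = e + f} \<inter> lam ` {T. hdeg T \<ge> e + f + 1} = {}"
    by (rule lam_disjoint) auto
  ultimately have "p0 \<otimes> q0 = \<zero>" using Span_disjoint unfolding RG_def by blast
  then show False using no_zero_divisors c p0 q0 by blast
qed

text \<open>Right multiplication by \<open>RH\<close> respects the decomposition of the quotient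
  into left cosets of \<open>H\<close>. An Ore relation over the whole quotient can therefore be
  restricted to one coset meeting the support of the multiplier, and a left translation moves that
  coset to \<open>H\<close>.\<close>

lemma RH_left_Ore:
  assumes "a \<in> RH" "a \<noteq> \<zero>" "b \<in> RH" "b \<noteq> \<zero>"
  obtains r s where "r \<in> RH" "s \<in> RH" "r \<otimes> a = s \<otimes> b" "r \<otimes> a \<noteq> \<zero>"
proof -
  have RQ: "a \<in> Span (carrier Q)" "b \<in> Span (carrier Q)"
    using assms Span_mono[of _ "range lam" "carrier Q"] HQ.lam_closed unfolding RH_def by blast+
  obtain r s where rs: "r \<in> Span (carrier Q)" "s \<in> Span (carrier Q)" "r \<otimes> a = s \<otimes> b" "r \<otimes> a \<noteq> \<zero>"
    using Span_left_Ore[OF Ore RQ(1) assms(2) RQ(2) assms(4)] .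
  have "r \<noteq> \<zero>" using rs(4) assms(1) by auto
  then obtain \<alpha> where \<alpha>: "\<alpha> \<in> carrier Q" "r \<notin> Span (carrier Q - {\<alpha>})"
    using Span_nonzeroE[OF rs(1)] by blast
  define S where "S = (\<lambda>T. \<alpha> \<otimes>\<^bsub>Q\<^esub> lam T) ` UNIV"
  have S: "S \<subseteq> carrier Q" using \<alpha> by (auto simp: S_def)
  have Sl: "\<beta> \<otimes>\<^bsub>Q\<^esub> lam T \<in> S" if "\<beta> \<in> S" for \<beta> T
    using that \<alpha> by (auto simp: S_def HQ.m_assoc simp flip: HQ.lam_hmult)
  have Sl': "\<beta> \<otimes>\<^bsub>Q\<^esub> lam T \<in> carrier Q - S" if "\<beta> \<in> carrier Q - S" for \<beta> T
  proof -
    have "\<beta> \<otimes>\<^bsub>Q\<^esub> lam T \<otimes>\<^bsub>Q\<^esub> lam (hinv T) = \<beta>"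
      using that by (simp add: HQ.m_assoc flip: HQ.lam_hmult)
    then show ?thesis using that Sl by (metis DiffD1 DiffD2 DiffI HQ.lam_closed HQ.m_closed)
  qed
  have split: "\<exists>t0\<in>Span S. \<exists>t1\<in>Span (carrier Q - S). t = t0 \<oplus> t1" if "t \<in> Span (carrier Q)" for t
    using that S Span_UnE[of t S "carrier Q - S"] by (metis Un_Diff_cancel Un_absorb1)
  obtain r0 r1 where r: "r0 \<in> Span S" "r1 \<in> Span (carrier Q - S)" "r = r0 \<oplus> r1"
    using split[OF rs(1)] by blast
  obtain s0 s1 where s: "s0 \<in> Span S" "s1 \<in> Span (carrier Q - S)" "s = s0 \<oplus> s1"
    using split[OF rs(2)] by blast
  have mS: "t \<otimes> c \<in> Span S" if "t \<in> Span S" "c \<in> RH" for t c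
    by (rule Span_mult[OF that(1) that(2)[unfolded RH_def]]) (use Sl in auto)
  have mS': "t \<otimes> c \<in> Span (carrier Q - S)" if "t \<in> Span (carrier Q - S)" "c \<in> RH" for t c
    by (rule Span_mult[OF that(1) that(2)[unfolded RH_def]]) (use Sl' in auto)
  have c: "r0 \<in> carrier D" "r1 \<in> carrier D" "s0 \<in> carrier D" "s1 \<in> carrier D"
    "a \<in> carrier D" "b \<in> carrier D"
    using r s assms by auto
  have eq01: "(r0 \<otimes> a \<ominus> s0 \<otimes> b) = s1 \<otimes> b \<ominus> r1 \<otimes> a"
  proof -
    have "r0 \<otimes> a \<oplus> r1 \<otimes> a = s0 \<otimes> b \<oplus> s1 \<otimes> b"
      using rs(3) c by (simp add: r(3) s(3) l_distr)
    then have "r0 \<otimes> a = s0 \<otimes> b \<oplus> s1 \<otimes> b \<ominus> r1 \<otimes> a"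
      using c by (metis a_minus_def add.inv_solve_right add.m_closed m_closed)
    then have eq: "r0 \<otimes> a = (s1 \<otimes> b \<ominus> r1 \<otimes> a) \<oplus> s0 \<otimes> b"
      using c by (simp add: a_minus_def a_ac)
    define w where "w = s1 \<otimes> b \<ominus> r1 \<otimes> a"
    have "w \<in> carrier D" using c by (simp add: w_def)
    then show ?thesis
      using c unfolding eq w_def[symmetric] by (simp add: a_minus_def a_assoc r_neg)
  qed
  have "r0 \<otimes> a \<ominus> s0 \<otimes> b \<in> Span S"
    by (intro Span_minus mS r s assms)
  moreover have "r0 \<otimes> a \<ominus> s0 \<otimes> b \<in> Span (carrier Q - S)"
    unfolding eq01 by (intro Span_minus mS' r s assms)
  ultimately have "r0 \<otimes> a \<ominus> s0 \<otimes> b = \<zero>"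
    by (rule Span_disjoint) (rule Diff_disjoint)
  then have eq: "r0 \<otimes> a = s0 \<otimes> b"
    by (rule minus_eq_zeroD[rotated 2]) (use c in simp_all)
  \<comment> \<open>\<open>\<alpha>\<close> itself belongs to \<open>S\<close>; without a part in
    \<open>S\<close>, the multiplier \<open>r\<close> would avoid \<open>\<alpha>\<close>.\<close>
  have "r0 \<noteq> \<zero>"
  proof
    assume "r0 = \<zero>"
    then have "r \<in> Span (carrier Q - S)" using r c by simp
    moreover have "carrier Q - S \<subseteq> carrier Q - {\<alpha>}"
    proof -
      have "\<alpha> = \<alpha> \<otimes>\<^bsub>Q\<^esub> lam (0, 0, 0)" using \<alpha> HQ.lam_one by simp
      then show ?thesis unfolding S_def by blast
    qed
    ultimately show False using \<alpha>(2) Span_mono by blast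
  qed
  moreover have "a \<noteq> \<zero>" by (rule assms)
  ultimately have nz: "r0 \<otimes> a \<noteq> \<zero>" using no_zero_divisors c by blast
  \<comment> \<open>Multiplying from the left by \<open>\<phi> g\<close> carries the coset of
    \<open>\<alpha>\<close> to \<open>H\<close> and brings both multipliers into
    \<open>RH\<close>.\<close>
  define g where "g = inv\<^bsub>G\<^esub> \<xi> \<alpha>"
  have g: "g \<in> carrier G" using \<alpha> by (simp add: g_def)
  have "(N #>\<^bsub>G\<^esub> g) \<otimes>\<^bsub>Q\<^esub> \<alpha> = N #>\<^bsub>G\<^esub> (g \<otimes>\<^bsub>G\<^esub> \<xi> \<alpha>)"
    using coset_mult[OF g, of "\<xi> \<alpha>"] \<alpha> by simp
  also have "\<dots> = \<one>\<^bsub>Q\<^esub>" using \<alpha> by (simp add: g_def one_FactGroup G.coset_mult_one G.subset)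
  finally have g\<alpha>: "(N #>\<^bsub>G\<^esub> g) \<otimes>\<^bsub>Q\<^esub> \<alpha> = \<one>\<^bsub>Q\<^esub>" .
  have phig: "\<phi> g \<in> Span {N #>\<^bsub>G\<^esub> g}" using g by (simp add: Span_phi)
  have gS: "\<phi> g \<otimes> t \<in> RH" if "t \<in> Span S" for t
    unfolding RH_def
  proof (rule Span_mult[OF phig that])
    fix \<gamma> \<beta> assume "\<gamma> \<in> {N #>\<^bsub>G\<^esub> g}" "\<beta> \<in> S"
    then show "\<gamma> \<otimes>\<^bsub>Q\<^esub> \<beta> \<in> range lam"
      using g\<alpha> g \<alpha> by (auto simp: S_def simp flip: HQ.m_assoc)
  qed
  have "(\<phi> g \<otimes> r0) \<otimes> a = (\<phi> g \<otimes> s0) \<otimes> b"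
    using eq c g by (simp add: m_assoc)
  moreover have "(\<phi> g \<otimes> r0) \<otimes> a \<noteq> \<zero>"
    using no_zero_divisors[of "\<phi> g" "r0 \<otimes> a"] nz phi_nonzero[OF g] c g by (auto simp: m_assoc)
  ultimately show thesis using that[OF gS[OF r(1)] gS[OF s(1)]] by simp
qed

text \<open>The elements \<open>d\<close> that can be written as a left fraction with denominator
  \<open>p\<close> of exact order \<open>e\<close> and numerator of order at least
  \<open>e + n\<close>; intuitively \<open>d\<close> has order at least \<open>n\<close>. The
  condition asks for one such denominator only.\<close>

definition TF :: "int \<Rightarrow> 'a set" where
  "TF n = {d \<in> carrier D. \<exists>p q e. p \<in> RG e \<and> p \<notin> RG (e + 1) \<and> q \<in> RG (e + n) \<and> p \<otimes> d = q}"

lemma TF_carrier [simp]: "d \<in> TF n \<Longrightarrow> d \<in> carrier D"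
  by (simp add: TF_def)

lemma TF_I: "\<lbrakk>d \<in> carrier D; p \<in> RG e; p \<notin> RG (e + 1); p \<otimes> d \<in> RG (e + n)\<rbrakk> \<Longrightarrow> d \<in> TF n"
  unfolding TF_def by blast

lemma one_RG: "\<one> \<in> RG 0" "\<one> \<notin> RG 1"
proof -
  have "\<one>\<^bsub>G\<^esub> \<in> lam (0, 0, 0)"
    unfolding HQ.lam_one one_FactGroup by (rule subgroup.one_closed[OF G.is_subgroup])
  then show one: "\<one> \<in> RG 0" using phi_RG[of "\<one>\<^bsub>G\<^esub>" "(0, 0, 0)" 0] by simp
  have "\<one> \<noteq> \<zero>" using division by (simp add: division_ring_def)
  then obtain e where e: "\<one> \<in> RG e" "\<one> \<notin> RG (e + 1)"
    using RH_order[OF RG_RH[OF one]] by blast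
  have "\<one> \<notin> RG (e + e + 1)" using order_mult[OF e e] by simp
  \<comment> \<open>Since \<open>\<one>\<close> is its own square, its order satisfies
    \<open>e + e < e + 1\<close>, so it is at most 0.\<close>
  moreover have "\<one> \<in> RG (e + e)" using RG_mult[OF e(1) e(1)] by simp
  ultimately have "\<not> e + e \<ge> e + 1" using e RG_antimono by blast
  then show "\<one> \<notin> RG 1" using RG_antimono[of \<one> 1 "e + 1"] e by auto
qed

lemma RG_TF: "a \<in> RG n \<Longrightarrow> a \<in> TF n"
  using one_RG TF_I[of a \<one> 0 n] by simp

lemma order_nonzero: "p \<notin> RG e \<Longrightarrow> p \<noteq> \<zero>"
  by auto

text \<open>On \<open>RH\<close> the filtration of fractions is the original one, because
  \<open>order_mult\<close> recovers the order of \<open>d\<close> from that of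
  \<open>p \<otimes> d\<close>. This is how an estimate in \<open>D\<close> becomes a statement
  about supports.\<close>

lemma TF_RG:
  assumes "d \<in> TF n" "d \<in> RH"
  shows "d \<in> RG n"
proof (cases "d = \<zero>")
  case False
  then obtain f where f: "d \<in> RG f" "d \<notin> RG (f + 1)" using RH_order assms by blast
  obtain p e where p: "p \<in> RG e" "p \<notin> RG (e + 1)" "p \<otimes> d \<in> RG (e + n)"
    using assms(1) unfolding TF_def by blast
  have "p \<otimes> d \<notin> RG (e + f + 1)" using order_mult p f by blast
  then have "\<not> e + f + 1 \<le> e + n" using p(3) RG_antimono by blast
  then show ?thesis using f RG_antimono[of d f n] by simp
qed simp

text \<open>The Ore condition yields a common left multiple of the two denominators. Its order is
  \<open>i + e\<close> by one factorization and \<open>j + f\<close> by the other, so these agree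
  and both estimates survive.\<close>

lemma TF_common_denominator:
  assumes "d \<in> TF n" "d' \<in> TF m"
  obtains p e where "p \<in> RG e" "p \<notin> RG (e + 1)" "p \<otimes> d \<in> RG (e + n)" "p \<otimes> d' \<in> RG (e + m)"
proof -
  obtain p e where p: "p \<in> RG e" "p \<notin> RG (e + 1)" "p \<otimes> d \<in> RG (e + n)"
    using assms(1) unfolding TF_def by blast
  obtain q f where q: "q \<in> RG f" "q \<notin> RG (f + 1)" "q \<otimes> d' \<in> RG (f + m)"
    using assms(2) unfolding TF_def by blast
  obtain r s where rs: "r \<in> RH" "s \<in> RH" "r \<otimes> p = s \<otimes> q" "r \<otimes> p \<noteq> \<zero>"
    using RH_left_Ore[of p q] p q RG_RH by (metis order_nonzero)
  have c: "r \<in> carrier D" "s \<in> carrier D" "p \<in> carrier D" "q \<in> carrier D" "d \<in> carrier D" "d' \<in> carrier D"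
    using rs p q assms by auto
  have "r \<noteq> \<zero>" "s \<noteq> \<zero>" using rs c by auto
  then obtain i j where i: "r \<in> RG i" "r \<notin> RG (i + 1)" and j: "s \<in> RG j" "s \<notin> RG (j + 1)"
    using RH_order rs by metis
  have rp: "r \<otimes> p \<in> RG (i + e)" "r \<otimes> p \<notin> RG (i + e + 1)"
    and sq: "r \<otimes> p \<in> RG (j + f)" "r \<otimes> p \<notin> RG (j + f + 1)"
    using RG_mult[OF i(1) p(1)] order_mult[OF i p(1,2)] RG_mult[OF j(1) q(1)] order_mult[OF j q(1,2)] rs(3)
    by auto
  have "i + e = j + f"
    using RG_antimono[OF rp(1), of "j + f + 1"] RG_antimono[OF sq(1), of "i + e + 1"] rp sq by linarith
  moreover have "(r \<otimes> p) \<otimes> d \<in> RG (i + e + n)"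
    using RG_mult[OF i(1) p(3)] c by (simp add: m_assoc add.assoc)
  moreover have "(r \<otimes> p) \<otimes> d' \<in> RG (j + f + m)"
    using RG_mult[OF j(1) q(3)] c by (simp add: rs(3) m_assoc add.assoc)
  ultimately show thesis using that[OF rp] by simp
qed

lemma TF_add:
  assumes "d \<in> TF n" "d' \<in> TF n"
  shows "d \<oplus> d' \<in> TF n"
proof -
  obtain p e where p: "p \<in> RG e" "p \<notin> RG (e + 1)" "p \<otimes> d \<in> RG (e + n)" "p \<otimes> d' \<in> RG (e + n)"
    using TF_common_denominator[OF assms] .
  then have "p \<otimes> (d \<oplus> d') \<in> RG (e + n)"
    using assms RG_add by (simp add: r_distr)
  then show ?thesis using p assms by (intro TF_I) auto
qed

lemma TF_uminus: "d \<in> TF n \<Longrightarrow> \<ominus> d \<in> TF n"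
proof -
  assume d: "d \<in> TF n"
  then obtain p e where p: "p \<in> RG e" "p \<notin> RG (e + 1)" "p \<otimes> d \<in> RG (e + n)"
    unfolding TF_def by blast
  then have "p \<otimes> (\<ominus> d) \<in> RG (e + n)" using d RG_uminus by (simp add: r_minus)
  then show ?thesis using p d by (intro TF_I) auto
qed

lemma TF_antimono: "\<lbrakk>d \<in> TF n; m \<le> n\<rbrakk> \<Longrightarrow> d \<in> TF m"
proof -
  assume d: "d \<in> TF n" "m \<le> n"
  then obtain p e where p: "p \<in> RG e" "p \<notin> RG (e + 1)" "p \<otimes> d \<in> RG (e + n)"
    unfolding TF_def by blast
  then have "p \<otimes> d \<in> RG (e + m)" using d RG_antimono[of _ "e + n" "e + m"] by simp
  then show ?thesis using p d by (intro TF_I) auto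
qed

lemma zero_TF [simp]: "\<zero> \<in> TF n"
  by (simp add: RG_TF)

text \<open>An Ore relation \<open>r (p d) = s q\<close> carries \<open>d\<close> past the
  denominator \<open>q\<close> of the second fraction: \<open>(r p) (d d') = s (q d')\<close>. It
  needs nonzero elements, hence the separate case \<open>d = \<zero>\<close>.\<close>

lemma TF_mult:
  assumes "d \<in> TF n" "d' \<in> TF m"
  shows "d \<otimes> d' \<in> TF (n + m)"
proof -
  obtain p e where p: "p \<in> RG e" "p \<notin> RG (e + 1)" "p \<otimes> d \<in> RG (e + n)"
    using assms(1) unfolding TF_def by blast
  obtain q f where q: "q \<in> RG f" "q \<notin> RG (f + 1)" "q \<otimes> d' \<in> RG (f + m)"
    using assms(2) unfolding TF_def by blast
  have c: "p \<in> carrier D" "q \<in> carrier D" "d \<in> carrier D" "d' \<in> carrier D"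
    using p q assms by auto
  show ?thesis
  proof (cases "d = \<zero>")
    case False
    have pd: "p \<otimes> d \<noteq> \<zero>" using no_zero_divisors c False p(2) by (metis order_nonzero)
    obtain r s where rs: "r \<in> RH" "s \<in> RH" "r \<otimes> (p \<otimes> d) = s \<otimes> q" "r \<otimes> (p \<otimes> d) \<noteq> \<zero>"
      using RH_left_Ore[of "p \<otimes> d" q] p q pd RG_RH by (metis order_nonzero)
    have rc: "r \<in> carrier D" "s \<in> carrier D" using rs by auto
    have "r \<noteq> \<zero>" "s \<noteq> \<zero>" using rs c by auto
    then obtain i j where i: "r \<in> RG i" "r \<notin> RG (i + 1)" and j: "s \<in> RG j" "s \<notin> RG (j + 1)"
      using RH_order rs by metis
    have "s \<otimes> q \<in> RG (i + (e + n))" using RG_mult[OF i(1) p(3)] rs(3) by simp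
    moreover have "s \<otimes> q \<notin> RG (j + f + 1)" using order_mult[OF j q(1,2)] .
    ultimately have le: "i + (e + n) \<le> j + f" using RG_antimono by (meson not_le zless_imp_add1_zle)
    have "(r \<otimes> p) \<otimes> (d \<otimes> d') = s \<otimes> (q \<otimes> d')"
      using c rc rs(3) by (metis m_assoc m_closed)
    also have "\<dots> \<in> RG (j + (f + m))" using RG_mult[OF j(1) q(3)] .
    finally have "(r \<otimes> p) \<otimes> (d \<otimes> d') \<in> RG (i + e + (n + m))"
      using le RG_antimono by (simp add: algebra_simps)
    moreover have "r \<otimes> p \<in> RG (i + e)" "r \<otimes> p \<notin> RG (i + e + 1)"
      using RG_mult[OF i(1) p(1)] order_mult[OF i p(1,2)] by auto
    ultimately show ?thesis using c by (intro TF_I) auto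
  qed (use c in simp)
qed

text \<open>As \<open>\<phi> g\<close> has positive order, \<open>\<one> \<oplus> \<phi> g\<close>
  has order exactly 0, and it can serve as the denominator of its own inverse with numerator
  \<open>\<one>\<close>.\<close>

lemma inverse_TF:
  assumes "g \<in> lam T" "hdeg T \<ge> 1"
  shows "\<one> \<oplus> \<phi> g \<in> Units D" "inv (\<one> \<oplus> \<phi> g) \<in> TF 0"
proof -
  have gc: "g \<in> carrier G" using mem_coset[OF HQ.lam_closed assms(1)] by simp
  have g: "\<phi> g \<in> RG 1" using phi_RG assms by simp
  have p: "\<one> \<oplus> \<phi> g \<in> RG 0" using g one_RG RG_add RG_antimono by simp
  have p': "\<one> \<oplus> \<phi> g \<notin> RG 1"
  proof
    assume "\<one> \<oplus> \<phi> g \<in> RG 1"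
    then have "(\<one> \<oplus> \<phi> g) \<oplus> \<ominus> \<phi> g \<in> RG 1" using g RG_add RG_uminus by blast
    also have "(\<one> \<oplus> \<phi> g) \<oplus> \<ominus> \<phi> g = \<one>" using gc by (simp add: a_assoc r_neg)
    finally show False using one_RG by simp
  qed
  then have nz: "\<one> \<oplus> \<phi> g \<noteq> \<zero>" by auto
  then show "\<one> \<oplus> \<phi> g \<in> Units D" using division_inv gc by simp
  show "inv (\<one> \<oplus> \<phi> g) \<in> TF 0"
    using p p' one_RG division_inv[of "\<one> \<oplus> \<phi> g"] nz gc by (intro TF_I[of _ "\<one> \<oplus> \<phi> g" 0]) auto
qed

end

section \<open>Matrices over Laurent series\<close>

datatype 'a mat2 = Mat2 'a 'a 'a 'a

instantiation mat2 :: (comm_ring_1) ring_1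
begin

definition "0 = Mat2 0 0 0 0"
definition "1 = Mat2 1 0 0 1"

fun plus_mat2 :: "'a mat2 \<Rightarrow> 'a mat2 \<Rightarrow> 'a mat2" where
  "Mat2 a b c d + Mat2 a' b' c' d' = Mat2 (a + a') (b + b') (c + c') (d + d')"

fun minus_mat2 :: "'a mat2 \<Rightarrow> 'a mat2 \<Rightarrow> 'a mat2" where
  "Mat2 a b c d - Mat2 a' b' c' d' = Mat2 (a - a') (b - b') (c - c') (d - d')"

fun uminus_mat2 :: "'a mat2 \<Rightarrow> 'a mat2" where
  "- Mat2 a b c d = Mat2 (- a) (- b) (- c) (- d)"

fun times_mat2 :: "'a mat2 \<Rightarrow> 'a mat2 \<Rightarrow> 'a mat2" where
  "Mat2 a b c d * Mat2 a' b' c' d' =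
    Mat2 (a * a' + b * c') (a * b' + b * d') (c * a' + d * c') (c * b' + d * d')"

instance
proof
  fix A B C :: "'a mat2"
  show "A * B * C = A * (B * C)" "(A + B) * C = A * C + B * C" "A * (B + C) = A * B + A * C"
    "A + B + C = A + (B + C)"
    by (cases A; cases B; cases C; simp add: algebra_simps)+
  show "A + B = B + A" "A - B = A + - B"
    by (cases A; cases B; simp)+
  show "- A + A = 0" "1 * A = A" "A * 1 = A" "0 + A = A"
    by (cases A; simp add: zero_mat2_def one_mat2_def)+
  show "(0 :: 'a mat2) \<noteq> 1" by (simp add: zero_mat2_def one_mat2_def)
qed

end

fun smul :: "'a :: comm_ring_1 \<Rightarrow> 'a mat2 \<Rightarrow> 'a mat2" where
  "smul r (Mat2 a b c d) = Mat2 (r * a) (r * b) (r * c) (r * d)"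

lemma smul_simps:
  "smul r (A + B) = smul r A + smul r B" "smul r (A - B) = smul r A - smul r B"
  "smul r (- A) = - smul r A" "smul r 0 = 0" "smul 1 A = A"
  "smul r A * B = smul r (A * B)" "A * smul r B = smul r (A * B)"
  "smul r (smul q A) = smul (r * q) A" "smul (r - q) A = smul r A - smul q A"
  by (cases A; cases B; simp add: zero_mat2_def algebra_simps)+

lemma pred_mat2_add:
  assumes "\<And>a b. \<lbrakk>P a; P b\<rbrakk> \<Longrightarrow> P (a + b)" "pred_mat2 P A" "pred_mat2 P B"
  shows "pred_mat2 P (A + B)"
  using assms by (cases A; cases B) simp

text \<open>The matrix \<open>(-1)^k \<sigma>^i \<tau>^j\<close> for the anticommuting involutions
  \<open>\<sigma> = diag(1, -1)\<close> and \<open>\<tau> = antidiag(1, 1)\<close>. Writing it by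
  parities admits negative exponents without inverses.\<close>

definition pauli :: "int \<Rightarrow> int \<Rightarrow> int \<Rightarrow> 'a :: comm_ring_1 mat2" where
  "pauli i j k = smul (if even k then 1 else - 1)
    ((if even i then 1 else Mat2 1 0 0 (- 1)) * (if even j then 1 else Mat2 0 1 1 0))"

text \<open>Moving \<open>\<tau>^j\<close> past \<open>\<sigma>^i'\<close> costs the sign
  \<open>(-1)^(j i')\<close>, which is the correction term of \<open>hmult\<close> at
  \<open>z = -1\<close>.\<close>

lemma pauli_mult: "pauli i j k * pauli i' j' k' = pauli (i + i') (j + j') (k + k' - j * i')"
  unfolding pauli_def one_mat2_def
  by (cases "even i"; cases "even j"; cases "even k"; cases "even i'"; cases "even j'"; cases "even k'") simp_all

text \<open>The power of \<open>t\<close> records the degree, so that the filtration of the group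
  ring becomes the \<open>t\<close>-adic order of matrices.\<close>

fun rho :: "int \<times> int \<times> int \<Rightarrow> int fls mat2" where
  "rho (i, j, k) = smul (fls_X_intpow (i + j)) (pauli i j k)"

lemma rho_hmult: "rho (hmult S T) = rho S * rho T"
proof -
  obtain i j k i' j' k' where ST: "S = (i, j, k)" "T = (i', j', k')"
    by (cases S; cases T) auto
  have "(fls_X_intpow (i + i' + (j + j')) :: int fls) = fls_X_intpow (i + j) * fls_X_intpow (i' + j')"
    unfolding fls_X_intpow_times_fls_X_intpow by (simp add: algebra_simps)
  then show ?thesis
    unfolding ST hmult.simps rho.simps by (simp add: smul_simps pauli_mult mult.commute)
qed

lemma rho_zero [simp]: "rho (0, 0, 0) = 1"
  by (simp add: pauli_def one_mat2_def)

section \<open>The \<open>t\<close>-adic order of Laurent series and matrices\<close>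

definition vge :: "int \<Rightarrow> int fls \<Rightarrow> bool" where
  "vge n f \<longleftrightarrow> (\<forall>k < n. fls_nth f k = 0)"

lemma vge_simps [simp]: "vge n 0" "\<lbrakk>vge n f; vge n g\<rbrakk> \<Longrightarrow> vge n (f + g)" "vge n f \<Longrightarrow> vge n (- f)"
  "\<lbrakk>vge n f; vge n g\<rbrakk> \<Longrightarrow> vge n (f - g)"
  by (auto simp: vge_def)

lemma vge_mono: "\<lbrakk>vge n f; m \<le> n\<rbrakk> \<Longrightarrow> vge m f"
  by (auto simp: vge_def)

lemma vge_mult:
  assumes "vge n f" "vge m g"
  shows "vge (n + m) (f * g)"
proof (cases "f * g = 0")
  case False
  then have "n \<le> fls_subdegree f" "m \<le> fls_subdegree g"
    using assms by (auto simp: vge_def intro!: fls_subdegree_geI)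
  then have "n + m \<le> fls_subdegree (f * g)"
    using fls_mult_subdegree_ge[OF False] by linarith
  then show ?thesis by (auto simp: vge_def)
qed (auto simp: vge_def)

abbreviation vmat :: "int \<Rightarrow> int fls mat2 \<Rightarrow> bool" where
  "vmat n \<equiv> pred_mat2 (vge n)"

lemma vmat_simps [simp]: "vmat n 0" "\<lbrakk>vmat n A; vmat n B\<rbrakk> \<Longrightarrow> vmat n (A + B)" "vmat n A \<Longrightarrow> vmat n (- A)"
  "\<lbrakk>vmat n A; vmat n B\<rbrakk> \<Longrightarrow> vmat n (A - B)"
  by (cases A; cases B; simp add: zero_mat2_def)+

lemma vmat_mono: "\<lbrakk>vmat n A; m \<le> n\<rbrakk> \<Longrightarrow> vmat m A"
  by (cases A) (auto intro: vge_mono)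

lemma vmat_mult: "\<lbrakk>vmat n A; vmat m B\<rbrakk> \<Longrightarrow> vmat (n + m) (A * B)"
  by (cases A; cases B) (simp add: vge_mult)

lemma vmat_smul: "\<lbrakk>vge n f; vmat m B\<rbrakk> \<Longrightarrow> vmat (n + m) (smul f B)"
  by (cases B) (simp add: vge_mult)

lemma pauli_rho_nth:
  assumes "hdeg T \<noteq> d"
  shows "pred_mat2 (\<lambda>f. fls_nth f d = 0) (rho T)"
proof -
  obtain i j k where T: "T = (i, j, k)" by (cases T)
  show ?thesis
    using assms by (auto simp: T pauli_def one_mat2_def)
qed

lemma vmat_rho: "n \<le> hdeg T \<Longrightarrow> vmat n (rho T)"
  using pauli_rho_nth[of T] by (cases "rho T") (auto simp: vge_def)

section \<open>Polynomial matrices, which can be evaluated at \<open>t = -1\<close>\<close>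

definition pf :: "int poly \<Rightarrow> int fls" where
  "pf p = fps_to_fls (fps_of_poly p)"

lemma pf_simps [simp]: "pf 0 = 0" "pf 1 = 1" "pf (p + q) = pf p + pf q" "pf (p - q) = pf p - pf q"
  "pf (- p) = - pf p" "pf (p * q) = pf p * pf q"
  by (simp_all add: pf_def fps_of_poly_add fps_of_poly_diff fps_of_poly_uminus fps_of_poly_mult fls_times_fps_to_fls)

lemma pf_nth: "fls_nth (pf p) (int k) = coeff p k"
  by (simp add: pf_def)

lemma vge_pf [simp]: "vge 0 (pf p)"
  by (simp add: pf_def vge_def)

lemma pf_pCons: "pf (pCons a p) = fls_const a + fls_X * pf p"
  by (simp add: pf_def fps_of_poly_pCons fls_times_fps_to_fls algebra_simps)

abbreviation pm :: "int poly mat2 \<Rightarrow> int fls mat2" where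
  "pm \<equiv> map_mat2 pf"

lemma pm_simps [simp]: "pm 0 = 0" "pm 1 = 1" "pm (A + B) = pm A + pm B" "pm (A - B) = pm A - pm B"
  "pm (- A) = - pm A" "pm (A * B) = pm A * pm B" "pm (smul p A) = smul (pf p) (pm A)"
  by (cases A; cases B; simp add: zero_mat2_def one_mat2_def)+

lemma vmat_pm [simp]: "vmat 0 (pm A)"
  by (cases A) simp

abbreviation evm :: "int poly mat2 \<Rightarrow> int mat2" where
  "evm \<equiv> map_mat2 (\<lambda>p. poly p (- 1))"

lemma evm_simps [simp]: "evm 0 = 0" "evm 1 = 1" "evm (A + B) = evm A + evm B" "evm (A - B) = evm A - evm B"
  "evm (- A) = - evm A" "evm (A * B) = evm A * evm B" "evm (smul p A) = smul (poly p (- 1)) (evm A)"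
  by (cases A; cases B; simp add: zero_mat2_def one_mat2_def)+

section \<open>The matrix image of the integral group ring\<close>

declare rho.simps [simp del]

text \<open>Group elements are independent over the prime ring of \<open>D\<close>. An integer
  coefficient is determined only modulo the characteristic, hence a conclusion about
  \<open>[c g] \<cdot> \<one>\<close> and not about \<open>c g\<close>.\<close>

locale free_pair_setup = heisenberg_division D G N F \<phi> \<xi> x y
  for D :: "'a ring" (structure) and G :: "'g monoid" and N F \<phi> \<xi> x y +
  assumes int_independent: "\<lbrakk>finite A; A \<subseteq> carrier G; (\<Oplus>g\<in>A. [(c g :: int)] \<cdot> \<phi> g) = \<zero>; g \<in> A\<rbrakk>
      \<Longrightarrow> [c g] \<cdot> \<one> = \<zero>"
    and two_ne_zero: "\<one> \<oplus> \<one> \<noteq> \<zero>"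
begin

text \<open>The kernel of the map from the integers to \<open>D\<close>, that is, the multiples of
  the characteristic.\<close>

definition zD :: "int \<Rightarrow> bool" where
  "zD n \<longleftrightarrow> [n] \<cdot> \<one> = \<zero>"

lemma int_mult_one: "[(m * n :: int)] \<cdot> \<one> = ([m] \<cdot> \<one>) \<otimes> ([n] \<cdot> \<one>)"
proof -
  have "([m] \<cdot> \<one>) \<otimes> ([n] \<cdot> \<one>) = [m] \<cdot> ([n] \<cdot> \<one>)"
    by (simp add: add_pow_ldistr_int)
  also have "\<dots> = [(m * n)] \<cdot> \<one>"
    by (simp add: add.int_pow_pow mult.commute)
  finally show ?thesis ..
qed

lemma int_zero_mult [simp]: "a \<in> carrier D \<Longrightarrow> [(0 :: int)] \<cdot> a = \<zero>"
  by (simp add: add_pow_def)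

lemma zD_simps [simp]: "zD 0" "\<lbrakk>zD m; zD n\<rbrakk> \<Longrightarrow> zD (m + n)" "zD m \<Longrightarrow> zD (m * n)" "zD n \<Longrightarrow> zD (m * n)"
  "zD m \<Longrightarrow> zD (- m)"
  by (simp_all add: zD_def add.int_pow_mult int_mult_one add.int_pow_neg)

lemma zD_minus [simp]: "\<lbrakk>zD m; zD n\<rbrakk> \<Longrightarrow> zD (m - n)"
  using zD_simps(2)[of m "- n"] by simp

lemma zD_sum: "(\<And>i. i \<in> A \<Longrightarrow> zD (f i)) \<Longrightarrow> zD (\<Sum>i\<in>A. f i)"
  by (induction A rule: infinite_finite_induct) auto

lemma zD_prime: "zD (m * n) \<Longrightarrow> zD m \<or> zD n"
  by (simp add: zD_def int_mult_one no_zero_divisors)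

text \<open>The kernel \<open>zD\<close> is prime because \<open>D\<close> has no zero divisors, and
  it does not contain 2.\<close>

lemma zD_power_two: "\<not> zD (2 ^ n)"
proof -
  have "\<one> \<noteq> \<zero>" using division by (simp add: division_ring_def)
  then have 1: "\<not> zD 1" by (simp add: zD_def)
  have "[(2 :: int)] \<cdot> \<one> = \<one> \<oplus> \<one>"
    using add.int_pow_mult[of \<one> 1 1] by simp
  then have 2: "\<not> zD 2" using two_ne_zero by (simp add: zD_def)
  show ?thesis by (induction n) (use 1 2 zD_prime in auto)
qed

text \<open>\<open>shadow e a M\<close>: \<open>M\<close> is the image of \<open>a\<close>, an element of the integral group ring of the
  preimage of the Heisenberg group supported in degrees at least \<open>e\<close>.\<close>

inductive shadow :: "int \<Rightarrow> 'a \<Rightarrow> int fls mat2 \<Rightarrow> bool" for e where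
  shadow_zero: "shadow e \<zero> 0"
| shadow_phi: "\<lbrakk>g \<in> lam T; e \<le> hdeg T\<rbrakk> \<Longrightarrow> shadow e (\<phi> g) (rho T)"
| shadow_add: "\<lbrakk>shadow e a A; shadow e b B\<rbrakk> \<Longrightarrow> shadow e (a \<oplus> b) (A + B)"
| shadow_uminus: "shadow e a A \<Longrightarrow> shadow e (\<ominus> a) (- A)"

lemma shadow_RG: "shadow e a M \<Longrightarrow> a \<in> RG e"
  by (induction rule: shadow.induct) (auto simp: phi_RG RG_add RG_uminus)

lemma shadow_carrier: "shadow e a M \<Longrightarrow> a \<in> carrier D"
  by (rule RG_carrier[OF shadow_RG])

lemma shadow_vmat: "shadow e a M \<Longrightarrow> vmat e M"
  by (induction rule: shadow.induct) (auto simp: vmat_rho)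

lemma shadow_mono: "\<lbrakk>shadow e a M; f \<le> e\<rbrakk> \<Longrightarrow> shadow f a M"
  by (induction rule: shadow.induct) (auto intro: shadow.intros)

lemma shadow_one: "e \<le> 0 \<Longrightarrow> shadow e \<one> 1"
  using shadow_phi[of "\<one>\<^bsub>G\<^esub>" "(0, 0, 0)" e] subgroup.one_closed[OF G.is_subgroup]
  by (simp add: one_FactGroup)

lemma lam_phi_closed [simp]: "g \<in> lam T \<Longrightarrow> g \<in> carrier G"
  by (rule mem_coset[OF HQ.lam_closed])

lemma lam_mult: 
  assumes "g \<in> lam S" "h \<in> lam T"
  shows "g \<otimes>\<^bsub>G\<^esub> h \<in> lam (hmult S T)"
proof -
  have c: "g \<in> carrier G" "h \<in> carrier G" using assms by auto
  have "lam (hmult S T) = N #>\<^bsub>G\<^esub> (g \<otimes>\<^bsub>G\<^esub> h)"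
    using mem_coset(2)[OF HQ.lam_closed assms(1)] mem_coset(2)[OF HQ.lam_closed assms(2)] c
    by (simp add: HQ.lam_hmult flip: coset_mult)
  then show ?thesis using G.rcos_self[of "g \<otimes>\<^bsub>G\<^esub> h"] G.is_subgroup c by simp
qed

lemma shadow_mult:
  assumes "shadow e a A" "shadow f b B"
  shows "shadow (e + f) (a \<otimes> b) (A * B)"
  using assms(1)
proof (induction rule: shadow.induct)
  case shadow_zero
  then show ?case using shadow_carrier[OF assms(2)] shadow.shadow_zero by simp
next
  case (shadow_phi g S)
  show ?case
    using assms(2)
  proof (induction rule: shadow.induct)
    case shadow_zero
    then show ?case using shadow_phi shadow.shadow_zero by simp
  next
    case (shadow_phi h T)
    then show ?case
      using \<open>g \<in> lam S\<close> \<open>e \<le> hdeg S\<close> shadow.shadow_phi[OF lam_mult, of g S h T "e + f"]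
      by (simp add: phi_mult rho_hmult)
  next
    case (shadow_add b1 B1 b2 B2)
    then show ?case
      using \<open>g \<in> lam S\<close> shadow.shadow_add[OF shadow_add.IH]
      by (simp add: r_distr shadow_carrier distrib_left)
  next
    case (shadow_uminus b B)
    then show ?case
      using \<open>g \<in> lam S\<close> shadow.shadow_uminus[OF shadow_uminus.IH]
      by (simp add: r_minus shadow_carrier)
  qed
next
  case (shadow_add a1 A1 a2 A2)
  then show ?case
    using shadow.shadow_add[OF shadow_add.IH] shadow_carrier[OF assms(2)]
    by (simp add: l_distr shadow_carrier distrib_right)
next
  case (shadow_uminus a A)
  then show ?case
    using shadow.shadow_uminus[OF shadow_uminus.IH] shadow_carrier[OF assms(2)]
    by (simp add: l_minus shadow_carrier)
qed

definition crd :: "'g \<Rightarrow> int \<times> int \<times> int" where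
  "crd g = (SOME T. g \<in> lam T)"

lemma crd_eq:
  assumes "g \<in> lam T"
  shows "crd g = T"
proof -
  have "g \<in> lam (crd g)" unfolding crd_def using assms by (rule someI)
  then have "lam (crd g) = lam T"
    using assms mem_coset(2)[OF HQ.lam_closed] by metis
  then show ?thesis by (rule injD[OF HQ.inj_lam])
qed

text \<open>Coefficients are required to vanish off \<open>A\<close> so that two such forms can be
  rewritten over the union of their supports and added. One function \<open>c\<close> serves for
  both \<open>a\<close> and \<open>M\<close>, which ties the two together.\<close>

lemma shadow_normal_form:
  assumes "shadow e a M"
  shows "\<exists>A (c :: 'g \<Rightarrow> int). finite A \<and> (\<forall>g\<in>A. \<exists>T. g \<in> lam T) \<and> (\<forall>g. g \<notin> A \<longrightarrow> c g = 0) \<and>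
    a = (\<Oplus>g\<in>A. [c g] \<cdot> \<phi> g) \<and> M = (\<Sum>g\<in>A. of_int (c g) * rho (crd g))"
  using assms
proof (induction rule: shadow.induct)
  case shadow_zero
  show ?case by (intro exI[of _ "{}"] exI[of _ "\<lambda>_. 0"]) simp
next
  case (shadow_phi g T)
  show ?case
    by (intro exI[of _ "{g}"] exI[of _ "\<lambda>h. if h = g then 1 else 0"])
      (use shadow_phi crd_eq[OF shadow_phi(1)] in \<open>auto simp del: split_paired_Ex\<close>)
next
  case (shadow_add a M b M')
  obtain A c where A: "finite A" "\<forall>g\<in>A. \<exists>T. g \<in> lam T" "\<forall>g. g \<notin> A \<longrightarrow> c g = (0 :: int)"
    "a = (\<Oplus>g\<in>A. [c g] \<cdot> \<phi> g)" "M = (\<Sum>g\<in>A. of_int (c g) * rho (crd g))"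
    using shadow_add.IH(1) by blast
  obtain B d where B: "finite B" "\<forall>g\<in>B. \<exists>T. g \<in> lam T" "\<forall>g. g \<notin> B \<longrightarrow> d g = (0 :: int)"
    "b = (\<Oplus>g\<in>B. [d g] \<cdot> \<phi> g)" "M' = (\<Sum>g\<in>B. of_int (d g) * rho (crd g))"
    using shadow_add.IH(2) by blast
  have cl: "\<phi> g \<in> carrier D" if "g \<in> A \<union> B" for g using that A B by auto
  have "a = (\<Oplus>g\<in>A \<union> B. [c g] \<cdot> \<phi> g)"
    unfolding A(4) using A B cl by (intro add.finprod_mono_neutral_cong_left) auto
  moreover have "b = (\<Oplus>g\<in>A \<union> B. [d g] \<cdot> \<phi> g)"
    unfolding B(4) using A B cl by (intro add.finprod_mono_neutral_cong_left) auto
  ultimately have "a \<oplus> b = (\<Oplus>g\<in>A \<union> B. [c g] \<cdot> \<phi> g \<oplus> [d g] \<cdot> \<phi> g)"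
    using cl by (simp add: finsum_addf)
  also have "\<dots> = (\<Oplus>g\<in>A \<union> B. [(c g + d g)] \<cdot> \<phi> g)"
    using cl by (intro finsum_cong') (auto simp: add.int_pow_mult)
  finally have 1: "a \<oplus> b = (\<Oplus>g\<in>A \<union> B. [(c g + d g)] \<cdot> \<phi> g)" .
  have "M = (\<Sum>g\<in>A \<union> B. of_int (c g) * rho (crd g))"
    unfolding A(5) using A B by (intro sum.mono_neutral_left) auto
  moreover have "M' = (\<Sum>g\<in>A \<union> B. of_int (d g) * rho (crd g))"
    unfolding B(5) using A B by (intro sum.mono_neutral_left) auto
  ultimately have 2: "M + M' = (\<Sum>g\<in>A \<union> B. of_int (c g + d g) * rho (crd g))"
    by (simp add: sum.distrib distrib_right)
  show ?case
    by (intro exI[of _ "A \<union> B"] exI[of _ "\<lambda>g. c g + d g"]) (use 1 2 A B in auto)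
next
  case (shadow_uminus a M)
  obtain A c where A: "finite A" "\<forall>g\<in>A. \<exists>T. g \<in> lam T" "\<forall>g. g \<notin> A \<longrightarrow> c g = (0 :: int)"
    "a = (\<Oplus>g\<in>A. [c g] \<cdot> \<phi> g)" "M = (\<Sum>g\<in>A. of_int (c g) * rho (crd g))"
    using shadow_uminus.IH by blast
  have cl: "\<phi> g \<in> carrier D" if "g \<in> A" for g using that A by auto
  have "(\<Oplus>g\<in>A. [(- c g)] \<cdot> \<phi> g) \<oplus> a = (\<Oplus>g\<in>A. [(- c g)] \<cdot> \<phi> g \<oplus> [c g] \<cdot> \<phi> g)"
    unfolding A(4) using cl by (simp add: finsum_addf)
  also have "\<dots> = (\<Oplus>g\<in>A. \<zero>)"
    using cl by (intro finsum_cong') (auto simp: add.int_pow_neg l_neg)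
  finally have "(\<Oplus>g\<in>A. [(- c g)] \<cdot> \<phi> g) \<oplus> a = \<zero>" by simp
  moreover have "a \<in> carrier D" "(\<Oplus>g\<in>A. [(- c g)] \<cdot> \<phi> g) \<in> carrier D"
    unfolding A(4) using cl by (auto intro!: finsum_closed)
  ultimately have 1: "\<ominus> a = (\<Oplus>g\<in>A. [(- c g)] \<cdot> \<phi> g)"
    by (intro minus_equality)
  show ?case
    by (intro exI[of _ A] exI[of _ "\<lambda>g. - c g"]) (use 1 A in \<open>auto simp: sum_negf\<close>)
qed

lemma of_int_mat2: "(of_int n :: 'c :: comm_ring_1 mat2) = Mat2 (of_int n) 0 0 (of_int n)"
proof -
  have "(of_nat m :: 'c mat2) = Mat2 (of_nat m) 0 0 (of_nat m)" for m
    by (induction m) (auto simp: zero_mat2_def one_mat2_def)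
  then show ?thesis by (cases n rule: int_cases2) simp_all
qed

lemma fls_nth_of_int_mult: "fls_nth (of_int n * f) k = n * fls_nth (f :: int fls) k"
proof -
  have "fls_nth (of_nat m * f) k = int m * fls_nth f k" for m
    by (induction m) (simp_all add: algebra_simps)
  then show ?thesis by (cases n rule: int_cases2) simp_all
qed

text \<open>\<open>vge n\<close> modulo the characteristic.\<close>

definition vanishes :: "int \<Rightarrow> int fls \<Rightarrow> bool" where
  "vanishes n f \<longleftrightarrow> (\<forall>k < n. zD (fls_nth f k))"

lemma vanishes_add: "\<lbrakk>vanishes n f; vanishes n g\<rbrakk> \<Longrightarrow> vanishes n (f + g)"
  by (simp add: vanishes_def)

lemma vanishes_vge: "vge n f \<Longrightarrow> vanishes n f"
  by (simp add: vanishes_def vge_def)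

lemma vanishes_pf_mult:
  assumes "vanishes n f"
  shows "vanishes n (pf p * f)"
proof (induction p)
  case 0
  then show ?case by (simp add: vanishes_def)
next
  case (pCons a p)
  have "pf (pCons a p) * f = fls_const a * f + fls_X * (pf p * f)"
    by (simp only: pf_pCons distrib_right mult.assoc)
  then show ?case
    using assms pCons.IH by (simp add: vanishes_def fls_X_times_conv_shift(1))
qed

text \<open>This transfers estimates from \<open>D\<close> to matrices. By \<open>TF_RG\<close> the
  element \<open>a\<close> has no component in a degree below \<open>n\<close>, so there the integer
  combination of group elements is zero and its coefficients vanish modulo the characteristic. Since
  \<open>rho\<close> is homogeneous, the same coefficients make up the low powers of
  \<open>t\<close> in \<open>M\<close>.\<close>

lemma shadow_TF:
  assumes sh: "shadow e a M" and a: "a \<in> TF n"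
  shows "pred_mat2 (vanishes n) M"
proof -
  obtain A c where A: "finite A" "\<forall>g\<in>A. \<exists>T. g \<in> lam T"
    "a = (\<Oplus>g\<in>A. [(c g :: int)] \<cdot> \<phi> g)" "M = (\<Sum>g\<in>A. of_int (c g) * rho (crd g))"
    using shadow_normal_form[OF sh] by blast
  have cl: "\<phi> g \<in> carrier D" "g \<in> carrier G" if "g \<in> A" for g using that A by auto
  \<comment> \<open>Subsums over group elements with prescribed coordinates lie in the matching
    span, because integer multiples of \<open>\<one>\<close> belong to \<open>F\<close>.\<close>
  have span: "(\<Oplus>g\<in>B. [c g] \<cdot> \<phi> g) \<in> Span (lam ` P)" if "B \<subseteq> A" "\<And>g. g \<in> B \<Longrightarrow> crd g \<in> P" for B P
  proof -
    have "finite B" using that A finite_subset by blast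
    then show ?thesis
      using that
    proof (induction B rule: finite_induct)
      case (insert g B)
      then obtain T where T: "g \<in> lam T" "T \<in> P" using A crd_eq by (metis insertI1 insert_subset)
      have "([k] \<cdot> \<one>) \<in> F" for k :: int
      proof -
        have "[k] \<cdot> \<one> \<in> F" if "k = int m" for m k
          unfolding that by (induction m) (simp_all add: add.int_pow_mult)
        then show ?thesis
          by (cases k rule: int_cases2) (auto simp: add.int_pow_neg)
      qed
      moreover have "[c g] \<cdot> \<phi> g = ([c g] \<cdot> \<one>) \<otimes> \<phi> g"
        using insert cl by (simp add: add_pow_ldistr_int)
      moreover have "N #>\<^bsub>G\<^esub> g \<in> lam ` P"
        using mem_coset(2)[OF HQ.lam_closed T(1)] T(2) by simp
      ultimately show ?case
        using insert cl
        by (subst finsum_insert) (auto simp: subset_iff intro!: Span_add_term)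
    qed simp
  qed
  have zero: "zD (c g)" if g: "g \<in> A" "hdeg (crd g) < n" for g
  proof -
    define d where "d = hdeg (crd g)"
    define B where "B = {h \<in> A. hdeg (crd h) = d}"
    have B: "finite B" "B \<subseteq> A" using A by (auto simp: B_def)
    have "a = (\<Oplus>h\<in>B. [c h] \<cdot> \<phi> h) \<oplus> (\<Oplus>h\<in>A - B. [c h] \<cdot> \<phi> h)"
      unfolding A(3) using A B cl
      by (subst finsum_Un_disjoint[symmetric]) (auto simp: Un_absorb1)
    moreover have clB: "(\<Oplus>h\<in>B. [c h] \<cdot> \<phi> h) \<in> carrier D" "(\<Oplus>h\<in>A - B. [c h] \<cdot> \<phi> h) \<in> carrier D"
      using B cl by (auto intro!: finsum_closed)
    ultimately have eq: "(\<Oplus>h\<in>B. [c h] \<cdot> \<phi> h) = a \<ominus> (\<Oplus>h\<in>A - B. [c h] \<cdot> \<phi> h)"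
      by (simp add: a_minus_def a_assoc r_neg)
    have "a \<in> RG n" using TF_RG[OF a] shadow_RG[OF sh] RG_RH by blast
    then have "a \<in> Span (lam ` {T. hdeg T \<noteq> d})"
      unfolding RG_def by (rule Span_mono) (use g in \<open>auto simp: d_def\<close>)
    moreover have "(\<Oplus>h\<in>A - B. [c h] \<cdot> \<phi> h) \<in> Span (lam ` {T. hdeg T \<noteq> d})"
      by (rule span) (auto simp: B_def)
    ultimately have "(\<Oplus>h\<in>B. [c h] \<cdot> \<phi> h) \<in> Span (lam ` {T. hdeg T \<noteq> d})"
      \<comment> \<open>The degree \<open>d\<close> part equals \<open>a\<close> minus the other
        terms, and neither of these meets degree \<open>d\<close>.\<close>
      unfolding eq by (rule Span_minus)
    moreover have "(\<Oplus>h\<in>B. [c h] \<cdot> \<phi> h) \<in> Span (lam ` {T. hdeg T = d})"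
      by (rule span) (auto simp: B_def)
    moreover have "lam ` {T. hdeg T \<noteq> d} \<inter> lam ` {T. hdeg T = d} = {}"
      by (rule lam_disjoint) auto
    ultimately have "(\<Oplus>h\<in>B. [c h] \<cdot> \<phi> h) = \<zero>"
      by (rule Span_disjoint)
    then show ?thesis
      unfolding zD_def using int_independent[of B c g] B g cl by (auto simp: B_def d_def)
  qed
  have "pred_mat2 (vanishes n) (of_int (c g) * rho (crd g))" if "g \<in> A" for g
  proof -
    obtain f1 f2 f3 f4 where f: "rho (crd g) = Mat2 f1 f2 f3 f4" by (cases "rho (crd g)")
    have "zD (c g * fls_nth f k)" if "f \<in> {f1, f2, f3, f4}" "k < n" for f k
    proof (cases "hdeg (crd g) = k")
      case True
      then show ?thesis using zero[OF \<open>g \<in> A\<close>] that by simp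
    next
      case False
      then have "fls_nth f k = 0" using pauli_rho_nth[of "crd g" k] f that by auto
      then show ?thesis by simp
    qed
    then show ?thesis
      by (simp add: f of_int_mat2 vanishes_def fls_nth_of_int_mult)
  qed
  then have "pred_mat2 (vanishes n) (\<Sum>g\<in>B. of_int (c g) * rho (crd g))" if "B \<subseteq> A" for B
    using that
    by (induction B rule: infinite_finite_induct)
      (auto intro: pred_mat2_add vanishes_add simp: zero_mat2_def vanishes_def)
  then show ?thesis using A by simp
qed

end

section \<open>Words in symmetric binomials\<close>

definition sgm :: "bool \<Rightarrow> 'a :: comm_ring_1 mat2" where
  "sgm b = (if b then Mat2 0 1 1 0 else Mat2 1 0 0 (- 1))"

text \<open>\<open>False\<close> selects \<open>x\<close> and \<open>True\<close> selects
  \<open>y\<close>, in accordance with the coding of letters in \<open>reduced_word\<close>.\<close>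

definition gen :: "bool \<Rightarrow> int \<times> int \<times> int" where
  "gen b = (if b then (0, 1, 0) else (1, 0, 0))"

abbreviation tX :: "int poly" where "tX \<equiv> [:0, 1:]"

lemma sgm_sq: "sgm b * sgm b = 1"
  by (simp add: sgm_def one_mat2_def)

lemma pm_sgm [simp]: "pm (sgm b) = sgm b" and evm_sgm [simp]: "evm (sgm b) = sgm b"
  by (simp_all add: sgm_def)

lemma pf_tX: "pf tX = fls_X"
  by (simp add: pf_def)

lemma hdeg_gen [simp]: "hdeg (gen b) = 1" "hdeg (hinv (gen b)) = - 1"
  by (simp_all add: gen_def hinv_def)

lemma hinv_hinv_gen [simp]: "hinv (hinv (gen b)) = gen b"
  by (simp add: gen_def hinv_def)

lemma pauli_gen: "pauli 1 0 0 = sgm False" "pauli 0 1 0 = sgm True" "pauli (- 1) 0 0 = sgm False" "pauli 0 (- 1) 0 = sgm True"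
  by (simp_all add: pauli_def sgm_def one_mat2_def)

lemma rho_gen: "rho (gen b) = pm (smul tX (sgm b))"
  by (cases b) (simp_all add: gen_def rho.simps pauli_gen pf_tX fls_X_conv_shift_1)

lemma rho_hinv_gen: "smul (pf tX) (rho (hinv (gen b))) = pm (sgm b)"
proof -
  have "rho (hinv (gen b)) = smul (fls_X_intpow (- 1)) (sgm b)"
    by (cases b) (simp_all add: gen_def hinv_def rho.simps pauli_gen)
  moreover have "fls_X * (fls_X_intpow (- 1) :: int fls) = 1"
    by (simp add: fls_X_times_conv_shift)
  ultimately show ?thesis
    by (simp only: pf_tX smul_simps pm_sgm)
qed

text \<open>\<open>lvec (b, True)\<close> spans the image of \<open>1 - sgm b\<close>, the value of
  the binomial at \<open>t = -1\<close>, and \<open>lvec (b, False)\<close> that of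
  \<open>1 + sgm b\<close>, which comes from its inverse. They are eigenvectors of
  \<open>sgm b\<close> for -1 and 1.\<close>

fun lvec :: "bool \<times> bool \<Rightarrow> int \<times> int" where
  "lvec (False, True) = (0, 1)"
| "lvec (False, False) = (1, 0)"
| "lvec (True, True) = (1, - 1)"
| "lvec (True, False) = (1, 1)"

fun outer :: "int \<times> int \<Rightarrow> int \<times> int \<Rightarrow> int mat2" where
  "outer (a, b) (c, d) = Mat2 (a * c) (a * d) (b * c) (b * d)"

fun dot :: "int \<times> int \<Rightarrow> int \<times> int \<Rightarrow> int" where
  "dot (a, b) (c, d) = a * c + b * d"

lemma outer_mult: "outer u v * outer w z = smul (dot v w) (outer u z)"
  by (cases u; cases v; cases w; cases z) (simp add: algebra_simps)

definition pow2 :: "int \<Rightarrow> bool" where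
  "pow2 s \<longleftrightarrow> (\<exists>k. s = 2 ^ k \<or> s = - (2 ^ k))"

lemma pow2_mult: "\<lbrakk>pow2 s; pow2 t\<rbrakk> \<Longrightarrow> pow2 (s * t)"
  unfolding pow2_def by (auto simp flip: power_add)

lemma pow2_simps [simp]: "pow2 1" "pow2 (- 1)" "pow2 2" "pow2 (- 2)" "pow2 4" "pow2 (- 4)"
proof -
  show "pow2 1" "pow2 (- 1)" unfolding pow2_def by (intro exI[of _ 0]; simp)+
  show "pow2 2" "pow2 (- 2)" unfolding pow2_def by (intro exI[of _ 1]; simp)+
  show "pow2 4" "pow2 (- 4)" unfolding pow2_def by (intro exI[of _ 2]; simp)+
qed

text \<open>The only orthogonal pairs are the two eigenvectors of one \<open>sgm b\<close>, and
  those belong to cancelling letters. The other scalar products are 1, -1 or 2.\<close>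

lemma pow2_dot:
  assumes "\<not> (fst l = fst l' \<and> snd l \<noteq> snd l')"
  shows "pow2 (dot (lvec l) (lvec l'))"
  using assms by (cases l; cases l'; cases "fst l"; cases "snd l"; cases "fst l'"; cases "snd l'") auto

lemma (in monoid) inv_mult_Units:
  assumes "a \<in> Units G" "b \<in> Units G"
  shows "inv (a \<otimes> b) = inv b \<otimes> inv a"
proof -
  have c: "a \<in> carrier G" "b \<in> carrier G" "inv a \<in> carrier G" "inv b \<in> carrier G"
    using assms by auto
  have "(inv b \<otimes> inv a) \<otimes> (a \<otimes> b) = inv b \<otimes> ((inv a \<otimes> a) \<otimes> b)"
    using c by (simp only: m_assoc m_closed)
  moreover have "(a \<otimes> b) \<otimes> (inv b \<otimes> inv a) = a \<otimes> ((b \<otimes> inv b) \<otimes> inv a)"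
    using c by (simp only: m_assoc m_closed)
  ultimately show ?thesis
    using assms c by (intro inv_unique'[symmetric]) auto
qed

context free_pair_setup
begin

text \<open>\<open>\<delta>\<close> is a denominator: modulo elements of high order, \<open>d\<close> lies in the integral group ring, and
  its image there is \<open>P / \<delta>\<close>.\<close>

definition approx :: "'a \<Rightarrow> int poly \<Rightarrow> int poly mat2 \<Rightarrow> bool" where
  "approx d \<delta> P \<longleftrightarrow> d \<in> carrier D \<and>
    (\<exists>e. \<forall>n. \<exists>a M. shadow e a M \<and> d \<ominus> a \<in> TF n \<and> vmat n (smul (pf \<delta>) M - pm P))"

lemma approx_shadow:
  assumes "shadow e a M" "smul (pf \<delta>) M = pm P"
  shows "approx a \<delta> P"
proof -
  have "a \<ominus> a = \<zero>" using shadow_carrier[OF assms(1)] by (simp add: a_minus_def r_neg)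
  then show ?thesis
    unfolding approx_def using assms shadow_carrier[OF assms(1)]
    by (intro conjI exI[of _ e] allI exI[of _ a] exI[of _ M]) auto
qed

text \<open>The error of a product is \<open>(d - a) d' + a (d' - b)\<close>. Both summands are
  small because the lower bound in \<open>approx\<close> is chosen before \<open>n\<close>: it
  bounds the orders of \<open>a\<close> and \<open>d'\<close> however good the approximation
  is.\<close>

lemma approx_mult:
  assumes "approx d \<delta> P" "approx d' \<delta>' P'"
  shows "approx (d \<otimes> d') (\<delta> * \<delta>') (P * P')"
proof -
  obtain e1 where e1: "\<And>n. \<exists>a M. shadow e1 a M \<and> d \<ominus> a \<in> TF n \<and> vmat n (smul (pf \<delta>) M - pm P)"
    using assms(1) by (auto simp: approx_def)
  obtain e2 where e2: "\<And>n. \<exists>a M. shadow e2 a M \<and> d' \<ominus> a \<in> TF n \<and> vmat n (smul (pf \<delta>') M - pm P')"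
    using assms(2) by (auto simp: approx_def)
  have d: "d \<in> carrier D" "d' \<in> carrier D" using assms by (auto simp: approx_def)
  define e where "e = min 0 (min e1 e2)"
  have e: "e \<le> e1" "e \<le> e2" "e \<le> 0" by (auto simp: e_def)
  have "\<exists>a M. shadow (e + e) a M \<and> d \<otimes> d' \<ominus> a \<in> TF n \<and> vmat n (smul (pf (\<delta> * \<delta>')) M - pm (P * P'))" for n
  proof -
    \<comment> \<open>Multiplication by an element of order at least \<open>e\<close> loses up to
      \<open>- e\<close>, so precision \<open>n - e\<close> is requested. The maximum with 0 keeps
      \<open>d' \<ominus> b\<close>, and with it \<open>d'\<close>, in \<open>TF e\<close>.\<close>
    define m where "m = max (n - e) 0"
    obtain a A where a: "shadow e1 a A" "d \<ominus> a \<in> TF m" "vmat m (smul (pf \<delta>) A - pm P)"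
      using e1 by blast
    obtain b B where b: "shadow e2 b B" "d' \<ominus> b \<in> TF m" "vmat m (smul (pf \<delta>') B - pm P')"
      using e2 by blast
    have sa: "shadow e a A" and sb: "shadow e b B"
      using a b e shadow_mono by blast+
    have ab: "a \<in> carrier D" "b \<in> carrier D" using sa sb shadow_carrier by auto
    have bT: "b \<in> TF e" and aT: "a \<in> TF e" using shadow_RG[OF sb] shadow_RG[OF sa] RG_TF by auto
    have "d' = (d' \<ominus> b) \<oplus> b" using d ab by (simp add: a_minus_def a_assoc l_neg)
    moreover have "d' \<ominus> b \<in> TF e" by (rule TF_antimono[OF b(2)]) (use e in \<open>simp add: m_def\<close>)
    ultimately have dT: "d' \<in> TF e" using bT TF_add by metis
    have mn: "n \<le> m + e" "n \<le> e + m" "n \<le> 0 + m" "n \<le> m + (0 + e)" using e by (auto simp: m_def)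
    have "(d \<ominus> a) \<otimes> d' \<in> TF n" by (rule TF_antimono[OF TF_mult[OF a(2) dT] mn(1)])
    moreover have "a \<otimes> (d' \<ominus> b) \<in> TF n" by (rule TF_antimono[OF TF_mult[OF aT b(2)] mn(2)])
    moreover have "d \<otimes> d' \<ominus> a \<otimes> b = (d \<ominus> a) \<otimes> d' \<oplus> a \<otimes> (d' \<ominus> b)"
    proof -
      have "(d \<ominus> a) \<otimes> d' \<oplus> a \<otimes> (d' \<ominus> b) = d \<otimes> d' \<oplus> (\<ominus> (a \<otimes> d') \<oplus> (a \<otimes> d' \<oplus> \<ominus> (a \<otimes> b)))"
        using d ab by (simp add: a_minus_def l_distr r_distr l_minus r_minus a_assoc)
      then show ?thesis using d ab by (simp add: a_minus_def r_neg1)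
    qed
    ultimately have 1: "d \<otimes> d' \<ominus> a \<otimes> b \<in> TF n" using TF_add by simp
    have "smul (pf (\<delta> * \<delta>')) (A * B) - pm (P * P')
      = (smul (pf \<delta>) A - pm P) * smul (pf \<delta>') B + pm P * (smul (pf \<delta>') B - pm P')"
      by (simp add: smul_simps algebra_simps)
    moreover have "vmat n ((smul (pf \<delta>) A - pm P) * smul (pf \<delta>') B)"
      by (rule vmat_mono[OF vmat_mult[OF a(3) vmat_smul[OF vge_pf shadow_vmat[OF sb]]] mn(4)])
    moreover have "vmat n (pm P * (smul (pf \<delta>') B - pm P'))"
      by (rule vmat_mono[OF vmat_mult[OF vmat_pm b(3)] mn(3)])
    ultimately show ?thesis
      using 1 shadow_mult[OF sa sb] by (metis vmat_simps(2))
  qed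
  then show ?thesis unfolding approx_def using d by blast
qed

lemma approx_one: "approx \<one> 1 1"
  by (rule approx_shadow[OF shadow_one[of 0]]) (simp_all add: smul_simps)

text \<open>\<open>a\<close> and \<open>M\<close> are corresponding partial sums of the geometric
  series: each step replaces \<open>a\<close> by \<open>\<one> - \<phi> g \<otimes> a\<close> and
  multiplies the error by \<open>- \<phi> g\<close>. A single induction keeps the element and its
  matrix in step; it starts from \<open>a = \<zero>\<close> with error
  \<open>- \<one>\<close>.\<close>

lemma geometric_shadow:
  assumes g: "g \<in> lam T" "hdeg T = 1"
  shows "\<exists>a M b B. shadow 0 a M \<and> b \<in> TF (int n) \<and> vmat (int n) B \<and>
    (\<one> \<oplus> \<phi> g) \<otimes> a = \<one> \<oplus> b \<and> (1 + rho T) * M = 1 + B"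
proof (induction n)
  case 0
  have "\<ominus> \<one> \<in> TF 0" using one_RG(1) RG_TF TF_uminus by blast
  moreover have "vmat 0 (- 1)" using vmat_pm[of "- 1"] by simp
  moreover have "(\<one> \<oplus> \<phi> g) \<otimes> \<zero> = \<one> \<oplus> \<ominus> \<one>" using g by (simp add: r_neg)
  moreover have "(1 + rho T) * 0 = 1 + (- 1)" by simp
  ultimately show ?case using shadow_zero[of 0] unfolding of_nat_0 by blast
next
  case (Suc n)
  obtain a M b B where IH: "shadow 0 a M" "b \<in> TF (int n)" "vmat (int n) B"
    "(\<one> \<oplus> \<phi> g) \<otimes> a = \<one> \<oplus> b" "(1 + rho T) * M = 1 + B"
    using Suc.IH by blast
  have c: "\<phi> g \<in> carrier D" "a \<in> carrier D" "b \<in> carrier D"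
    using g shadow_carrier[OF IH(1)] TF_carrier[OF IH(2)] by auto
  have sg: "shadow 1 (\<phi> g) (rho T)" using g by (intro shadow_phi) auto
  have "shadow 0 (\<phi> g \<otimes> a) (rho T * M)"
    using shadow_mono[OF shadow_mult[OF sg IH(1)], of 0] by simp
  then have 1: "shadow 0 (\<one> \<oplus> \<ominus> (\<phi> g \<otimes> a)) (1 + - (rho T * M))"
    by (intro shadow_add shadow_uminus shadow_one) auto
  have 2: "\<ominus> (\<phi> g \<otimes> b) \<in> TF (int (Suc n))"
    using TF_uminus[OF TF_mult[OF RG_TF[OF shadow_RG[OF sg]] IH(2)]] by simp
  have 3: "vmat (int (Suc n)) (- (rho T * B))"
    using vmat_mult[OF shadow_vmat[OF sg] IH(3)] by simp
  have "(\<one> \<oplus> \<phi> g) \<otimes> (\<one> \<oplus> \<ominus> (\<phi> g \<otimes> a)) = \<one> \<oplus> \<phi> g \<oplus> \<ominus> (\<phi> g \<otimes> ((\<one> \<oplus> \<phi> g) \<otimes> a))"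
    using c by (simp add: l_distr r_distr r_minus minus_add a_ac m_assoc)
  also have "\<dots> = \<one> \<oplus> \<ominus> (\<phi> g \<otimes> b)"
  proof -
    have "\<phi> g \<oplus> (\<ominus> \<phi> g \<oplus> \<ominus> (\<phi> g \<otimes> b)) = \<ominus> (\<phi> g \<otimes> b)" using c by (simp add: r_neg2)
    then show ?thesis unfolding IH(4) using c by (simp add: r_distr minus_add a_assoc)
  qed
  finally have 4: "(\<one> \<oplus> \<phi> g) \<otimes> (\<one> \<oplus> \<ominus> (\<phi> g \<otimes> a)) = \<one> \<oplus> \<ominus> (\<phi> g \<otimes> b)" .
  have "(1 + rho T) * (1 + - (rho T * M)) = 1 + rho T - rho T * ((1 + rho T) * M)"
    by (simp add: algebra_simps)
  also have "\<dots> = 1 + - (rho T * B)" unfolding IH(5) by (simp add: algebra_simps)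
  finally show ?case using 1 2 3 4 by blast
qed

lemma approx_binomial:
  assumes "g \<in> lam (gen b)"
  shows "approx (\<one> \<oplus> \<phi> g) 1 (1 + smul tX (sgm b))"
proof (rule approx_shadow)
  show "shadow 0 (\<one> \<oplus> \<phi> g) (1 + rho (gen b))"
    using assms by (intro shadow_add shadow_one shadow_phi) auto
  show "smul (pf 1) (1 + rho (gen b)) = pm (1 + smul tX (sgm b))"
    by (simp add: smul_simps rho_gen)
qed

text \<open>For \<open>R = t \<sigma>\<close> one has \<open>R * R = t^2\<close>, so the inverse of
  \<open>1 + R\<close> is \<open>(1 - R) / (1 - t^2)\<close>. The approximations are the partial
  sums of \<open>geometric_shadow\<close>.\<close>

lemma approx_inverse_binomial:
  assumes "g \<in> lam (gen b)"
  shows "approx (inv (\<one> \<oplus> \<phi> g)) (1 - tX * tX) (1 - smul tX (sgm b))"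
proof -
  define R where "R = smul tX (sgm b)"
  have RR: "R * R = smul (tX * tX) 1" by (simp only: R_def smul_simps sgm_sq)
  have gc: "\<one> \<oplus> \<phi> g \<in> carrier D" using assms by simp
  have U: "\<one> \<oplus> \<phi> g \<in> Units D" and inv: "inv (\<one> \<oplus> \<phi> g) \<in> TF 0"
    using inverse_TF[OF assms] by auto
  have key: "smul (pf (1 - tX * tX)) M = (1 - pm R) * ((1 + pm R) * M)" for M
  proof -
    have "(1 - R) * (1 + R) = smul (1 - tX * tX) 1"
      using RR by (simp add: algebra_simps smul_simps)
    then have "(1 - pm R) * (1 + pm R) = smul (pf (1 - tX * tX)) 1"
      by (metis pm_simps(2,3,4,6,7))
    then show ?thesis
      unfolding mult.assoc[symmetric] by (simp only: smul_simps mult_1_left)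
  qed
  have "\<exists>a M. shadow 0 a M \<and> inv (\<one> \<oplus> \<phi> g) \<ominus> a \<in> TF n \<and>
      vmat n (smul (pf (1 - tX * tX)) M - pm (1 - R))" for n
  proof -
    obtain a M c B where *: "shadow 0 a M" "c \<in> TF (int (nat n))" "vmat (int (nat n)) B"
      "(\<one> \<oplus> \<phi> g) \<otimes> a = \<one> \<oplus> c" "(1 + rho (gen b)) * M = 1 + B"
      using geometric_shadow[OF assms, of "nat n"] by auto
    have cl: "a \<in> carrier D" "c \<in> carrier D" using * shadow_carrier TF_carrier by auto
    define i where "i = inv (\<one> \<oplus> \<phi> g)"
    have i: "i \<in> carrier D" "i \<otimes> (\<one> \<oplus> \<phi> g) = \<one>" using U by (auto simp: i_def)
    have "a = i \<otimes> ((\<one> \<oplus> \<phi> g) \<otimes> a)" using i cl gc by (simp flip: m_assoc)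
    also have "\<dots> = i \<oplus> i \<otimes> c" using * i cl by (simp add: r_distr)
    \<comment> \<open>The error of the partial sum is \<open>i \<otimes> c\<close>; as
      \<open>i\<close> has order at least 0, it is as small as \<open>c\<close>.\<close>
    finally have a: "a = i \<oplus> i \<otimes> c" .
    have "i \<ominus> a = \<ominus> (i \<otimes> c)"
      unfolding a using i cl by (simp add: a_minus_def minus_add r_neg2 r_neg1)
    moreover have "i \<otimes> c \<in> TF (0 + int (nat n))"
      using TF_mult[OF inv *(2)] by (simp add: i_def)
    ultimately have 1: "i \<ominus> a \<in> TF n"
      using TF_uminus TF_antimono[of _ "0 + int (nat n)" n] by simp
    have "smul (pf (1 - tX * tX)) M - pm (1 - R) = pm (1 - R) * B"
      using *(5) unfolding key rho_gen R_def[symmetric] by (simp add: algebra_simps)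
    moreover have "vmat n (pm (1 - R) * B)"
      by (rule vmat_mono[OF vmat_mult[OF vmat_pm *(3)]]) simp
    ultimately have "vmat n (smul (pf (1 - tX * tX)) M - pm (1 - R))"
      by (simp only:)
    then show ?thesis using *(1) 1 unfolding i_def by blast
  qed
  then show ?thesis unfolding approx_def R_def[symmetric] using U by blast
qed

lemma approx_phi: "g \<in> lam (gen b) \<Longrightarrow> approx (\<phi> g) 1 (smul tX (sgm b))"
  by (rule approx_shadow[OF shadow_phi[OF _ order_refl]]) (auto simp: rho_gen smul_simps)

lemma approx_phi_inv: "g \<in> lam (hinv (gen b)) \<Longrightarrow> approx (\<phi> g) tX (sgm b)"
  by (rule approx_shadow[OF shadow_phi[OF _ order_refl]]) (auto simp: rho_hinv_gen)

lemma poly_zD: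
  assumes "\<And>k. zD (coeff p k)"
  shows "zD (poly p a)"
  unfolding poly_altdef using assms by (intro zD_sum) simp

text \<open>Multiplying the error \<open>1 - M\<close> by the denominator and adding
  \<open>\<delta> M - P\<close> eliminates \<open>M\<close>. The polynomial matrix
  \<open>\<delta> - P\<close> then vanishes modulo the characteristic up to every order, so all its
  coefficients do and evaluation is allowed. The value of \<open>\<delta>\<close> at -1 may be
  zero.\<close>

lemma approx_one_evm:
  assumes "approx \<one> \<delta> P"
  shows "pred_mat2 zD (smul (poly \<delta> (- 1)) 1 - evm P)"
proof -
  obtain e where e: "\<And>n. \<exists>a M. shadow e a M \<and> \<one> \<ominus> a \<in> TF n \<and> vmat n (smul (pf \<delta>) M - pm P)"
    using assms by (auto simp: approx_def)
  have "pred_mat2 (vanishes n) (pm (smul \<delta> 1 - P))" for n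
  proof -
    obtain a M where a: "shadow e a M" "\<one> \<ominus> a \<in> TF n" "vmat n (smul (pf \<delta>) M - pm P)"
      using e by blast
    have "shadow (min e 0) (\<one> \<oplus> \<ominus> a) (1 + - M)"
      using shadow_mono[OF a(1), of "min e 0"] by (intro shadow_add shadow_uminus shadow_one) auto
    then have "pred_mat2 (vanishes n) (1 + - M)"
      using shadow_TF a(2) by (simp add: a_minus_def)
    then have "pred_mat2 (vanishes n) (smul (pf \<delta>) (1 + - M))"
      by (cases "1 + - M") (simp add: vanishes_pf_mult)
    moreover have "pred_mat2 (vanishes n) (smul (pf \<delta>) M - pm P)"
      using a(3) by (cases "smul (pf \<delta>) M - pm P") (simp add: vanishes_vge)
    ultimately have "pred_mat2 (vanishes n) (smul (pf \<delta>) (1 + - M) + (smul (pf \<delta>) M - pm P))"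
      by (intro pred_mat2_add vanishes_add)
    then show ?thesis by (simp add: smul_simps)
  qed
  then have *: "pred_mat2 (\<lambda>p. vanishes n (pf p)) (smul \<delta> 1 - P)" for n
    by (cases "smul \<delta> 1 - P") simp
  have "zD (poly p (- 1))" if "\<And>n. vanishes n (pf p)" for p
  proof (rule poly_zD)
    fix k
    have "zD (fls_nth (pf p) (int k))"
      using that[of "int k + 1"] unfolding vanishes_def by simp
    then show "zD (coeff p k)" unfolding pf_nth .
  qed
  then have "pred_mat2 zD (evm (smul \<delta> 1 - P))"
    using * by (cases "smul \<delta> 1 - P") simp
  then show ?thesis by simp
qed

definition symm :: "'g \<Rightarrow> 'g \<Rightarrow> 'a" where
  "symm g h = (\<one> \<oplus> \<phi> g) \<otimes> (\<one> \<oplus> \<phi> h)"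

lemma lam_inv_mem:
  assumes "g \<in> lam T"
  shows "inv\<^bsub>G\<^esub> g \<in> lam (hinv T)"
proof -
  have c: "g \<in> carrier G" using assms by simp
  have "lam (hinv T) = inv\<^bsub>Q\<^esub> (N #>\<^bsub>G\<^esub> g)"
    using mem_coset(2)[OF HQ.lam_closed assms] by (simp add: HQ.lam_hinv)
  also have "\<dots> = N #>\<^bsub>G\<^esub> inv\<^bsub>G\<^esub> g"
    using c G.inv_FactGroup[of "N #>\<^bsub>G\<^esub> g"] by (simp add: G.rcos_inv)
  finally show ?thesis using c G.rcos_self[of "inv\<^bsub>G\<^esub> g"] G.is_subgroup by simp
qed

text \<open>If \<open>h\<close> lies in the coset of \<open>gen b\<close>, both factors have the
  same matrix. If it lies in the inverse coset, then \<open>1 + h = h (1 + k)\<close> with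
  \<open>k\<close> the inverse of \<open>h\<close>, and the extra factor \<open>h\<close>
  contributes \<open>sgm b / t\<close>. At \<open>t = -1\<close> the factor \<open>sgm b\<close>
  acts on its own eigenvectors, so only a sign changes.\<close>

lemma letter_approx:
  assumes g: "g \<in> lam (gen b)" and h: "h \<in> lam (gen b) \<or> h \<in> lam (hinv (gen b))"
  shows "symm g h \<in> Units D"
    and "\<exists>\<delta> P s. approx (symm g h) \<delta> P \<and> evm P = smul s (outer (lvec (b, True)) (lvec (b, True))) \<and> pow2 s"
    and "\<exists>\<delta> P s. approx (inv (symm g h)) \<delta> P \<and> evm P = smul s (outer (lvec (b, False)) (lvec (b, False))) \<and> pow2 s"
proof -
  let ?t = "smul tX (sgm b) :: int poly mat2"
  \<comment> \<open>\<open>(1 - sgm b)^2 = 2 (1 - sgm b)\<close>, and \<open>1 - sgm b\<close> is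
    the outer product itself for \<open>True\<close> but twice it for \<open>False\<close>; hence 2
    and 4. The same holds for \<open>1 + sgm b\<close>.\<close>
  have sq: "(1 - sgm b) * (1 - sgm b) = smul (if b then 2 else 4) (outer (lvec (b, True)) (lvec (b, True)))"
    "(1 + sgm b) * (1 + sgm b) = smul (if b then 2 else 4) (outer (lvec (b, False)) (lvec (b, False)))"
    by (cases b; simp add: sgm_def one_mat2_def)+
  have ev: "evm (1 + ?t) = 1 - sgm b" "evm (1 - ?t) = 1 + sgm b" "evm ?t = - sgm b"
    by (cases b; simp add: sgm_def one_mat2_def)+
  have Ug: "\<one> \<oplus> \<phi> g \<in> Units D" using inverse_TF g by simp
  have "symm g h \<in> Units D \<and>
    (\<exists>\<delta> P s. approx (symm g h) \<delta> P \<and> evm P = smul s (outer (lvec (b, True)) (lvec (b, True))) \<and> pow2 s) \<and>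
    (\<exists>\<delta> P s. approx (inv (symm g h)) \<delta> P \<and> evm P = smul s (outer (lvec (b, False)) (lvec (b, False))) \<and> pow2 s)"
    using h
  proof
    assume h: "h \<in> lam (gen b)"
    have Uh: "\<one> \<oplus> \<phi> h \<in> Units D" using inverse_TF h by simp
    have inv: "inv (symm g h) = inv (\<one> \<oplus> \<phi> h) \<otimes> inv (\<one> \<oplus> \<phi> g)"
      unfolding symm_def using Ug Uh by (rule inv_mult_Units)
    have "symm g h \<in> Units D" unfolding symm_def using Ug Uh by simp
    moreover have "approx (symm g h) (1 * 1) ((1 + ?t) * (1 + ?t))"
      unfolding symm_def by (intro approx_mult approx_binomial g h)
    moreover have "evm ((1 + ?t) * (1 + ?t)) = smul (if b then 2 else 4) (outer (lvec (b, True)) (lvec (b, True)))"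
      unfolding evm_simps(6) ev by (rule sq)
    moreover have "approx (inv (symm g h)) ((1 - tX * tX) * (1 - tX * tX)) ((1 - ?t) * (1 - ?t))"
      unfolding inv by (intro approx_mult approx_inverse_binomial g h)
    moreover have "evm ((1 - ?t) * (1 - ?t)) = smul (if b then 2 else 4) (outer (lvec (b, False)) (lvec (b, False)))"
      unfolding evm_simps(6) ev by (rule sq)
    moreover have "pow2 (if b then 2 else 4)" by simp
    ultimately show ?thesis by blast
  next
    assume h: "h \<in> lam (hinv (gen b))"
    define k where "k = inv\<^bsub>G\<^esub> h"
    have k: "k \<in> lam (gen b)" using lam_inv_mem[OF h] by (simp add: k_def)
    have hc: "h \<in> carrier G" "k \<in> carrier G" using h k by auto
    have hk: "\<phi> h \<otimes> \<phi> k = \<one>" "\<phi> k \<otimes> \<phi> h = \<one>" using phi_inv[of h] hc by (auto simp: k_def)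
    have Uk: "\<one> \<oplus> \<phi> k \<in> Units D" using inverse_TF k by simp
    have Uh: "\<phi> h \<in> Units D" using hk hc by (auto simp: Units_def)
    have ih: "inv (\<phi> h) = \<phi> k" using hk hc by (intro inv_unique'[symmetric]) auto
    have "\<one> \<oplus> \<phi> h = \<phi> h \<otimes> (\<one> \<oplus> \<phi> k)" using hk hc by (simp add: r_distr a_comm)
    then have w: "symm g h = (\<one> \<oplus> \<phi> g) \<otimes> (\<phi> h \<otimes> (\<one> \<oplus> \<phi> k))" by (simp add: symm_def)
    have inv: "inv (symm g h) = (inv (\<one> \<oplus> \<phi> k) \<otimes> \<phi> k) \<otimes> inv (\<one> \<oplus> \<phi> g)"
      unfolding w using Ug Uk Uh ih by (simp add: inv_mult_Units)
    have sq': "(1 - sgm b) * (sgm b * (1 - sgm b)) = smul (- (if b then 2 else 4)) (outer (lvec (b, True)) (lvec (b, True)))"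
      "(1 + sgm b) * - sgm b * (1 + sgm b) = smul (- (if b then 2 else 4)) (outer (lvec (b, False)) (lvec (b, False)))"
      by (cases b; simp add: sgm_def one_mat2_def)+
    have "symm g h \<in> Units D" unfolding w using Ug Uk Uh by simp
    moreover have "approx (symm g h) (1 * (tX * 1)) ((1 + ?t) * (sgm b * (1 + ?t)))"
      unfolding w by (intro approx_mult approx_binomial approx_phi_inv g h k)
    moreover have "evm ((1 + ?t) * (sgm b * (1 + ?t)))
        = smul (- (if b then 2 else 4)) (outer (lvec (b, True)) (lvec (b, True)))"
      unfolding evm_simps(6) ev evm_sgm by (rule sq')
    moreover have "approx (inv (symm g h)) ((1 - tX * tX) * 1 * (1 - tX * tX)) ((1 - ?t) * ?t * (1 - ?t))"
      unfolding inv by (intro approx_mult approx_inverse_binomial approx_phi g k)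
    moreover have "evm ((1 - ?t) * ?t * (1 - ?t))
        = smul (- (if b then 2 else 4)) (outer (lvec (b, False)) (lvec (b, False)))"
      unfolding evm_simps(6) ev by (rule sq')
    moreover have "pow2 (- (if b then 2 else 4))" by simp
    ultimately show ?thesis by blast
  qed
  then show "symm g h \<in> Units D"
    "\<exists>\<delta> P s. approx (symm g h) \<delta> P \<and> evm P = smul s (outer (lvec (b, True)) (lvec (b, True))) \<and> pow2 s"
    "\<exists>\<delta> P s. approx (inv (symm g h)) \<delta> P \<and> evm P = smul s (outer (lvec (b, False)) (lvec (b, False))) \<and> pow2 s"
    by blast+
qed

text \<open>By \<open>outer_mult\<close> the inner vectors contract to scalar products of
  neighbouring letters, which are powers of 2 up to sign in a reduced word. Only the two outermost
  vectors survive.\<close>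

lemma word_approx:
  assumes letter: "\<And>l. \<exists>\<delta> P s. approx (let g = (if fst l then v else u) in (if snd l then g else inv g)) \<delta> P \<and>
      evm P = smul s (outer (lvec l) (lvec l)) \<and> pow2 s"
    and "reduced_word (l # w)"
  shows "\<exists>\<delta> P s l'. approx (eval_word D u v (l # w)) \<delta> P \<and> evm P = smul s (outer (lvec l) (lvec l')) \<and> pow2 s"
  using assms(2)
proof (induction w arbitrary: l)
  case Nil
  obtain \<delta> P s where *: "approx (let g = (if fst l then v else u) in (if snd l then g else inv g)) \<delta> P"
    "evm P = smul s (outer (lvec l) (lvec l))" "pow2 s"
    using letter by blast
  have "approx (eval_word D u v [l]) (\<delta> * 1) (P * 1)"
    unfolding eval_word.simps by (intro approx_mult * approx_one)
  then have "approx (eval_word D u v [l]) \<delta> P"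
    by (simp only: mult_1_right)
  then show ?case using *(2,3) by blast
next
  case (Cons l2 w)
  obtain \<delta> P s where *: "approx (let g = (if fst l then v else u) in (if snd l then g else inv g)) \<delta> P"
    "evm P = smul s (outer (lvec l) (lvec l))" "pow2 s"
    using letter by blast
  have "reduced_word (l2 # w)" using Cons.prems by simp
  then obtain \<delta>' P' s' l' where w: "approx (eval_word D u v (l2 # w)) \<delta>' P'"
    "evm P' = smul s' (outer (lvec l2) (lvec l'))" "pow2 s'"
    using Cons.IH[of l2] by blast
  have "approx (eval_word D u v (l # l2 # w)) (\<delta> * \<delta>') (P * P')"
    unfolding eval_word.simps(2)[of D u v l] by (intro approx_mult * w)
  moreover have "evm (P * P') = smul (s * (s' * dot (lvec l) (lvec l2))) (outer (lvec l) (lvec l'))"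
    unfolding evm_simps(6) * w smul_simps outer_mult by (simp add: algebra_simps)
  moreover have "pow2 (s * (s' * dot (lvec l) (lvec l2)))"
    using Cons.prems by (intro pow2_mult * w pow2_dot) simp
  ultimately show ?case by blast
qed

text \<open>The entries of the outer product are 0, 1 or -1. Either some off-diagonal entry is
  nonzero, or exactly one diagonal entry is; in both cases a scalar matrix would force
  \<open>s\<close> to vanish in \<open>D\<close>.\<close>

lemma rank_one_not_scalar:
  assumes "pred_mat2 zD (smul r 1 - smul s (outer (lvec l) (lvec l')))" "pow2 s"
  shows False
proof -
  have s: "\<not> zD s" "\<not> zD (- s)" using assms(2) zD_power_two zD_simps(5) unfolding pow2_def by fastforce+
  have d: "zD (r - s) \<Longrightarrow> zD r \<Longrightarrow> False"
    using zD_minus[of r "r - s"] s by simp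
  show False
    using assms(1) s d
    by (cases l; cases l'; cases "fst l"; cases "snd l"; cases "fst l'"; cases "snd l'")
      (auto simp: one_mat2_def)
qed

theorem free_pair_symm:
  assumes "g \<in> lam (gen False)" "g' \<in> lam (gen False) \<or> g' \<in> lam (hinv (gen False))"
    and "h \<in> lam (gen True)" "h' \<in> lam (gen True) \<or> h' \<in> lam (hinv (gen True))"
  shows "free_pair D (symm g g') (symm h h')"
  unfolding free_pair_def
proof (intro conjI allI impI)
  note g = letter_approx[OF assms(1,2)] and h = letter_approx[OF assms(3,4)]
  show "symm g g' \<in> Units D" "symm h h' \<in> Units D" using g h by auto
  fix w :: "(bool \<times> bool) list" assume w: "w \<noteq> []" "reduced_word w"
  then obtain l w' where lw: "w = l # w'" by (cases w) auto
  have "\<exists>\<delta> P s. approx (let f = (if fst l then symm h h' else symm g g') in (if snd l then f else inv f)) \<delta> P \<and>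
      evm P = smul s (outer (lvec l) (lvec l)) \<and> pow2 s" for l
    using g(2,3) h(2,3) by (cases l; cases "fst l"; cases "snd l") auto
  then obtain \<delta> P s l' where *: "approx (eval_word D (symm g g') (symm h h') w) \<delta> P"
    "evm P = smul s (outer (lvec l) (lvec l'))" "pow2 s"
    using word_approx[of "symm h h'" "symm g g'" l w'] w lw by blast
  show "eval_word D (symm g g') (symm h h') w \<noteq> \<one>"
  proof
    assume "eval_word D (symm g g') (symm h h') w = \<one>"
    then have "pred_mat2 zD (smul (poly \<delta> (- 1)) 1 - smul s (outer (lvec l) (lvec l')))"
      using approx_one_evm[of \<delta> P] * by simp
    then show False using rank_one_not_scalar * by blast
  qed
qed

end

section \<open>Generated division subrings\<close>

lemma div_generated_subset: "S \<subseteq> div_generated D S"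
  by (auto simp: div_generated_def)

lemma div_generated_minimal: "\<lbrakk>div_closed D T; S \<subseteq> T\<rbrakk> \<Longrightarrow> div_generated D S \<subseteq> T"
  by (auto simp: div_generated_def)

lemma (in ring) div_closed_carrier: "division_ring R \<Longrightarrow> div_closed R (carrier R)"
  unfolding div_closed_def using division_ring_inv(2) by simp

lemma (in ring) div_closed_div_generated:
  assumes "division_ring R" "S \<subseteq> carrier R"
  shows "div_closed R (div_generated R S)"
proof -
  have "div_generated R S \<subseteq> carrier R"
    using div_closed_carrier[OF assms(1)] assms(2) by (rule div_generated_minimal)
  then show ?thesis
    by (subst div_closed_def) (auto simp: div_generated_def div_closed_def)
qed

theorem theorem3p2:
  fixes K :: "'k ring" and G :: "'g monoid" and N :: "'g set"
    and D :: "'a ring" and \<psi> :: "'k \<Rightarrow> 'a" and \<phi> :: "'g \<Rightarrow> 'a"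
    and s :: "'g \<Rightarrow> 'g" and J :: "'a \<Rightarrow> 'a"
  assumes "field K"
    and "\<one>\<^bsub>K\<^esub> \<oplus>\<^bsub>K\<^esub> \<one>\<^bsub>K\<^esub> \<noteq> \<zero>\<^bsub>K\<^esub>"
    and "group G"
    and "group_involution G s"
    and "N \<lhd> G"
    and "s ` N \<subseteq> N"
    and "nonabelian (G Mod N)"
    and "torsion_free (G Mod N)"
    and "nilpotent_group (G Mod N)"
    and "division_ring D"
    and "group_algebra_embedding K G D \<psi> \<phi>"
    and "good_embedding K G N D \<psi> \<phi>"
    and "k_involution_extending K G D \<psi> \<phi> s J"
  shows "\<exists>u \<in> D_sub D \<psi> (carrier K) \<phi> (carrier G).
         \<exists>v \<in> D_sub D \<psi> (carrier K) \<phi> (carrier G). free_symmetric_pair D J u v"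
proof -
  interpret K: field K by (rule assms(1))
  interpret D: ring D using assms(10) by (simp add: division_ring_def)
  interpret G: normal N G by (rule assms(5))
  interpret Q: group "G Mod N" by (rule G.factorgroup_is_group)

  have psi_hom: "\<psi> \<in> ring_hom K D"
    and psi_central: "\<And>a x. \<lbrakk>a \<in> carrier K; x \<in> carrier D\<rbrakk> \<Longrightarrow> \<psi> a \<otimes>\<^bsub>D\<^esub> x = x \<otimes>\<^bsub>D\<^esub> \<psi> a"
    and phi_closed: "\<And>g. g \<in> carrier G \<Longrightarrow> \<phi> g \<in> carrier D"
    and phi_one: "\<phi> \<one>\<^bsub>G\<^esub> = \<one>\<^bsub>D\<^esub>"
    and phi_mult: "\<And>g h. \<lbrakk>g \<in> carrier G; h \<in> carrier G\<rbrakk> \<Longrightarrow> \<phi> (g \<otimes>\<^bsub>G\<^esub> h) = \<phi> g \<otimes>\<^bsub>D\<^esub> \<phi> h"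
    and phi_indep: "\<And>A c. \<lbrakk>finite A; A \<subseteq> carrier G; c ` A \<subseteq> carrier K;
        (\<Oplus>\<^bsub>D\<^esub>g\<in>A. \<psi> (c g) \<otimes>\<^bsub>D\<^esub> \<phi> g) = \<zero>\<^bsub>D\<^esub>\<rbrakk> \<Longrightarrow> \<forall>g\<in>A. c g = \<zero>\<^bsub>K\<^esub>"
    using assms(11) unfolding group_algebra_embedding_def by auto
  interpret psi: ring_hom_ring K D \<psi>
    by (intro ring_hom_ringI2 K.ring_axioms D.ring_axioms psi_hom)
  have psi_closed: "\<psi> a \<in> carrier D" if "a \<in> carrier K" for a using that by simp

  define F where "F = D_sub D \<psi> (carrier K) \<phi> N"
  have N_sub: "N \<subseteq> carrier G" by (rule G.subset)
  have F_gen: "\<psi> ` carrier K \<union> \<phi> ` N \<subseteq> carrier D"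
    using phi_closed N_sub by auto
  have F: "div_closed D F"
    unfolding F_def D_sub_def by (rule D.div_closed_div_generated[OF assms(10) F_gen])
  have FN: "\<psi> a \<in> F" if "a \<in> carrier K" for a
    using that div_generated_subset[of "\<psi> ` carrier K \<union> \<phi> ` N" D] by (auto simp: F_def D_sub_def)
  have FP: "\<phi> g \<in> F" if "g \<in> N" for g
    using that div_generated_subset[of "\<psi> ` carrier K \<union> \<phi> ` N" D] by (auto simp: F_def D_sub_def)
  have Fc: "f \<in> carrier D" if "f \<in> F" for f
    using F that by (auto simp: div_closed_def)
  have phi_inv: "\<phi> g \<otimes>\<^bsub>D\<^esub> \<phi> (inv\<^bsub>G\<^esub> g) = \<one>\<^bsub>D\<^esub>" "\<phi> (inv\<^bsub>G\<^esub> g) \<otimes>\<^bsub>D\<^esub> \<phi> g = \<one>\<^bsub>D\<^esub>" if "g \<in> carrier G" for g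
    using that phi_mult[of g "inv\<^bsub>G\<^esub> g"] phi_mult[of "inv\<^bsub>G\<^esub> g" g] phi_one by auto
  \<comment> \<open>The set \<open>T\<close> of elements conjugated into \<open>F\<close> is closed
    under the division ring operations. It contains the scalars, which are central, and the image of
    \<open>N\<close>, which is normal, hence all of \<open>F\<close>.\<close>
  have conj: "\<phi> g \<otimes>\<^bsub>D\<^esub> f \<otimes>\<^bsub>D\<^esub> \<phi> (inv\<^bsub>G\<^esub> g) \<in> F" if g: "g \<in> carrier G" and f: "f \<in> F" for g f
  proof -
    define p q where "p = \<phi> g" and "q = \<phi> (inv\<^bsub>G\<^esub> g)"
    have pq: "p \<in> carrier D" "q \<in> carrier D" "p \<otimes>\<^bsub>D\<^esub> q = \<one>\<^bsub>D\<^esub>" "q \<otimes>\<^bsub>D\<^esub> p = \<one>\<^bsub>D\<^esub>"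
      using g phi_closed phi_inv by (auto simp: p_def q_def)
    have qp: "q \<otimes>\<^bsub>D\<^esub> (p \<otimes>\<^bsub>D\<^esub> a) = a" if "a \<in> carrier D" for a
      using pq that by (simp flip: D.m_assoc)
    define T where "T = {f \<in> carrier D. p \<otimes>\<^bsub>D\<^esub> f \<otimes>\<^bsub>D\<^esub> q \<in> F}"
    have FD: "\<zero>\<^bsub>D\<^esub> \<in> F" "\<one>\<^bsub>D\<^esub> \<in> F" "\<And>a b. \<lbrakk>a \<in> F; b \<in> F\<rbrakk> \<Longrightarrow> a \<oplus>\<^bsub>D\<^esub> b \<in> F"
      "\<And>a b. \<lbrakk>a \<in> F; b \<in> F\<rbrakk> \<Longrightarrow> a \<otimes>\<^bsub>D\<^esub> b \<in> F" "\<And>a. a \<in> F \<Longrightarrow> \<ominus>\<^bsub>D\<^esub> a \<in> F"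
      "\<And>a. \<lbrakk>a \<in> F; a \<noteq> \<zero>\<^bsub>D\<^esub>\<rbrakk> \<Longrightarrow> inv\<^bsub>D\<^esub> a \<in> F"
      using F by (auto simp: div_closed_def)
    have "div_closed D T"
      unfolding div_closed_def
    proof (intro conjI ballI)
      show "T \<subseteq> carrier D" "\<zero>\<^bsub>D\<^esub> \<in> T" "\<one>\<^bsub>D\<^esub> \<in> T" using FD pq by (auto simp: T_def)
    next
      fix a b assume ab: "a \<in> T" "b \<in> T"
      then have c: "a \<in> carrier D" "b \<in> carrier D" by (auto simp: T_def)
      have "p \<otimes>\<^bsub>D\<^esub> (a \<oplus>\<^bsub>D\<^esub> b) \<otimes>\<^bsub>D\<^esub> q = p \<otimes>\<^bsub>D\<^esub> a \<otimes>\<^bsub>D\<^esub> q \<oplus>\<^bsub>D\<^esub> p \<otimes>\<^bsub>D\<^esub> b \<otimes>\<^bsub>D\<^esub> q"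
        using c pq by (simp add: D.l_distr D.r_distr)
      then show "a \<oplus>\<^bsub>D\<^esub> b \<in> T" using ab c FD(3) by (simp add: T_def)
      have "p \<otimes>\<^bsub>D\<^esub> (a \<otimes>\<^bsub>D\<^esub> b) \<otimes>\<^bsub>D\<^esub> q = (p \<otimes>\<^bsub>D\<^esub> a \<otimes>\<^bsub>D\<^esub> q) \<otimes>\<^bsub>D\<^esub> (p \<otimes>\<^bsub>D\<^esub> b \<otimes>\<^bsub>D\<^esub> q)"
        using c pq qp by (simp add: D.m_assoc)
      then show "a \<otimes>\<^bsub>D\<^esub> b \<in> T" using ab c FD(4) by (simp add: T_def)
    next
      fix a assume a: "a \<in> T"
      then have c: "a \<in> carrier D" by (auto simp: T_def)
      have "p \<otimes>\<^bsub>D\<^esub> (\<ominus>\<^bsub>D\<^esub> a) \<otimes>\<^bsub>D\<^esub> q = \<ominus>\<^bsub>D\<^esub> (p \<otimes>\<^bsub>D\<^esub> a \<otimes>\<^bsub>D\<^esub> q)"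
        using c pq by (simp add: D.l_minus D.r_minus)
      then show "\<ominus>\<^bsub>D\<^esub> a \<in> T" using a c FD(5) by (simp add: T_def)
    next
      fix a assume a: "a \<in> T - {\<zero>\<^bsub>D\<^esub>}"
      then have c: "a \<in> carrier D" "a \<noteq> \<zero>\<^bsub>D\<^esub>" by (auto simp: T_def)
      note ai = D.division_ring_inv[OF assms(10) c]
      let ?b = "p \<otimes>\<^bsub>D\<^esub> a \<otimes>\<^bsub>D\<^esub> q" and ?c = "p \<otimes>\<^bsub>D\<^esub> inv\<^bsub>D\<^esub> a \<otimes>\<^bsub>D\<^esub> q"
      have aai: "a \<otimes>\<^bsub>D\<^esub> (inv\<^bsub>D\<^esub> a \<otimes>\<^bsub>D\<^esub> q) = q" "inv\<^bsub>D\<^esub> a \<otimes>\<^bsub>D\<^esub> (a \<otimes>\<^bsub>D\<^esub> q) = q"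
        using ai c pq by (simp_all flip: D.m_assoc)
      have bc: "?b \<otimes>\<^bsub>D\<^esub> ?c = \<one>\<^bsub>D\<^esub>" "?c \<otimes>\<^bsub>D\<^esub> ?b = \<one>\<^bsub>D\<^esub>"
        using ai(2) c pq qp aai by (simp_all add: D.m_assoc)
      have cl: "?b \<in> carrier D" "?c \<in> carrier D" using ai c pq by auto
      have "\<one>\<^bsub>D\<^esub> \<noteq> \<zero>\<^bsub>D\<^esub>" using assms(10) by (simp add: division_ring_def)
      then have "?b \<noteq> \<zero>\<^bsub>D\<^esub>" using bc(1) cl(2) by auto
      then have "inv\<^bsub>D\<^esub> ?b \<in> F" using a FD(6) by (simp add: T_def)
      moreover have "inv\<^bsub>D\<^esub> ?b = ?c"
        using bc cl by (intro D.inv_unique'[symmetric]) auto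
      ultimately show "inv\<^bsub>D\<^esub> a \<in> T" using ai by (simp add: T_def)
    qed
    moreover have "\<psi> ` carrier K \<union> \<phi> ` N \<subseteq> T"
    proof (intro Un_least image_subsetI)
      fix a assume a: "a \<in> carrier K"
      have "p \<otimes>\<^bsub>D\<^esub> \<psi> a \<otimes>\<^bsub>D\<^esub> q = \<psi> a \<otimes>\<^bsub>D\<^esub> (p \<otimes>\<^bsub>D\<^esub> q)"
        using psi_central[OF a pq(1)] D.m_assoc[OF psi_closed[OF a] pq(1,2)] by simp
      then show "\<psi> a \<in> T" using a pq FN by (simp add: T_def)
    next
      fix n assume n: "n \<in> N"
      then have nc: "n \<in> carrier G" using N_sub by blast
      have "p \<otimes>\<^bsub>D\<^esub> \<phi> n \<otimes>\<^bsub>D\<^esub> q = \<phi> (g \<otimes>\<^bsub>G\<^esub> n \<otimes>\<^bsub>G\<^esub> inv\<^bsub>G\<^esub> g)"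
        using g nc phi_mult by (simp add: p_def q_def)
      then show "\<phi> n \<in> T" using FP G.inv_op_closed2[OF g n] nc phi_closed by (simp add: T_def)
    qed
    ultimately have "F \<subseteq> T" unfolding F_def D_sub_def by (rule div_generated_minimal)
    then show ?thesis using f by (auto simp: T_def p_def q_def)
  qed

  note good = assms(12)[unfolded good_embedding_def F_def[symmetric]]
  from good[THEN conjunct2, THEN conjunct2] obtain \<xi>
    where \<xi>: "(\<forall>\<alpha> \<in> carrier (G Mod N). \<xi> \<alpha> \<in> \<alpha>) \<and>
        (\<forall>A c. finite A \<longrightarrow> A \<subseteq> carrier (G Mod N) \<longrightarrow> c ` A \<subseteq> F \<longrightarrow>
           (\<Oplus>\<^bsub>D\<^esub> \<alpha> \<in> A. c \<alpha> \<otimes>\<^bsub>D\<^esub> \<phi> (\<xi> \<alpha>)) = \<zero>\<^bsub>D\<^esub> \<longrightarrow> (\<forall>\<alpha> \<in> A. c \<alpha> = \<zero>\<^bsub>D\<^esub>))"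
    by (rule exE)
  have xi: "\<xi> \<alpha> \<in> \<alpha>" if "\<alpha> \<in> carrier (G Mod N)" for \<alpha>
    using \<xi>[THEN conjunct1] that by (rule bspec)
  have xi_indep: "\<forall>\<alpha>\<in>A. c \<alpha> = \<zero>\<^bsub>D\<^esub>"
    if "finite A" "A \<subseteq> carrier (G Mod N)" "c ` A \<subseteq> F" "(\<Oplus>\<^bsub>D\<^esub>\<alpha>\<in>A. c \<alpha> \<otimes>\<^bsub>D\<^esub> \<phi> (\<xi> \<alpha>)) = \<zero>\<^bsub>D\<^esub>" for A c
    by (rule \<xi>[THEN conjunct2, THEN spec, THEN spec, THEN mp, THEN mp, THEN mp, THEN mp]) (rule that)+
  have cp_Ore: "ore_domain (crossed_product E (G Mod N) \<sigma> \<tau>)"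
    if "division_ring E" "crossed_product_data E (G Mod N) \<sigma> \<tau>" for E :: "'a ring" and \<sigma> \<tau>
    using good[THEN conjunct2, THEN conjunct1] that by blast
  interpret gd: graded_division D G N F \<phi> \<xi>
    by (intro graded_division.intro graded_division_axioms.intro D.ring_axioms G.normal_axioms
        assms(10) F phi_closed phi_one phi_mult FP conj xi xi_indep)

  have t: "group_involution (G Mod N) (\<lambda>C. s ` C)"
    by (rule G.involution_FactGroup[OF assms(4,6)])
  obtain x y where x: "x \<in> carrier (G Mod N)" and y: "y \<in> carrier (G Mod N)"
    and sx: "s ` x = x \<or> s ` x = inv\<^bsub>G Mod N\<^esub> x" and sy: "s ` y = y \<or> s ` y = inv\<^bsub>G Mod N\<^esub> y"
    and xy: "commutator (G Mod N) x y \<noteq> \<one>\<^bsub>G Mod N\<^esub>"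
      "\<And>q. q \<in> carrier (G Mod N) \<Longrightarrow> commutator (G Mod N) x y \<otimes>\<^bsub>G Mod N\<^esub> q = q \<otimes>\<^bsub>G Mod N\<^esub> commutator (G Mod N) x y"
    using Q.heisenberg_pair_exists[OF assms(9,7,8) t] by blast

  \<comment> \<open>Integer combinations in \<open>D\<close> are images of combinations over the
    prime ring of \<open>K\<close>, so independence over \<open>K\<close> applies to them.\<close>
  have psi_int: "\<psi> ([k] \<cdot>\<^bsub>K\<^esub> \<one>\<^bsub>K\<^esub>) = [k] \<cdot>\<^bsub>D\<^esub> \<one>\<^bsub>D\<^esub>" for k :: int
  proof -
    have "\<psi> ([int m] \<cdot>\<^bsub>K\<^esub> \<one>\<^bsub>K\<^esub>) = [int m] \<cdot>\<^bsub>D\<^esub> \<one>\<^bsub>D\<^esub>" for m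
    proof (induction m)
      case 0
      then show ?case by (simp add: add_pow_def)
    next
      case (Suc m)
      then show ?case by (simp add: K.add.int_pow_mult D.add.int_pow_mult)
    qed
    then show ?thesis
      by (cases k rule: int_cases2) (auto simp: K.add.int_pow_neg D.add.int_pow_neg)
  qed
  have int_indep: "[(c g)] \<cdot>\<^bsub>D\<^esub> \<one>\<^bsub>D\<^esub> = \<zero>\<^bsub>D\<^esub>"
    if A: "finite A" "A \<subseteq> carrier G" "(\<Oplus>\<^bsub>D\<^esub>g\<in>A. [(c g)] \<cdot>\<^bsub>D\<^esub> \<phi> g) = \<zero>\<^bsub>D\<^esub>" "g \<in> A" for A and c :: "'g \<Rightarrow> int" and g
  proof -
    have "(\<Oplus>\<^bsub>D\<^esub>g\<in>A. \<psi> ([(c g)] \<cdot>\<^bsub>K\<^esub> \<one>\<^bsub>K\<^esub>) \<otimes>\<^bsub>D\<^esub> \<phi> g) = (\<Oplus>\<^bsub>D\<^esub>g\<in>A. [(c g)] \<cdot>\<^bsub>D\<^esub> \<phi> g)"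
      using A phi_closed
      by (intro D.finsum_cong') (auto simp: psi_int D.add_pow_ldistr_int subset_iff)
    then have "[(c g)] \<cdot>\<^bsub>K\<^esub> \<one>\<^bsub>K\<^esub> = \<zero>\<^bsub>K\<^esub>"
      using phi_indep[of A "\<lambda>g. [(c g)] \<cdot>\<^bsub>K\<^esub> \<one>\<^bsub>K\<^esub>"] A by auto
    then show ?thesis using psi_int[of "c g"] by simp
  qed
  have two: "\<one>\<^bsub>D\<^esub> \<oplus>\<^bsub>D\<^esub> \<one>\<^bsub>D\<^esub> \<noteq> \<zero>\<^bsub>D\<^esub>"
  proof
    assume "\<one>\<^bsub>D\<^esub> \<oplus>\<^bsub>D\<^esub> \<one>\<^bsub>D\<^esub> = \<zero>\<^bsub>D\<^esub>"
    then have "\<psi> (\<one>\<^bsub>K\<^esub> \<oplus>\<^bsub>K\<^esub> \<one>\<^bsub>K\<^esub>) = \<zero>\<^bsub>D\<^esub>" by simp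
    then show False
      using phi_indep[of "{\<one>\<^bsub>G\<^esub>}" "\<lambda>_. \<one>\<^bsub>K\<^esub> \<oplus>\<^bsub>K\<^esub> \<one>\<^bsub>K\<^esub>"] assms(2) phi_one by simp
  qed

  interpret H: free_pair_setup D G N F \<phi> \<xi> x y
    by (intro free_pair_setup.intro free_pair_setup_axioms.intro heisenberg_division.intro
        heisenberg_division_axioms.intro heisenberg_pair.intro heisenberg_pair_axioms.intro
        gd.graded_division_axioms Q.is_group x y assms(8) xy int_indep two
        cp_Ore[OF gd.F_ring_division gd.crossed_product_data])

  define g h where "g = \<xi> x" and "h = \<xi> y"
  have g: "g \<in> H.lam (gen False)" and h: "h \<in> H.lam (gen True)"
    using xi x y by (auto simp: g_def h_def gen_def H.HQ.lam.simps simp del: carrier_FactGroup one_FactGroup mult_FactGroup)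
  have lx: "H.lam (gen False) = x" and ly: "H.lam (gen True) = y"
    using x y by (simp_all add: gen_def H.HQ.lam.simps del: carrier_FactGroup one_FactGroup mult_FactGroup)
  \<comment> \<open>\<open>s g\<close> lies in the image of the coset \<open>x\<close>, which is
    \<open>x\<close> or its inverse by the choice of the pair; these are the two cases of
    \<open>free_pair_symm\<close>.\<close>
  have sg: "s g \<in> H.lam (gen False) \<or> s g \<in> H.lam (hinv (gen False))"
    using sx g unfolding H.HQ.lam_hinv lx by blast
  have sh: "s h \<in> H.lam (gen True) \<or> s h \<in> H.lam (hinv (gen True))"
    using sy h unfolding H.HQ.lam_hinv ly by blast
  have free: "free_pair D (H.symm g (s g)) (H.symm h (s h))"
    by (rule H.free_pair_symm[OF g sg h sh])

  have J: "\<And>a b. \<lbrakk>a \<in> carrier D; b \<in> carrier D\<rbrakk> \<Longrightarrow> J (a \<oplus>\<^bsub>D\<^esub> b) = J a \<oplus>\<^bsub>D\<^esub> J b"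
    "\<And>a b. \<lbrakk>a \<in> carrier D; b \<in> carrier D\<rbrakk> \<Longrightarrow> J (a \<otimes>\<^bsub>D\<^esub> b) = J b \<otimes>\<^bsub>D\<^esub> J a"
    "\<And>g. g \<in> carrier G \<Longrightarrow> J (\<phi> g) = \<phi> (s g)"
    using assms(13) by (auto simp: k_involution_extending_def)
  have s: "\<And>g. g \<in> carrier G \<Longrightarrow> s g \<in> carrier G" "\<And>g. g \<in> carrier G \<Longrightarrow> s (s g) = g"
    using assms(4) by (auto simp: group_involution_def)
  have J1: "J \<one>\<^bsub>D\<^esub> = \<one>\<^bsub>D\<^esub>"
    using J(3)[of "\<one>\<^bsub>G\<^esub>"] G.involution_one_inv(1)[OF assms(4)] phi_one by simp
  \<comment> \<open>The involution interchanges the two binomials, and reversing the product puts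
    them back in place.\<close>
  have sym: "J (H.symm k (s k)) = H.symm k (s k)" if "k \<in> carrier G" for k
    using that s phi_closed by (simp add: H.symm_def J J1)
  let ?DG = "D_sub D \<psi> (carrier K) \<phi> (carrier G)"
  have DG: "div_closed D ?DG" unfolding D_sub_def
    by (rule D.div_closed_div_generated[OF assms(10)]) (use phi_closed in auto)
  have DGphi: "\<phi> k \<in> ?DG" if "k \<in> carrier G" for k
    using that div_generated_subset[of "\<psi> ` carrier K \<union> \<phi> ` carrier G" D] by (auto simp: D_sub_def)
  have mem: "H.symm k (s k) \<in> ?DG" if "k \<in> carrier G" for k
    using that DG DGphi s unfolding H.symm_def div_closed_def by simp
  have "g \<in> carrier G" "h \<in> carrier G" using g h by auto
  then show ?thesis
    using free sym mem unfolding free_symmetric_pair_def by blast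
qed

end
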